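(* Let $g\ge 1$ and $k,n\ge 3$. There is a canonical isomorphism of groups $\iota: G_\Sigma\to G_k(\widehat\Sigma_g)$ (sending each generator $\sigma,\zeta,a_i,b_i$ of $G_\Sigma$ to the element of the same name). Moreover $\iota\circ\Phi_\Sigma=\Phi_k$ as homomorphisms $B_k(\widehat\Sigma_{g,n})\to G_k(\widehat\Sigma_g)$.
   Context: For a connected surface $\Sigma$, $\mathbb F_m(\Sigma)=\{(x_1,\dots,x_m)\in\Sigma^m: x_i\neq x_j\ (i\ne j)\}$, $B_n(\Sigma)=\pi_1(\mathbb F_n(\Sigma)/S_n)$ (braid group), $B_{k,n}(\Sigma)=\pi_1(\mathbb F_{k+n}(\Sigma)/(S_k\times S_n))$ (mixed braid group). $\widehat\Sigma_g$ is a compact connected orientable surface of genus $g$ with one boundary component, and $\widehat\Sigma_{g,n}$ is $\widehat\Sigma_g$ minus $n$ interior points. $\Gamma_1(G)=G$, $\Gamma_i(G)=[G,\Gamma_{i-1}(G)]$; $[x,y]=xyx^{-1}y^{-1}$, $x^y=y^{-1}xy$. Presentation of $B_{k,n}(\widehat\Sigma_g)$. Generators: $S=\{\sigma_1,\dots,\sigma_{k-1}\}$, $\widetilde S=\{\tilde\sigma_1,\dots,\tilde\sigma_{n-1}\}$, $AB=\{a_1,b_1,\dots,a_g,b_g\}$, $\widetilde{AB}=\{\tilde a_1,\tilde b_1,\dots,\tilde a_g,\tilde b_g\}$, $Z=\{\zeta_1,\dots,\zeta_n\}$. Write $c<d$ for $c\in\{a_i,b_i\}$, $d\in\{a_j,b_j\}$,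 $i<j$. Relations (for all indices for which they make sense): (a) $\sigma_i\sigma_j=\sigma_j\sigma_i$ for $|i-j|\ge2$; $\sigma_i\sigma_{i+1}\sigma_i=\sigma_{i+1}\sigma_i\sigma_{i+1}$; $c\sigma_i=\sigma_ic$ for $i\neq1$, $c\in AB\cup Z$; $c\sigma_1c\sigma_1=\sigma_1c\sigma_1c$ for $c\in AB\cup Z$; $a_i\sigma_1b_i=\sigma_1b_i\sigma_1a_i\sigma_1$; $\sigma_1^{-1}c\sigma_1$ commutes with $d$ for $c,d\in AB$, $c<d$; $\sigma_1^{-1}\zeta_i\sigma_1$ commutes with every $c\in AB$, and with $\zeta_j$ for $i<j$. (b) The relations of (a) among $S\cup AB$ only, with $k$ replaced by $n$ and $\sigma_i,a_i,b_i$ by $\tilde\sigma_i,\tilde a_i,\tilde b_i$. (c) $\tilde\sigma_i,\tilde a_i,\tilde b_i$ commute with every $\sigma_j$; $\tilde\sigma_i$ commutes with $a_j,b_j$; $\tilde\sigma_i\zeta_{i+1}\tilde\sigma_i^{-1}=\zeta_i$; $\tilde\sigma_i\zeta_i\tilde\sigma_i^{-1}=\zeta_i^{-1}\zeta_{i+1}\zeta_i$; $\tilde\sigma_i\zeta_j\tilde\sigma_i^{-1}=\zeta_j$ for $j\ne i,i+1$; for $(\tilde x,x)=(\tilde a_i,a_i)$ or $(\tilde b_i,b_i)$: $\tilde x\zeta_1\tilde x^{-1}=\zeta_1^{x\zeta_1}$, $\tilde x\zeta_j\tilde x^{-1}=\zeta_j^{[x^{-1},\zeta_1^{-1}]}$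 for $j\ne1$, $\tilde xx\tilde x^{-1}=\zeta_1^{-1}x\zeta_1$, and for $d\in\{a_j,b_j\}$, $\tilde xd\tilde x^{-1}=d^{[x^{-1},\zeta_1^{-1}]}$ if $i>j$, $\tilde xd\tilde x^{-1}=d$ if $j>i$; $\tilde a_ib_i\tilde a_i^{-1}=b_i\zeta_1$; $\tilde b_ia_i\tilde b_i^{-1}=\zeta_1^{-1}a_i[b_i^{-1},\zeta_1^{-1}]$. The epimorphism $\psi_k:B_{k,n}(\widehat\Sigma_g)\to B_n(\widehat\Sigma_g)$ forgets the first $k$ strings: it kills $S\cup AB\cup Z$ and maps $\widetilde S\cup\widetilde{AB}$ to the standard generators of $B_n(\widehat\Sigma_g)$ (which has the presentation with generators $\widetilde S\cup\widetilde{AB}$ and relations (b)). Its kernel is $B_k(\widehat\Sigma_{g,n})$, which is generated by $S\cup AB\cup Z$ with defining relations (a). $\rho_{k,n}:B_{k,n}(\widehat\Sigma_g)\to B_{k,n}(\widehat\Sigma_g)/\Gamma_3(B_{k,n}(\widehat\Sigma_g))$ is the canonical projection; $\overline\psi_k: B_{k,n}(\widehat\Sigma_g)/\Gamma_3(B_{k,n}(\widehat\Sigma_g))\to B_n(\widehat\Sigma_g)/\Gamma_3(B_n(\widehat\Sigma_g))$ is induced by $\psi_k$; $G_k(\widehat\Sigma_g)=\ker\overline\psi_k$; $\Phi_k:B_k(\widehat\Sigma_{g,n})\to G_k(\widehat\Sigma_g)$ is the restriction of $\rho_{k,n}$. In $G_k(\widehat\Sigma_g)$, the elements named $a_i,b_i$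 are the images under $\Phi_k$ of the generators $a_i,b_i$, and $\sigma$, $\zeta$ are the common images of the $\sigma_i$ and of the $\zeta_i$ respectively. The group $G_\Sigma$ (of An and Ko) is the group with generators $\sigma,\zeta,a_1,b_1,\dots,a_g,b_g$ and relations: any two distinct generators commute except the pairs $\{a_i,b_i\}$, and $[a_i,b_i]=\sigma^2$ for $i=1,\dots,g$. The homomorphism $\Phi_\Sigma:B_k(\widehat\Sigma_{g,n})\to G_\Sigma$ is given by $\sigma_i\mapsto\sigma$, $\zeta_i\mapsto\zeta$, $a_i\mapsto a_i$, $b_i\mapsto b_i$. *)

theory Defs
  imports "HOL-Analysis.Analysis" "HOL-Homology.Homology" "HOL-Combinatorics.Permutations"
begin

section \<open>Groups given by generators and relations\<close>

text \<open>A word is a list of signed letters; \<open>(s, True)\<close> stands for \<open>s\<close> and \<open>(s, False)\<close> for its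
  inverse. A relation \<open>u = v\<close> is the pair \<open>(u, v)\<close>.\<close>

type_synonym 'g word = "('g \<times> bool) list"

definition words :: "'g set \<Rightarrow> 'g word set" where
  "words S = lists (S \<times> UNIV)"

definition letter :: "'g \<Rightarrow> 'g word" where
  "letter s = [(s, True)]"

definition winv :: "'g word \<Rightarrow> 'g word" where
  "winv w = rev (map (\<lambda>(s, e). (s, \<not> e)) w)"

definition wcomm :: "'g word \<Rightarrow> 'g word \<Rightarrow> 'g word" where
  "wcomm x y = x @ y @ winv x @ winv y"

text \<open>\<open>wconj x y\<close> is $x^y = y^{-1} x y$.\<close>

definition wconj :: "'g word \<Rightarrow> 'g word \<Rightarrow> 'g word" where
  "wconj x y = winv y @ x @ y"

inductive word_eq :: "'g set \<Rightarrow> ('g word \<times> 'g word) set \<Rightarrow> 'g word \<Rightarrow> 'g word \<Rightarrow> bool"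
  for S :: "'g set" and R :: "('g word \<times> 'g word) set" where
  refl: "w \<in> words S \<Longrightarrow> word_eq S R w w"
| sym: "word_eq S R u v \<Longrightarrow> word_eq S R v u"
| trans: "word_eq S R u v \<Longrightarrow> word_eq S R v w \<Longrightarrow> word_eq S R u w"
| append: "word_eq S R u u' \<Longrightarrow> word_eq S R v v' \<Longrightarrow> word_eq S R (u @ v) (u' @ v')"
| cancel: "s \<in> S \<Longrightarrow> word_eq S R [(s, e), (s, \<not> e)] []"
| rel: "(u, v) \<in> R \<Longrightarrow> u \<in> words S \<Longrightarrow> v \<in> words S \<Longrightarrow> word_eq S R u v"

definition word_class :: "'g set \<Rightarrow> ('g word \<times> 'g word) set \<Rightarrow> 'g word \<Rightarrow> 'g word set" where
  "word_class S R w = {v. word_eq S R w v}"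

definition presented_group :: "'g set \<Rightarrow> ('g word \<times> 'g word) set \<Rightarrow> 'g word set monoid" where
  "presented_group S R =
     \<lparr>carrier = word_class S R ` words S,
      monoid.mult = (\<lambda>A B. {w. \<exists>u\<in>A. \<exists>v\<in>B. word_eq S R (u @ v) w}),
      one = word_class S R []\<rparr>"

text \<open>The elements \<open>\<gamma> s\<close> of \<open>G\<close>, for \<open>s \<in> S\<close>, generate \<open>G\<close> with defining relations \<open>R\<close>.\<close>

definition presents ::
    "'g set \<Rightarrow> ('g word \<times> 'g word) set \<Rightarrow> ('g \<Rightarrow> 'b) \<Rightarrow> ('b, 'm) monoid_scheme \<Rightarrow> bool" where
  "presents S R \<gamma> G \<longleftrightarrow> group G \<and>
     (\<exists>\<phi> \<in> iso (presented_group S R) G. \<forall>s\<in>S. \<phi> (word_class S R (letter s)) = \<gamma> s)"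

lemma word_eq_in_words:
  assumes "word_eq S R u v"
  shows "u \<in> words S \<and> v \<in> words S"
  using assms by induction (auto simp: words_def)

lemma word_class_eq_iff:
  assumes "u \<in> words S"
  shows "word_class S R u = word_class S R v \<longleftrightarrow> word_eq S R u v"
  using assms unfolding word_class_def
  by (auto dest: word_eq.refl word_eq.sym word_eq.trans word_eq_in_words)

lemma mult_presented_group:
  assumes "u \<in> words S" "v \<in> words S"
  shows "word_class S R u \<otimes>\<^bsub>presented_group S R\<^esub> word_class S R v = word_class S R (u @ v)"
  using assms unfolding presented_group_def word_class_def
  by (auto intro: word_eq.append word_eq.trans word_eq.refl)

lemma word_eq_winv:
  assumes "w \<in> words S"
  shows "word_eq S R (winv w @ w) []"
  using assms
proof (induction w)
  case Nil
  then show ?case by (auto simp: winv_def words_def intro: word_eq.refl)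
next
  case (Cons x w)
  obtain s e where x: "x = (s, e)" by (cases x)
  have s: "s \<in> S" and w: "w \<in> words S" using Cons.prems x by (auto simp: words_def)
  have wi: "winv w \<in> words S" using w by (auto simp: words_def winv_def)
  have "word_eq S R ([(s, \<not> e), (s, \<not> \<not> e)] @ w) ([] @ w)"
    by (rule word_eq.append[OF word_eq.cancel[OF s] word_eq.refl[OF w]])
  from word_eq.append[OF word_eq.refl[OF wi] this]
  have "word_eq S R (winv w @ [(s, \<not> e), (s, e)] @ w) (winv w @ w)" by simp
  then have "word_eq S R (winv (x # w) @ x # w) (winv w @ w)" using x by (simp add: winv_def)
  then show ?case using Cons.IH[OF w] by (rule word_eq.trans)
qed

lemma group_presented_group: "group (presented_group S R)"
proof (rule groupI)
  let ?G = "presented_group S R"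
  have c: "carrier ?G = word_class S R ` words S" and o: "\<one>\<^bsub>?G\<^esub> = word_class S R []"
    by (auto simp: presented_group_def)
  have app: "u @ v \<in> words S" if "u \<in> words S" "v \<in> words S" for u v :: "'a word"
    using that by (auto simp: words_def)
  have nil: "[] \<in> words S" by (simp add: words_def)
  show "\<one>\<^bsub>?G\<^esub> \<in> carrier ?G" using c o nil by auto
  show "x \<otimes>\<^bsub>?G\<^esub> y \<in> carrier ?G" if "x \<in> carrier ?G" "y \<in> carrier ?G" for x y
    using that by (auto simp: c mult_presented_group app)
  show "x \<otimes>\<^bsub>?G\<^esub> y \<otimes>\<^bsub>?G\<^esub> z = x \<otimes>\<^bsub>?G\<^esub> (y \<otimes>\<^bsub>?G\<^esub> z)"
    if "x \<in> carrier ?G" "y \<in> carrier ?G" "z \<in> carrier ?G" for x y z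
    using that by (auto simp: c mult_presented_group app)
  show "\<one>\<^bsub>?G\<^esub> \<otimes>\<^bsub>?G\<^esub> x = x" if "x \<in> carrier ?G" for x
    using that by (auto simp: c o mult_presented_group nil)
  show "\<exists>y\<in>carrier ?G. y \<otimes>\<^bsub>?G\<^esub> x = \<one>\<^bsub>?G\<^esub>" if x: "x \<in> carrier ?G" for x
  proof -
    obtain w where w: "w \<in> words S" "x = word_class S R w" using x c by auto
    have wi: "winv w \<in> words S" using w by (auto simp: words_def winv_def)
    have "word_class S R (winv w) \<otimes>\<^bsub>?G\<^esub> x = \<one>\<^bsub>?G\<^esub>"
      using word_class_eq_iff[OF app[OF wi w(1)]] word_eq_winv[OF w(1)]
      by (simp add: w mult_presented_group wi o)
    then show ?thesis using c wi by blast
  qed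
qed

section \<open>Surfaces\<close>

definition half_plane :: "(real \<times> real) set" where
  "half_plane = {p. 0 \<le> snd p}"

definition surface_with_boundary :: "'a topology \<Rightarrow> bool" where
  "surface_with_boundary X \<longleftrightarrow> Hausdorff_space X \<and> second_countable X \<and>
     (\<forall>x\<in>topspace X. \<exists>U V. openin X U \<and> x \<in> U \<and> openin (top_of_set half_plane) V \<and>
        subtopology X U homeomorphic_space top_of_set V)"

definition surface_interior :: "'a topology \<Rightarrow> 'a set" where
  "surface_interior X = {x\<in>topspace X. \<exists>U V. openin X U \<and> x \<in> U \<and> open (V :: (real \<times> real) set) \<and>
     subtopology X U homeomorphic_space top_of_set V}"

definition surface_boundary :: "'a topology \<Rightarrow> 'a set" where
  "surface_boundary X = topspace X - surface_interior X"

text \<open>Orientability in terms of a locally consistent choice of generators of the local homology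
  groups $H_2(M, M - x)$ of the interior.\<close>

definition orientable_surface :: "'a topology \<Rightarrow> bool" where
  "orientable_surface X \<longleftrightarrow>
     (let M = subtopology X (surface_interior X);
          H = (\<lambda>U. relative_homology_group 2 M (topspace M - U))
      in \<exists>\<mu>. (\<forall>x\<in>topspace M. \<mu> x \<in> carrier (H {x}) \<and> generate (H {x}) {\<mu> x} = carrier (H {x})) \<and>
             (\<forall>x\<in>topspace M. \<exists>U. openin M U \<and> x \<in> U \<and>
                (\<exists>\<nu>\<in>carrier (H U). \<forall>y\<in>U.
                   hom_induced 2 M (topspace M - U) M (topspace M - {y}) id \<nu> = \<mu> y)))"

text \<open>The genus is the largest number of disjoint simple closed curves in the interior whose union
  does not separate the surface. The interior is essential: a boundary circle never separates.\<close>

definition nonseparating_system :: "'a topology \<Rightarrow> nat \<Rightarrow> (nat \<Rightarrow> 'a set) \<Rightarrow> bool" where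
  "nonseparating_system X m C \<longleftrightarrow>
     (\<forall>i<m. C i \<subseteq> surface_interior X \<and>
        subtopology X (C i) homeomorphic_space top_of_set (sphere (0::complex) 1)) \<and>
     (\<forall>i<m. \<forall>j<m. i \<noteq> j \<longrightarrow> C i \<inter> C j = {}) \<and>
     connectedin X (topspace X - (\<Union>i<m. C i))"

definition has_genus :: "'a topology \<Rightarrow> nat \<Rightarrow> bool" where
  "has_genus X g \<longleftrightarrow> (\<exists>C. nonseparating_system X g C) \<and>
     (\<forall>m C. nonseparating_system X m C \<longrightarrow> m \<le> g)"

definition compact_orientable_surface_1 :: "nat \<Rightarrow> 'a topology \<Rightarrow> bool" where
  "compact_orientable_surface_1 g X \<longleftrightarrow>
     surface_with_boundary X \<and> compact_space X \<and> connected_space X \<and> orientable_surface X \<and>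
     has_genus X g \<and> surface_boundary X \<noteq> {} \<and> connectedin X (surface_boundary X)"

section \<open>Fundamental groups\<close>

definition loops :: "'b topology \<Rightarrow> 'b \<Rightarrow> (real \<Rightarrow> 'b) set" where
  "loops Y y = {p. pathin Y p \<and> p 0 = y \<and> p 1 = y}"

definition loop_homotopic :: "'b topology \<Rightarrow> 'b \<Rightarrow> (real \<Rightarrow> 'b) \<Rightarrow> (real \<Rightarrow> 'b) \<Rightarrow> bool" where
  "loop_homotopic Y y p q \<longleftrightarrow>
     homotopic_with (\<lambda>h. h 0 = y \<and> h 1 = y) (top_of_set {0..1}) Y p q"

definition loop_join :: "(real \<Rightarrow> 'b) \<Rightarrow> (real \<Rightarrow> 'b) \<Rightarrow> real \<Rightarrow> 'b" where
  "loop_join p q = (\<lambda>t. if t \<le> 1/2 then p (2 * t) else q (2 * t - 1))"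

definition loop_class :: "'b topology \<Rightarrow> 'b \<Rightarrow> (real \<Rightarrow> 'b) \<Rightarrow> (real \<Rightarrow> 'b) set" where
  "loop_class Y y p = {q \<in> loops Y y. loop_homotopic Y y p q}"

definition pi1 :: "'b topology \<Rightarrow> 'b \<Rightarrow> (real \<Rightarrow> 'b) set monoid" where
  "pi1 Y y =
     \<lparr>carrier = loop_class Y y ` loops Y y,
      monoid.mult = (\<lambda>C D. \<Union>p\<in>C. \<Union>q\<in>D. loop_class Y y (loop_join p q)),
      one = loop_class Y y (\<lambda>_. y)\<rparr>"

text \<open>The homomorphism \<open>pi1 X x \<rightarrow> pi1 Y (f x)\<close> induced by a continuous map \<open>f\<close>; only the target
  is needed to describe it.\<close>

definition pi1_map ::
    "'c topology \<Rightarrow> 'c \<Rightarrow> ('b \<Rightarrow> 'c) \<Rightarrow> (real \<Rightarrow> 'b) set \<Rightarrow> (real \<Rightarrow> 'c) set" where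
  "pi1_map Y y f C = (\<Union>p\<in>C. loop_class Y y (f \<circ> p))"

section \<open>Configuration spaces and braid groups\<close>

definition quotient_topology :: "'b topology \<Rightarrow> ('b \<Rightarrow> 'c) \<Rightarrow> 'c topology" where
  "quotient_topology Y f =
     topology (\<lambda>U. U \<subseteq> f ` topspace Y \<and> openin Y {y \<in> topspace Y. f y \<in> U})"

lemma openin_quotient_topology:
  "openin (quotient_topology Y f) U \<longleftrightarrow>
     U \<subseteq> f ` topspace Y \<and> openin Y {y \<in> topspace Y. f y \<in> U}"
proof -
  have "istopology (\<lambda>U. U \<subseteq> f ` topspace Y \<and> openin Y {y \<in> topspace Y. f y \<in> U})"
    unfolding istopology_def
  proof (intro conjI allI impI)
    fix S T
    assume "S \<subseteq> f ` topspace Y \<and> openin Y {y \<in> topspace Y. f y \<in> S}"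
      and "T \<subseteq> f ` topspace Y \<and> openin Y {y \<in> topspace Y. f y \<in> T}"
    moreover have "{y \<in> topspace Y. f y \<in> S \<inter> T} =
        {y \<in> topspace Y. f y \<in> S} \<inter> {y \<in> topspace Y. f y \<in> T}" by auto
    ultimately show "S \<inter> T \<subseteq> f ` topspace Y" "openin Y {y \<in> topspace Y. f y \<in> S \<inter> T}"
      by auto
  next
    fix \<K>
    assume K: "\<forall>U\<in>\<K>. U \<subseteq> f ` topspace Y \<and> openin Y {y \<in> topspace Y. f y \<in> U}"
    show "\<Union>\<K> \<subseteq> f ` topspace Y" using K by auto
    have "{y \<in> topspace Y. f y \<in> \<Union>\<K>} = (\<Union>U\<in>\<K>. {y \<in> topspace Y. f y \<in> U})" by auto
    then show "openin Y {y \<in> topspace Y. f y \<in> \<Union>\<K>}" using K by auto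
  qed
  then show ?thesis by (simp add: quotient_topology_def)
qed

text \<open>The space $F_m(X)$; points of a configuration are numbered from \<open>0\<close>.\<close>

definition config_space :: "nat \<Rightarrow> 'a topology \<Rightarrow> (nat \<Rightarrow> 'a) topology" where
  "config_space m X = subtopology (product_topology (\<lambda>_. X) {..<m}) {x. inj_on x {..<m}}"

definition sym_perms :: "nat \<Rightarrow> (nat \<Rightarrow> nat) set" where
  "sym_perms m = {p. p permutes {..<m}}"

definition mixed_perms :: "nat \<Rightarrow> nat \<Rightarrow> (nat \<Rightarrow> nat) set" where
  "mixed_perms k n = {p. p permutes {..<k + n} \<and> p ` {..<k} = {..<k}}"

definition orbit_of :: "(nat \<Rightarrow> nat) set \<Rightarrow> (nat \<Rightarrow> 'a) \<Rightarrow> (nat \<Rightarrow> 'a) set" where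
  "orbit_of P x = {x \<circ> p |p. p \<in> P}"

definition braid_space :: "nat \<Rightarrow> 'a topology \<Rightarrow> (nat \<Rightarrow> 'a) set topology" where
  "braid_space m X = quotient_topology (config_space m X) (orbit_of (sym_perms m))"

definition mixed_braid_space :: "nat \<Rightarrow> nat \<Rightarrow> 'a topology \<Rightarrow> (nat \<Rightarrow> 'a) set topology" where
  "mixed_braid_space k n X =
     quotient_topology (config_space (k + n) X) (orbit_of (mixed_perms k n))"

type_synonym 'a braid = "(real \<Rightarrow> (nat \<Rightarrow> 'a) set) set"

definition braid_group :: "nat \<Rightarrow> 'a topology \<Rightarrow> (nat \<Rightarrow> 'a) \<Rightarrow> 'a braid monoid" where
  "braid_group m X c = pi1 (braid_space m X) (orbit_of (sym_perms m) c)"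

definition mixed_braid_group :: "nat \<Rightarrow> nat \<Rightarrow> 'a topology \<Rightarrow> (nat \<Rightarrow> 'a) \<Rightarrow> 'a braid monoid" where
  "mixed_braid_group k n X c = pi1 (mixed_braid_space k n X) (orbit_of (mixed_perms k n) c)"

definition first_points :: "nat \<Rightarrow> (nat \<Rightarrow> 'a) \<Rightarrow> nat \<Rightarrow> 'a" where
  "first_points k x = restrict x {..<k}"

definition last_points :: "nat \<Rightarrow> nat \<Rightarrow> (nat \<Rightarrow> 'a) \<Rightarrow> nat \<Rightarrow> 'a" where
  "last_points k n x = (\<lambda>i\<in>{..<n}. x (k + i))"

definition add_points :: "nat \<Rightarrow> nat \<Rightarrow> (nat \<Rightarrow> 'a) \<Rightarrow> (nat \<Rightarrow> 'a) \<Rightarrow> nat \<Rightarrow> 'a" where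
  "add_points k n c x = (\<lambda>i\<in>{..<k + n}. if i < k then x i else c i)"

text \<open>\<open>psi\<close> is induced by $F_{k+n}(X)/(S_k \times S_n) \to F_n(X)/S_n$, forgetting the first \<open>k\<close>
  points. It is applied to an orbit pointwise, which gives again an orbit.\<close>

definition psi :: "nat \<Rightarrow> nat \<Rightarrow> 'a topology \<Rightarrow> (nat \<Rightarrow> 'a) \<Rightarrow> 'a braid \<Rightarrow> 'a braid" where
  "psi k n X c =
     pi1_map (braid_space n X) (orbit_of (sym_perms n) (last_points k n c)) ((`) (last_points k n))"

text \<open>\<open>X\<close> without the last \<open>n\<close> points of the base configuration \<open>c\<close>, and the braid group
  $B_k$ of this punctured surface.\<close>

definition punctured :: "nat \<Rightarrow> nat \<Rightarrow> 'a topology \<Rightarrow> (nat \<Rightarrow> 'a) \<Rightarrow> 'a topology" where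
  "punctured k n X c = subtopology X (topspace X - c ` {k..<k + n})"

definition fibre_braid_group :: "nat \<Rightarrow> nat \<Rightarrow> 'a topology \<Rightarrow> (nat \<Rightarrow> 'a) \<Rightarrow> 'a braid monoid" where
  "fibre_braid_group k n X c = braid_group k (punctured k n X c) (first_points k c)"

text \<open>The map from $B_k$ of the punctured surface onto $\ker \psi_k$ induced by the inclusion of the
  fibre over the base point: the last \<open>n\<close> points stay at the punctures.\<close>

definition fibre_incl :: "nat \<Rightarrow> nat \<Rightarrow> 'a topology \<Rightarrow> (nat \<Rightarrow> 'a) \<Rightarrow> 'a braid \<Rightarrow> 'a braid" where
  "fibre_incl k n X c =
     pi1_map (mixed_braid_space k n X) (orbit_of (mixed_perms k n) c)
       (\<lambda>A. \<Union>x\<in>A. orbit_of (mixed_perms k n) (add_points k n c x))"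

section \<open>The presentation of the mixed braid group\<close>

text \<open>Primed generators are those with a tilde.\<close>

datatype bgen = Sig nat | Al nat | Be nat | Zet nat | Sig' nat | Al' nat | Be' nat

definition gens_fibre :: "nat \<Rightarrow> nat \<Rightarrow> nat \<Rightarrow> bgen set" where
  "gens_fibre k n g = Sig ` {1..<k} \<union> Al ` {1..g} \<union> Be ` {1..g} \<union> Zet ` {1..n}"

definition gens_base :: "nat \<Rightarrow> nat \<Rightarrow> bgen set" where
  "gens_base n g = Sig' ` {1..<n} \<union> Al' ` {1..g} \<union> Be' ` {1..g}"

inductive_set surface_rels ::
    "nat \<Rightarrow> nat \<Rightarrow> (nat \<Rightarrow> 'g word) \<Rightarrow> (nat \<Rightarrow> 'g word) \<Rightarrow> (nat \<Rightarrow> 'g word) \<Rightarrow> ('g word \<times> 'g word) set"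
  for m g :: nat and s a b :: "nat \<Rightarrow> 'g word" where
  "\<lbrakk>i \<in> {1..<m}; j \<in> {1..<m}; i + 2 \<le> j \<or> j + 2 \<le> i\<rbrakk>
    \<Longrightarrow> (s i @ s j, s j @ s i) \<in> surface_rels m g s a b"
| "\<lbrakk>i \<in> {1..<m}; i + 1 < m\<rbrakk>
    \<Longrightarrow> (s i @ s (i + 1) @ s i, s (i + 1) @ s i @ s (i + 1)) \<in> surface_rels m g s a b"
| "\<lbrakk>i \<in> {1..<m}; i \<noteq> 1; j \<in> {1..g}; c \<in> {a j, b j}\<rbrakk>
    \<Longrightarrow> (c @ s i, s i @ c) \<in> surface_rels m g s a b"
| "\<lbrakk>1 < m; j \<in> {1..g}; c \<in> {a j, b j}\<rbrakk>
    \<Longrightarrow> (c @ s 1 @ c @ s 1, s 1 @ c @ s 1 @ c) \<in> surface_rels m g s a b"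
| "\<lbrakk>1 < m; i \<in> {1..g}\<rbrakk>
    \<Longrightarrow> (a i @ s 1 @ b i, s 1 @ b i @ s 1 @ a i @ s 1) \<in> surface_rels m g s a b"
| "\<lbrakk>1 < m; i \<in> {1..g}; j \<in> {1..g}; i < j; c \<in> {a i, b i}; d \<in> {a j, b j};
     x = winv (s 1) @ c @ s 1\<rbrakk>
    \<Longrightarrow> (x @ d, d @ x) \<in> surface_rels m g s a b"

inductive_set zeta_rels ::
    "nat \<Rightarrow> nat \<Rightarrow> nat \<Rightarrow> (nat \<Rightarrow> 'g word) \<Rightarrow> (nat \<Rightarrow> 'g word) \<Rightarrow> (nat \<Rightarrow> 'g word) \<Rightarrow> (nat \<Rightarrow> 'g word) \<Rightarrow>
     ('g word \<times> 'g word) set"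
  for k n g :: nat and s a b z :: "nat \<Rightarrow> 'g word" where
  "\<lbrakk>i \<in> {1..<k}; i \<noteq> 1; j \<in> {1..n}\<rbrakk>
    \<Longrightarrow> (z j @ s i, s i @ z j) \<in> zeta_rels k n g s a b z"
| "\<lbrakk>1 < k; j \<in> {1..n}\<rbrakk>
    \<Longrightarrow> (z j @ s 1 @ z j @ s 1, s 1 @ z j @ s 1 @ z j) \<in> zeta_rels k n g s a b z"
| "\<lbrakk>1 < k; i \<in> {1..n}; j \<in> {1..g}; c \<in> {a j, b j}; x = winv (s 1) @ z i @ s 1\<rbrakk>
    \<Longrightarrow> (x @ c, c @ x) \<in> zeta_rels k n g s a b z"
| "\<lbrakk>1 < k; i \<in> {1..n}; j \<in> {1..n}; i < j; x = winv (s 1) @ z i @ s 1\<rbrakk>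
    \<Longrightarrow> (x @ z j, z j @ x) \<in> zeta_rels k n g s a b z"

inductive_set action_rels ::
    "nat \<Rightarrow> nat \<Rightarrow> nat \<Rightarrow> (nat \<Rightarrow> 'g word) \<Rightarrow> (nat \<Rightarrow> 'g word) \<Rightarrow> (nat \<Rightarrow> 'g word) \<Rightarrow> (nat \<Rightarrow> 'g word) \<Rightarrow>
     (nat \<Rightarrow> 'g word) \<Rightarrow> (nat \<Rightarrow> 'g word) \<Rightarrow> (nat \<Rightarrow> 'g word) \<Rightarrow> ('g word \<times> 'g word) set"
  for k n g :: nat and s a b z s' a' b' :: "nat \<Rightarrow> 'g word" where
  "\<lbrakk>i \<in> {1..<n}; j \<in> {1..<k}\<rbrakk>
    \<Longrightarrow> (s' i @ s j, s j @ s' i) \<in> action_rels k n g s a b z s' a' b'"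
| "\<lbrakk>i \<in> {1..g}; t \<in> {a' i, b' i}; j \<in> {1..<k}\<rbrakk>
    \<Longrightarrow> (t @ s j, s j @ t) \<in> action_rels k n g s a b z s' a' b'"
| "\<lbrakk>i \<in> {1..<n}; j \<in> {1..g}; d \<in> {a j, b j}\<rbrakk>
    \<Longrightarrow> (s' i @ d, d @ s' i) \<in> action_rels k n g s a b z s' a' b'"
| "i \<in> {1..<n}
    \<Longrightarrow> (s' i @ z (i + 1) @ winv (s' i), z i) \<in> action_rels k n g s a b z s' a' b'"
| "i \<in> {1..<n}
    \<Longrightarrow> (s' i @ z i @ winv (s' i), winv (z i) @ z (i + 1) @ z i) \<in> action_rels k n g s a b z s' a' b'"
| "\<lbrakk>i \<in> {1..<n}; j \<in> {1..n}; j \<noteq> i; j \<noteq> i + 1\<rbrakk>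
    \<Longrightarrow> (s' i @ z j @ winv (s' i), z j) \<in> action_rels k n g s a b z s' a' b'"
| "\<lbrakk>1 \<le> n; i \<in> {1..g}; (t, x) \<in> {(a' i, a i), (b' i, b i)}\<rbrakk>
    \<Longrightarrow> (t @ z 1 @ winv t, wconj (z 1) (x @ z 1)) \<in> action_rels k n g s a b z s' a' b'"
| "\<lbrakk>i \<in> {1..g}; (t, x) \<in> {(a' i, a i), (b' i, b i)}; j \<in> {1..n}; j \<noteq> 1\<rbrakk>
    \<Longrightarrow> (t @ z j @ winv t, wconj (z j) (wcomm (winv x) (winv (z 1))))
          \<in> action_rels k n g s a b z s' a' b'"
| "\<lbrakk>1 \<le> n; i \<in> {1..g}; (t, x) \<in> {(a' i, a i), (b' i, b i)}\<rbrakk>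
    \<Longrightarrow> (t @ x @ winv t, winv (z 1) @ x @ z 1) \<in> action_rels k n g s a b z s' a' b'"
| "\<lbrakk>1 \<le> n; i \<in> {1..g}; (t, x) \<in> {(a' i, a i), (b' i, b i)}; j \<in> {1..g}; d \<in> {a j, b j}; j < i\<rbrakk>
    \<Longrightarrow> (t @ d @ winv t, wconj d (wcomm (winv x) (winv (z 1))))
          \<in> action_rels k n g s a b z s' a' b'"
| "\<lbrakk>i \<in> {1..g}; (t, x) \<in> {(a' i, a i), (b' i, b i)}; j \<in> {1..g}; d \<in> {a j, b j}; i < j\<rbrakk>
    \<Longrightarrow> (t @ d @ winv t, d) \<in> action_rels k n g s a b z s' a' b'"
| "\<lbrakk>1 \<le> n; i \<in> {1..g}\<rbrakk>
    \<Longrightarrow> (a' i @ b i @ winv (a' i), b i @ z 1) \<in> action_rels k n g s a b z s' a' b'"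
| "\<lbrakk>1 \<le> n; i \<in> {1..g}\<rbrakk>
    \<Longrightarrow> (b' i @ a i @ winv (b' i), winv (z 1) @ a i @ wcomm (winv (b i)) (winv (z 1)))
          \<in> action_rels k n g s a b z s' a' b'"

definition rels_fibre :: "nat \<Rightarrow> nat \<Rightarrow> nat \<Rightarrow> (bgen word \<times> bgen word) set" where
  "rels_fibre k n g =
     surface_rels k g (letter \<circ> Sig) (letter \<circ> Al) (letter \<circ> Be) \<union>
     zeta_rels k n g (letter \<circ> Sig) (letter \<circ> Al) (letter \<circ> Be) (letter \<circ> Zet)"

definition rels_base :: "nat \<Rightarrow> nat \<Rightarrow> (bgen word \<times> bgen word) set" where
  "rels_base n g = surface_rels n g (letter \<circ> Sig') (letter \<circ> Al') (letter \<circ> Be')"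

definition rels_mixed :: "nat \<Rightarrow> nat \<Rightarrow> nat \<Rightarrow> (bgen word \<times> bgen word) set" where
  "rels_mixed k n g = rels_fibre k n g \<union> rels_base n g \<union>
     action_rels k n g (letter \<circ> Sig) (letter \<circ> Al) (letter \<circ> Be) (letter \<circ> Zet)
       (letter \<circ> Sig') (letter \<circ> Al') (letter \<circ> Be')"

text \<open>The standard generators: elements \<open>\<gamma>\<close> of $B_{k,n}(X)$, \<open>\<delta>\<close> of $B_n(X)$ and \<open>\<beta>\<close> of the
  subgroup $B_k$ of the punctured surface, realising the known presentations of these groups and
  corresponding to each other under $\psi_k$ and the inclusion.\<close>

definition standard_generators ::
    "nat \<Rightarrow> nat \<Rightarrow> nat \<Rightarrow> 'a topology \<Rightarrow> (nat \<Rightarrow> 'a) \<Rightarrow>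
     (bgen \<Rightarrow> 'a braid) \<Rightarrow> (bgen \<Rightarrow> 'a braid) \<Rightarrow> (bgen \<Rightarrow> 'a braid) \<Rightarrow> bool" where
  "standard_generators k n g X c \<gamma> \<delta> \<beta> \<longleftrightarrow>
     presents (gens_fibre k n g \<union> gens_base n g) (rels_mixed k n g) \<gamma> (mixed_braid_group k n X c) \<and>
     presents (gens_base n g) (rels_base n g) \<delta> (braid_group n X (last_points k n c)) \<and>
     presents (gens_fibre k n g) (rels_fibre k n g) \<beta> (fibre_braid_group k n X c) \<and>
     (\<forall>s\<in>gens_fibre k n g. psi k n X c (\<gamma> s) = \<one>\<^bsub>braid_group n X (last_points k n c)\<^esub>) \<and>
     (\<forall>s\<in>gens_base n g. psi k n X c (\<gamma> s) = \<delta> s) \<and>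
     (\<forall>s\<in>gens_fibre k n g. fibre_incl k n X c (\<beta> s) = \<gamma> s)"

section \<open>Lower central quotients\<close>

fun lower_central :: "('b, 'm) monoid_scheme \<Rightarrow> nat \<Rightarrow> 'b set" where
  "lower_central G 0 = carrier G"
| "lower_central G (Suc 0) = carrier G"
| "lower_central G (Suc (Suc i)) =
     generate G {x \<otimes>\<^bsub>G\<^esub> y \<otimes>\<^bsub>G\<^esub> inv\<^bsub>G\<^esub> x \<otimes>\<^bsub>G\<^esub> inv\<^bsub>G\<^esub> y |x y.
       x \<in> carrier G \<and> y \<in> lower_central G (Suc i)}"

definition rho :: "('b, 'm) monoid_scheme \<Rightarrow> 'b \<Rightarrow> 'b set" where
  "rho G x = lower_central G 3 #>\<^bsub>G\<^esub> x"

text \<open>The map of quotients by $\Gamma_3$ induced by a homomorphism \<open>f\<close>: all \<open>x \<in> C\<close> give the same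
  coset.\<close>

definition induced_quot :: "('c, 'm) monoid_scheme \<Rightarrow> ('b \<Rightarrow> 'c) \<Rightarrow> 'b set \<Rightarrow> 'c set" where
  "induced_quot H f C = (\<Union>x\<in>C. rho H (f x))"

definition G_ker :: "nat \<Rightarrow> nat \<Rightarrow> 'a topology \<Rightarrow> (nat \<Rightarrow> 'a) \<Rightarrow> 'a braid set monoid" where
  "G_ker k n X c =
     (let B = mixed_braid_group k n X c; H = braid_group n X (last_points k n c);
          Q = B Mod lower_central B 3
      in Q\<lparr>carrier := kernel Q (H Mod lower_central H 3) (induced_quot H (psi k n X c))\<rparr>)"

definition Phi :: "nat \<Rightarrow> nat \<Rightarrow> 'a topology \<Rightarrow> (nat \<Rightarrow> 'a) \<Rightarrow> 'a braid \<Rightarrow> 'a braid set" where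
  "Phi k n X c x = rho (mixed_braid_group k n X c) (fibre_incl k n X c x)"

section \<open>The group of An and Ko\<close>

datatype akgen = AKsigma | AKzeta | AKa nat | AKb nat

definition ak_gens :: "nat \<Rightarrow> akgen set" where
  "ak_gens g = {AKsigma, AKzeta} \<union> AKa ` {1..g} \<union> AKb ` {1..g}"

definition ak_rels :: "nat \<Rightarrow> (akgen word \<times> akgen word) set" where
  "ak_rels g =
     {(letter x @ letter y, letter y @ letter x) |x y.
        x \<in> ak_gens g \<and> y \<in> ak_gens g \<and> x \<noteq> y \<and> (\<forall>i. {x, y} \<noteq> {AKa i, AKb i})} \<union>
     {(wcomm (letter (AKa i)) (letter (AKb i)), letter AKsigma @ letter AKsigma) |i. i \<in> {1..g}}"

definition G_Sigma :: "nat \<Rightarrow> akgen word set monoid" where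
  "G_Sigma g = presented_group (ak_gens g) (ak_rels g)"

definition ak :: "nat \<Rightarrow> akgen \<Rightarrow> akgen word set" where
  "ak g x = word_class (ak_gens g) (ak_rels g) (letter x)"

text \<open>\<open>f\<close> is the homomorphism $\Phi_\Sigma$, determined by its values on the generators \<open>\<beta>\<close> of $B_k$ of
  the punctured surface.\<close>

definition is_Phi_Sigma ::
    "nat \<Rightarrow> nat \<Rightarrow> nat \<Rightarrow> 'a topology \<Rightarrow> (nat \<Rightarrow> 'a) \<Rightarrow> (bgen \<Rightarrow> 'a braid) \<Rightarrow>
     ('a braid \<Rightarrow> akgen word set) \<Rightarrow> bool" where
  "is_Phi_Sigma k n g X c \<beta> f \<longleftrightarrow>
     f \<in> hom (fibre_braid_group k n X c) (G_Sigma g) \<and>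
     (\<forall>i\<in>{1..<k}. f (\<beta> (Sig i)) = ak g AKsigma) \<and>
     (\<forall>i\<in>{1..n}. f (\<beta> (Zet i)) = ak g AKzeta) \<and>
     (\<forall>i\<in>{1..g}. f (\<beta> (Al i)) = ak g (AKa i) \<and> f (\<beta> (Be i)) = ak g (AKb i))"

end

theory Submission
  imports Defs "HOL-Library.Function_Algebras"
begin

text \<open>Let $Q = B/\Gamma_3(B)$ for the mixed braid group $B$. Since $Q$ has nilpotency class two, the
  relations of $B$ collapse there: the braid relations identify all \<open>\<sigma>\<^sub>i\<close>, the \<open>\<zeta>\<^sub>i\<close> coincide and are
  central because \<open>\<zeta>\<^sub>1 = [b\<^sub>1\<^sup>-\<^sup>1, a'\<^sub>1]\<close>, and the fibre generators satisfy the relations of \<open>G_Sigma\<close>. They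
  generate a normal subgroup, which is the kernel in question because $\psi_k$ is split by the relations
  (b). For injectivity, $B$ maps to a Heisenberg type group of class two in which \<open>\<sigma>\<close>, \<open>\<zeta>\<close> and the exponent
  sums of the \<open>a\<^sub>i\<close>, \<open>b\<^sub>i\<close> can be read off; this map kills $\Gamma_3(B)$, and its composite with
  \<open>G_Sigma \<rightarrow> Q\<close> is injective by a normal form in \<open>G_Sigma\<close>.\<close>

section \<open>Words and homomorphisms\<close>

text \<open>Every abelian quotient of the mixed braid group kills \<open>\<zeta>\<close> and
  \<open>\<sigma>^2\<close>: the first is a commutator, and the relation between \<open>a_i\<close>,
  \<open>b_i\<close> and \<open>\<sigma>_1\<close> turns the second into one. Detecting them modulo
  \<open>\<Gamma>_3\<close> therefore takes a target of class exactly two. Its two cocycles can be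
  read off the relations: the one for \<open>\<sigma>\<close> from \<open>[a_i, b_i]\<close>, the
  one for \<open>\<zeta>\<close> from the conjugates of \<open>b_i\<close> by \<open>a'_i\<close>
  and of \<open>a_i\<close> by \<open>b'_i\<close>. This is why the target keeps coordinates for the
  generators with a tilde, although \<open>G_Sigma\<close> has none: without them
  \<open>\<zeta>\<close> could not be a nontrivial commutator. The same target serves three
  purposes: it separates the normal forms of \<open>G_Sigma\<close>, it recognises elements outside
  \<open>\<Gamma>_3(B)\<close>, and, since \<open>G_Sigma\<close> embeds in it, it verifies the
  relations needed for the existence of \<open>\<Phi>_\<Sigma>\<close>. Topology enters through one
  fact: forgetting points and adding the punctures respect orbits and are continuous, so
  \<open>psi\<close> and \<open>fibre_incl\<close> are homomorphisms. The group laws and the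
  presentations are supplied by \<open>standard_generators\<close>.\<close>

definition weval :: "('b, 'm) monoid_scheme \<Rightarrow> ('g \<Rightarrow> 'b) \<Rightarrow> 'g word \<Rightarrow> 'b" where
  "weval G f w = foldr (\<lambda>(s, e) r. (if e then f s else inv\<^bsub>G\<^esub> (f s)) \<otimes>\<^bsub>G\<^esub> r) w \<one>\<^bsub>G\<^esub>"

lemma weval_Nil [simp]: "weval G f [] = \<one>\<^bsub>G\<^esub>"
  by (simp add: weval_def)

lemma weval_Cons [simp]:
  "weval G f ((s, e) # w) = (if e then f s else inv\<^bsub>G\<^esub> (f s)) \<otimes>\<^bsub>G\<^esub> weval G f w"
  by (simp add: weval_def)

lemma words_Nil [simp]: "[] \<in> words S"
  and words_Cons [simp]: "(s, e) # w \<in> words S \<longleftrightarrow> s \<in> S \<and> w \<in> words S"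
  and words_append [simp]: "u @ v \<in> words S \<longleftrightarrow> u \<in> words S \<and> v \<in> words S"
  and words_letter [simp]: "letter s \<in> words S \<longleftrightarrow> s \<in> S"
  and words_winv [simp]: "winv w \<in> words S \<longleftrightarrow> w \<in> words S"
  by (auto simp: words_def letter_def winv_def in_lists_conv_set)

lemma words_wcomm [simp]: "wcomm u v \<in> words S \<longleftrightarrow> u \<in> words S \<and> v \<in> words S"
  and words_wconj [simp]: "wconj u v \<in> words S \<longleftrightarrow> u \<in> words S \<and> v \<in> words S"
  by (auto simp: wcomm_def wconj_def)

lemma words_mono: "S \<subseteq> T \<Longrightarrow> w \<in> words S \<Longrightarrow> w \<in> words T"
  unfolding words_def by (meson Sigma_mono lists_mono subsetD subset_refl)

lemma winv_Nil [simp]: "winv [] = []"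
  and winv_Cons [simp]: "winv ((s, e) # w) = winv w @ [(s, \<not> e)]"
  by (simp_all add: winv_def)

context group
begin

lemma weval_closed [simp, intro]:
  assumes "f \<in> S \<rightarrow> carrier G" "w \<in> words S"
  shows "weval G f w \<in> carrier G"
  using assms(2)
proof (induction w)
  case (Cons x w)
  then show ?case using assms(1) by (cases x) (auto simp: Pi_def)
qed simp

lemma weval_append:
  assumes "f \<in> S \<rightarrow> carrier G" "u \<in> words S" "v \<in> words S"
  shows "weval G f (u @ v) = weval G f u \<otimes> weval G f v"
  using assms(2)
proof (induction u)
  case Nil
  then show ?case using weval_closed[OF assms(1,3)] by simp
next
  case (Cons x u)
  obtain s e where x: "x = (s, e)" by (cases x)
  have "f s \<in> carrier G" "weval G f u \<in> carrier G" "weval G f v \<in> carrier G"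
    using Cons.prems x assms weval_closed[OF assms(1)] by (auto simp: Pi_def)
  then show ?case using Cons x by (simp add: m_assoc)
qed

lemma weval_letter:
  assumes "f \<in> S \<rightarrow> carrier G" "s \<in> S"
  shows "weval G f (letter s) = f s"
  using assms by (auto simp: letter_def Pi_def)

lemma weval_word_eq:
  assumes f: "f \<in> S \<rightarrow> carrier G"
    and R: "\<And>u v. (u, v) \<in> R \<Longrightarrow> u \<in> words S \<Longrightarrow> v \<in> words S \<Longrightarrow> weval G f u = weval G f v"
    and "word_eq S R u v"
  shows "weval G f u = weval G f v"
  using assms(3)
proof induction
  case (append u u' v v')
  then show ?case using word_eq_in_words[OF append.hyps(1)] word_eq_in_words[OF append.hyps(2)]
    by (simp add: weval_append[OF f])
next
  case (cancel s e)
  then show ?case using f by (auto simp: Pi_def)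
qed (auto simp: R)

lemma weval_in_subgroup:
  assumes "subgroup H G" "w \<in> words S" "f ` S \<subseteq> H"
  shows "weval G f w \<in> H"
  using assms(2)
proof (induction w)
  case Nil
  then show ?case using assms(1) by (simp add: subgroup.one_closed)
next
  case (Cons x w)
  then show ?case using assms(1,3)
    by (cases x) (auto intro!: subgroup.m_closed[OF assms(1)] subgroup.m_inv_closed[OF assms(1)])
qed

end

lemma weval_cong:
  assumes "w \<in> words S" "\<And>s. s \<in> S \<Longrightarrow> f s = h s"
  shows "weval G f w = weval G h w"
  using assms(1) by (induction w) (auto simp: assms(2))

lemma hom_weval:
  assumes "group G" "group K" "h \<in> hom G K" "f \<in> S \<rightarrow> carrier G" "w \<in> words S"
  shows "h (weval G f w) = weval K (h \<circ> f) w"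
proof -
  interpret group_hom G K h using assms by (simp add: group_hom_def group_hom_axioms_def)
  show ?thesis using assms(5)
  proof (induction w)
    case (Cons x w)
    obtain s e where x: "x = (s, e)" by (cases x)
    have "f s \<in> carrier G" "weval G f w \<in> carrier G"
      using Cons.prems x G.weval_closed[OF assms(4)] assms(4) by (auto simp: Pi_def)
    then show ?case using Cons x by simp
  qed simp
qed

section \<open>Presented groups\<close>

lemma carrier_presented_group: "carrier (presented_group S R) = word_class S R ` words S"
  and one_presented_group: "\<one>\<^bsub>presented_group S R\<^esub> = word_class S R []"
  by (simp_all add: presented_group_def)

text \<open>Von Dyck's theorem. Evaluation is constant on each class of words, so the image of a
  class is a singleton and \<open>the_elem\<close> extracts the value without choosing a
  representative.\<close>

lemma presented_group_hom:
  assumes "group K" and f: "f \<in> S \<rightarrow> carrier K"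
    and R: "\<And>u v. (u, v) \<in> R \<Longrightarrow> u \<in> words S \<Longrightarrow> v \<in> words S \<Longrightarrow> weval K f u = weval K f v"
  obtains h where "h \<in> hom (presented_group S R) K"
    and "\<And>w. w \<in> words S \<Longrightarrow> h (word_class S R w) = weval K f w"
proof
  interpret K: group K by fact
  define h where "h C = the_elem (weval K f ` C)" for C
  show h: "h (word_class S R w) = weval K f w" if "w \<in> words S" for w
  proof -
    have "w \<in> word_class S R w" using that by (simp add: word_class_def word_eq.refl)
    moreover have "weval K f v = weval K f w" if "v \<in> word_class S R w" for v
      using K.weval_word_eq[OF f R] that by (simp add: word_class_def)
    ultimately have "weval K f ` word_class S R w = {weval K f w}" by blast
    then show ?thesis by (simp add: h_def)
  qed
  show "h \<in> hom (presented_group S R) K"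
    by (rule homI)
       (auto simp: carrier_presented_group h mult_presented_group K.weval_append[OF f]
         intro!: K.weval_closed[OF f])
qed

text \<open>The notion \<open>presents\<close> fixes the isomorphism on single positive letters
  only. This lemma, which matches inverse letters with group inverses, extends that information to
  all words.\<close>

lemma word_class_eq_weval:
  assumes "w \<in> words S"
  shows "weval (presented_group S R) (\<lambda>s. word_class S R (letter s)) w = word_class S R w"
  using assms
proof (induction w)
  case Nil
  then show ?case by (simp add: one_presented_group)
next
  case (Cons x w)
  interpret group "presented_group S R" by (rule group_presented_group)
  obtain s e where x: "x = (s, e)" by (cases x)
  have s: "s \<in> S" and w: "w \<in> words S" using Cons.prems x by auto
  have "word_class S R [(s, False)] \<otimes>\<^bsub>presented_group S R\<^esub> word_class S R (letter s)
      = \<one>\<^bsub>presented_group S R\<^esub>"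
    using word_eq.cancel[OF s, of R False] s
    by (simp add: mult_presented_group one_presented_group word_class_eq_iff letter_def)
  then have "inv\<^bsub>presented_group S R\<^esub> word_class S R (letter s) = word_class S R [(s, False)]"
    by (rule inv_equality) (auto simp: carrier_presented_group s)
  then show ?case using Cons.IH[OF w] s w x
    by (auto simp: mult_presented_group letter_def)
qed

lemma presents_closed: "presents S R \<gamma> G \<Longrightarrow> \<gamma> \<in> S \<rightarrow> carrier G"
proof
  fix s assume "presents S R \<gamma> G" "s \<in> S"
  then obtain \<phi> where "\<phi> \<in> hom (presented_group S R) G" "\<phi> (word_class S R (letter s)) = \<gamma> s"
    by (auto simp: presents_def iso_def)
  moreover have "word_class S R (letter s) \<in> carrier (presented_group S R)"
    using \<open>s \<in> S\<close> by (simp add: carrier_presented_group)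
  ultimately show "\<gamma> s \<in> carrier G" using hom_in_carrier by metis
qed

lemma presents_class:
  assumes "presents S R \<gamma> G"
  obtains \<phi> where "\<phi> \<in> iso (presented_group S R) G"
    and "\<And>w. w \<in> words S \<Longrightarrow> \<phi> (word_class S R w) = weval G \<gamma> w"
proof -
  from assms obtain \<phi> where G: "group G" and \<phi>: "\<phi> \<in> iso (presented_group S R) G"
    and \<phi>s: "\<And>s. s \<in> S \<Longrightarrow> \<phi> (word_class S R (letter s)) = \<gamma> s"
    by (auto simp: presents_def)
  have "\<phi> (word_class S R w) = weval G \<gamma> w" if w: "w \<in> words S" for w
  proof -
    have "\<phi> (weval (presented_group S R) (\<lambda>s. word_class S R (letter s)) w)
        = weval G (\<phi> \<circ> (\<lambda>s. word_class S R (letter s))) w"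
      using \<phi> by (intro hom_weval[OF group_presented_group G _ _ w])
        (auto simp: iso_def carrier_presented_group)
    then have "\<phi> (word_class S R w) = weval G (\<phi> \<circ> (\<lambda>s. word_class S R (letter s))) w"
      by (simp add: word_class_eq_weval w)
    also have "\<dots> = weval G \<gamma> w" using w by (rule weval_cong) (simp add: \<phi>s)
    finally show ?thesis .
  qed
  with \<phi> that show ?thesis by blast
qed

lemma presents_rel:
  assumes "presents S R \<gamma> G" "(u, v) \<in> R" "u \<in> words S" "v \<in> words S"
  shows "weval G \<gamma> u = weval G \<gamma> v"
proof -
  obtain \<phi> where "\<And>w. w \<in> words S \<Longrightarrow> \<phi> (word_class S R w) = weval G \<gamma> w"
    using presents_class[OF assms(1)] by blast
  then show ?thesis
    using assms word_class_eq_iff[OF assms(3), of R v] word_eq.rel[OF assms(2-4)] by metis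
qed

lemma presents_word:
  assumes "presents S R \<gamma> G" "x \<in> carrier G"
  obtains w where "w \<in> words S" "x = weval G \<gamma> w"
proof -
  obtain \<phi> where \<phi>: "\<phi> \<in> iso (presented_group S R) G"
    and *: "\<And>w. w \<in> words S \<Longrightarrow> \<phi> (word_class S R w) = weval G \<gamma> w"
    using presents_class[OF assms(1)] by blast
  have "x \<in> \<phi> ` word_class S R ` words S"
    using \<phi> assms(2) by (simp add: iso_def bij_betw_def carrier_presented_group)
  then show ?thesis using * that by auto
qed

text \<open>Von Dyck's theorem transported along the presenting isomorphism. It later produces the
  map from the mixed braid group to \<open>heis g\<close>, the section of \<open>psi\<close>, and
  \<open>\<Phi>_\<Sigma>\<close>.\<close>

lemma presents_hom:
  assumes "presents S R \<gamma> G" "group K" "f \<in> S \<rightarrow> carrier K"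
    and "\<And>u v. (u, v) \<in> R \<Longrightarrow> u \<in> words S \<Longrightarrow> v \<in> words S \<Longrightarrow> weval K f u = weval K f v"
  obtains h where "h \<in> hom G K" "\<And>s. s \<in> S \<Longrightarrow> h (\<gamma> s) = f s"
proof -
  interpret K: group K by fact
  interpret P: group "presented_group S R" by (rule group_presented_group)
  obtain \<phi> where \<phi>: "\<phi> \<in> iso (presented_group S R) G"
    and *: "\<And>w. w \<in> words S \<Longrightarrow> \<phi> (word_class S R w) = weval G \<gamma> w"
    using presents_class[OF assms(1)] by blast
  interpret G: group G using assms(1) by (simp add: presents_def)
  obtain h where h: "h \<in> hom (presented_group S R) K"
    and hw: "\<And>w. w \<in> words S \<Longrightarrow> h (word_class S R w) = weval K f w"
    using presented_group_hom[OF assms(2-4)] by blast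
  let ?\<psi> = "inv_into (carrier (presented_group S R)) \<phi>"
  have "?\<psi> \<in> iso G (presented_group S R)" using P.iso_set_sym[OF \<phi>] .
  then have "h \<circ> ?\<psi> \<in> hom G K" using h by (auto simp: iso_def intro: hom_compose)
  moreover have "(h \<circ> ?\<psi>) (\<gamma> s) = f s" if s: "s \<in> S" for s
  proof -
    have "\<gamma> s = \<phi> (word_class S R (letter s))"
      using s * G.weval_letter[OF presents_closed[OF assms(1)]] by simp
    then have "?\<psi> (\<gamma> s) = word_class S R (letter s)"
      using \<phi> s by (auto simp: iso_def bij_betw_def carrier_presented_group intro!: inv_into_f_f)
    then show ?thesis using s hw K.weval_letter[OF assms(3)] by simp
  qed
  ultimately show ?thesis by (rule that)
qed

lemma presents_hom_eq:
  assumes "presents S R \<gamma> G" "group K" "h \<in> hom G K" "h' \<in> hom G K"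
    and "\<And>s. s \<in> S \<Longrightarrow> h (\<gamma> s) = h' (\<gamma> s)" and x: "x \<in> carrier G"
  shows "h x = h' x"
proof -
  obtain w where w: "w \<in> words S" "x = weval G \<gamma> w" using presents_word[OF assms(1) x] by blast
  have "group G" using assms(1) by (simp add: presents_def)
  note * = hom_weval[OF this assms(2) _ presents_closed[OF assms(1)] w(1)]
  show ?thesis unfolding w(2) *[OF assms(3)] *[OF assms(4)]
    using w(1) by (rule weval_cong) (simp add: assms(5))
qed

section \<open>The lower central series\<close>

context group
begin

definition comm :: "'a \<Rightarrow> 'a \<Rightarrow> 'a" where
  "comm x y = x \<otimes> y \<otimes> inv x \<otimes> inv y"

definition class2 :: bool where
  "class2 \<longleftrightarrow> (\<forall>x\<in>carrier G. \<forall>y\<in>carrier G. \<forall>z\<in>carrier G. comm x y \<otimes> z = z \<otimes> comm x y)"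

lemma comm_closed [simp, intro]: "x \<in> carrier G \<Longrightarrow> y \<in> carrier G \<Longrightarrow> comm x y \<in> carrier G"
  by (simp add: comm_def)

lemma class2D:
  "class2 \<Longrightarrow> x \<in> carrier G \<Longrightarrow> y \<in> carrier G \<Longrightarrow> z \<in> carrier G \<Longrightarrow> comm x y \<otimes> z = z \<otimes> comm x y"
  by (simp add: class2_def)

lemma lower_central_Suc_Suc:
  "lower_central G (Suc (Suc i)) =
     generate G {comm x y |x y. x \<in> carrier G \<and> y \<in> lower_central G (Suc i)}"
  by (simp add: comm_def)

lemma lower_central_subgroup: "subgroup (lower_central G i) G"
proof -
  have "subgroup (lower_central G (Suc i)) G" for i
  proof (induction i)
    case 0
    then show ?case by (simp add: subgroup_self)
  next
    case (Suc i)
    then show ?case unfolding lower_central_Suc_Suc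
      by (intro generate_is_subgroup) (auto dest: subgroup.mem_carrier)
  qed
  then show ?thesis by (cases i) (auto simp: subgroup_self)
qed

lemma comm_in_lower_central:
  "x \<in> carrier G \<Longrightarrow> y \<in> lower_central G (Suc i) \<Longrightarrow> comm x y \<in> lower_central G (Suc (Suc i))"
  unfolding lower_central_Suc_Suc by (intro generate.incl) blast

lemma comm_eq_one_iff:
  assumes "x \<in> carrier G" "y \<in> carrier G"
  shows "comm x y = \<one> \<longleftrightarrow> x \<otimes> y = y \<otimes> x"
proof -
  have "comm x y = x \<otimes> y \<otimes> inv (y \<otimes> x)"
    using assms by (simp add: comm_def inv_mult_group m_assoc)
  then show ?thesis using assms by (simp add: inv_solve_right')
qed

lemma inv_commute:
  assumes "x \<in> carrier G" "y \<in> carrier G" "x \<otimes> y = y \<otimes> x"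
  shows "inv x \<otimes> y = y \<otimes> inv x"
proof -
  have "y = x \<otimes> (y \<otimes> inv x)" using assms by (simp add: inv_solve_right flip: m_assoc)
  then show ?thesis using assms by (simp add: inv_solve_left')
qed

lemma lower_central_class2:
  assumes "class2"
  shows "lower_central G 3 = {\<one>}"
proof -
  \<comment> \<open>The series is indexed so that term 1 is the whole group. Term 2 is generated by
    commutators, which are central by assumption, and centrality passes to products and
    inverses.\<close>
  have central: "y \<otimes> x = x \<otimes> y" if "y \<in> lower_central G 2" "x \<in> carrier G" for x y
    using that(1) unfolding numeral_2_eq_2 lower_central_Suc_Suc
  proof (induction rule: generate.induct)
    case (inv h)
    then have h: "h \<in> carrier G" "h \<otimes> x = x \<otimes> h" using assms that(2) by (auto intro: class2D)
    then show ?case using that(2) by (intro inv_commute)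
  next
    case (eng h1 h2)
    have "h1 \<in> carrier G" "h2 \<in> carrier G"
      using eng.hyps lower_central_subgroup[of 2, unfolded numeral_2_eq_2 lower_central_Suc_Suc]
      by (auto dest: subgroup.mem_carrier)
    then show ?case using eng.IH that(2) by (simp add: m_assoc) (simp flip: m_assoc)
  qed (use assms that(2) in \<open>auto intro: class2D\<close>)
  have "comm x y = \<one>" if "x \<in> carrier G" "y \<in> lower_central G 2" for x y
  proof -
    have y: "y \<in> carrier G" by (rule subgroup.mem_carrier[OF lower_central_subgroup that(2)])
    have "comm x y = y \<otimes> x \<otimes> inv x \<otimes> inv y" unfolding comm_def using central[OF that(2,1)] by simp
    then show ?thesis using y that(1) by (simp add: m_assoc)
  qed
  then have "{comm x y |x y. x \<in> carrier G \<and> y \<in> lower_central G 2} \<subseteq> {\<one>}" by auto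
  then have "lower_central G 3 \<subseteq> generate G {\<one>}"
    unfolding numeral_3_eq_3 numeral_2_eq_2 lower_central_Suc_Suc[of "Suc 0"] by (rule mono_generate)
  then show ?thesis using generate_one subgroup.one_closed[OF lower_central_subgroup] by auto
qed

end

lemma hom_comm:
  assumes "group_hom G H h" "x \<in> carrier G" "y \<in> carrier G"
  shows "h (group.comm G x y) = group.comm H (h x) (h y)"
proof -
  interpret group_hom G H h by fact
  show ?thesis using assms(2,3) by (simp add: G.comm_def H.comm_def)
qed

text \<open>Homomorphisms carry the generating commutators of one term to those of the corresponding
  term. This functoriality is applied to conjugations, to \<open>psi\<close>, to its section, and to
  the map into \<open>heis g\<close>.\<close>

lemma hom_lower_central:
  assumes "group_hom G H h"
  shows "h ` lower_central G i \<subseteq> lower_central H i"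
proof -
  interpret group_hom G H h by fact
  have "h ` lower_central G (Suc i) \<subseteq> lower_central H (Suc i)" for i
  proof (induction i)
    case (Suc i)
    let ?A = "{G.comm x y |x y. x \<in> carrier G \<and> y \<in> lower_central G (Suc i)}"
    have sub: "lower_central G (Suc i) \<subseteq> carrier G"
      using G.lower_central_subgroup subgroup.subset by blast
    then have "h ` ?A \<subseteq> {H.comm x y |x y. x \<in> carrier H \<and> y \<in> lower_central H (Suc i)}"
      using Suc by (fastforce simp: hom_comm[OF assms])
    then have "generate H (h ` ?A)
        \<subseteq> generate H {H.comm x y |x y. x \<in> carrier H \<and> y \<in> lower_central H (Suc i)}"
      by (rule H.mono_generate)
    moreover have "h ` generate G ?A = generate H (h ` ?A)"
      by (rule generate_img[symmetric]) (use sub in auto)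
    ultimately show ?case unfolding G.lower_central_Suc_Suc H.lower_central_Suc_Suc by (simp only:)
  qed auto
  then show ?thesis by (cases i) auto
qed

section \<open>The quotient by the third term\<close>

context group
begin

text \<open>Conjugation by \<open>x\<close> is an endomorphism, so functoriality already gives
  invariance of every term.\<close>

lemma lower_central_normal: "lower_central G i \<lhd> G"
  unfolding normal_inv_iff
proof (intro conjI ballI lower_central_subgroup)
  fix x h assume x: "x \<in> carrier G" and h: "h \<in> lower_central G i"
  have "(\<lambda>h. x \<otimes> h \<otimes> inv x) \<in> hom G G"
  proof (rule homI)
    fix y z assume yz: "y \<in> carrier G" "z \<in> carrier G"
    have "inv x \<otimes> (x \<otimes> (z \<otimes> inv x)) = z \<otimes> inv x" using x yz by (simp flip: m_assoc)
    then show "x \<otimes> (y \<otimes> z) \<otimes> inv x = x \<otimes> y \<otimes> inv x \<otimes> (x \<otimes> z \<otimes> inv x)"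
      using x yz by (simp add: m_assoc)
  qed (use x in auto)
  then have "group_hom G G (\<lambda>h. x \<otimes> h \<otimes> inv x)" by unfold_locales
  from hom_lower_central[OF this, of i] h show "x \<otimes> h \<otimes> inv x \<in> lower_central G i" by blast
qed

lemma rho_group_hom: "group_hom G (G Mod lower_central G 3) (rho G)"
proof -
  interpret N: normal "lower_central G 3" G by (rule lower_central_normal)
  have "rho G = (#>) (lower_central G 3)" by (rule ext) (simp add: rho_def)
  then show ?thesis
    using N.factorgroup_is_group N.r_coset_hom_Mod is_group
    by (simp add: group_hom_def group_hom_axioms_def)
qed

lemma rho_surj: "rho G ` carrier G = carrier (G Mod lower_central G 3)"
  by (auto simp: rho_def FactGroup_def RCOSETS_def)

lemma rho_eq_one_iff:
  assumes "x \<in> carrier G"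
  shows "rho G x = \<one>\<^bsub>G Mod lower_central G 3\<^esub> \<longleftrightarrow> x \<in> lower_central G 3"
  using coset_join1[OF _ assms lower_central_subgroup] coset_join2[OF assms lower_central_subgroup]
    lower_central_subgroup[THEN subgroup.subset]
  by (auto simp: rho_def FactGroup_def)

text \<open>A double commutator \<open>comm z (comm x y)\<close> lies in \<open>\<Gamma>_3\<close>,
  so it dies in the quotient; a trivial commutator says that its two entries commute.\<close>

lemma class2_Mod: "group.class2 (G Mod lower_central G 3)"
proof -
  interpret r: group_hom G "G Mod lower_central G 3" "rho G" by (rule rho_group_hom)
  show ?thesis unfolding r.H.class2_def
  proof (intro ballI)
    fix X Y Z assume "X \<in> carrier (G Mod lower_central G 3)" "Y \<in> carrier (G Mod lower_central G 3)"
      "Z \<in> carrier (G Mod lower_central G 3)"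
    then obtain x y z where *: "X = rho G x" "Y = rho G y" "Z = rho G z"
      "x \<in> carrier G" "y \<in> carrier G" "z \<in> carrier G" unfolding rho_surj[symmetric] by blast
    have "comm x y \<in> lower_central G (Suc (Suc 0))" using * by (intro comm_in_lower_central) auto
    then have "comm z (comm x y) \<in> lower_central G 3"
      unfolding numeral_3_eq_3 using * by (intro comm_in_lower_central) auto
    then have "rho G (comm z (comm x y)) = \<one>\<^bsub>G Mod lower_central G 3\<^esub>"
      using * by (simp only: rho_eq_one_iff comm_closed)
    then have "r.H.comm Z (r.H.comm X Y) = \<one>\<^bsub>G Mod lower_central G 3\<^esub>"
      using * by (simp only: hom_comm[OF r.group_hom_axioms] comm_closed)
    then show "r.H.comm X Y \<otimes>\<^bsub>G Mod lower_central G 3\<^esub> Z = Z \<otimes>\<^bsub>G Mod lower_central G 3\<^esub> r.H.comm X Y"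
      using * by (simp add: r.H.comm_eq_one_iff del: one_FactGroup)
  qed
qed

end

section \<open>Groups of nilpotency class two\<close>

context group
begin

lemma comm_swap:
  assumes "x \<in> carrier G" "y \<in> carrier G"
  shows "x \<otimes> y = comm x y \<otimes> (y \<otimes> x)"
proof -
  have "inv x \<otimes> (inv y \<otimes> (y \<otimes> x)) = \<one>"
    using assms by (metis inv_closed inv_mult_group l_inv m_assoc m_closed)
  then show ?thesis using assms by (simp add: comm_def m_assoc)
qed

lemma comm_unique:
  assumes "x \<in> carrier G" "y \<in> carrier G" "c \<in> carrier G" "x \<otimes> y = c \<otimes> (y \<otimes> x)"
  shows "comm x y = c"
  using comm_swap[OF assms(1,2)] assms by (metis comm_closed m_closed right_cancel)

lemma inv_comm_swap:
  assumes "x \<in> carrier G" "y \<in> carrier G"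
  shows "inv (comm x y) = comm y x"
  using assms by (simp add: comm_def inv_mult_group m_assoc)

text \<open>Moving \<open>z\<close> to the left past \<open>y\<close> and then past \<open>x\<close>
  releases one commutator each time, and both are central. Together with the next three lemmas this
  makes \<open>comm\<close> multiplicative in each argument and compatible with inverses.\<close>

lemma comm_mult_left:
  assumes "class2" "x \<in> carrier G" "y \<in> carrier G" "z \<in> carrier G"
  shows "comm (x \<otimes> y) z = comm x z \<otimes> comm y z"
proof (rule comm_unique)
  have "x \<otimes> y \<otimes> z = x \<otimes> comm y z \<otimes> (z \<otimes> y)"
    using assms comm_swap[of y z] by (simp add: m_assoc)
  also have "\<dots> = comm y z \<otimes> (x \<otimes> z) \<otimes> y"
    using class2D[OF assms(1,3,4,2)] assms by (simp flip: m_assoc)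
  also have "\<dots> = comm y z \<otimes> comm x z \<otimes> (z \<otimes> (x \<otimes> y))"
    using assms comm_swap[of x z] by (simp add: m_assoc)
  finally show "x \<otimes> y \<otimes> z = comm x z \<otimes> comm y z \<otimes> (z \<otimes> (x \<otimes> y))"
    using class2D[OF assms(1,3,4), of "comm x z"] assms by simp
qed (use assms in auto)

lemma comm_inv_left:
  assumes "class2" "x \<in> carrier G" "z \<in> carrier G"
  shows "comm (inv x) z = inv (comm x z)"
proof -
  have "comm (inv x) z \<otimes> comm x z = comm (inv x \<otimes> x) z"
    using assms by (simp only: comm_mult_left inv_closed)
  also have "\<dots> = \<one>" using assms by (simp add: comm_eq_one_iff)
  finally show ?thesis using assms by (intro inv_equality[symmetric]) auto
qed

lemma comm_mult_right:
  assumes "class2" "x \<in> carrier G" "y \<in> carrier G" "z \<in> carrier G"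
  shows "comm x (y \<otimes> z) = comm x y \<otimes> comm x z"
proof -
  have "comm x (y \<otimes> z) = inv (comm z x) \<otimes> inv (comm y x)"
    using assms comm_mult_left[OF assms(1,3,4,2)] inv_comm_swap[of "y \<otimes> z" x]
    by (simp add: inv_mult_group)
  then show ?thesis using assms class2D[OF assms(1,2,4), of "comm x y"] by (simp add: inv_comm_swap)
qed

lemma comm_inv_right:
  assumes "class2" "x \<in> carrier G" "z \<in> carrier G"
  shows "comm x (inv z) = inv (comm x z)"
  using assms comm_inv_left[OF assms(1,3,2)] inv_comm_swap
  by (metis inv_closed)

text \<open>Reading \<open>s t s = t s t\<close> as \<open>(s t) s = t (s t)\<close> shows
  \<open>t = c s\<close> with the central commutator \<open>c = [s t, s]\<close>. Substituting back,
  the two sides become \<open>c s^3\<close> and \<open>c^2 s^3\<close>, whence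
  \<open>c = 1\<close>.\<close>

lemma class2_braid_rel:
  assumes "class2" "s \<in> carrier G" "t \<in> carrier G" "s \<otimes> (t \<otimes> s) = t \<otimes> (s \<otimes> t)"
  shows "s = t"
proof -
  define c where "c = comm (s \<otimes> t) s"
  have c: "c \<in> carrier G" using assms by (simp add: c_def)
  have "s \<otimes> t \<otimes> s = t \<otimes> (s \<otimes> t)" using assms by (simp add: m_assoc)
  moreover have "s \<otimes> t \<otimes> s = c \<otimes> s \<otimes> (s \<otimes> t)"
    using comm_swap[of "s \<otimes> t" s] assms c by (simp add: c_def m_assoc)
  ultimately have t: "t = c \<otimes> s" using assms c by (metis m_closed right_cancel)
  have sc: "s \<otimes> (c \<otimes> x) = c \<otimes> (s \<otimes> x)" if "x \<in> carrier G" for x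
  proof -
    have "c \<otimes> s = s \<otimes> c" unfolding c_def using assms by (intro class2D) auto
    then show ?thesis using that assms c by (simp flip: m_assoc)
  qed
  have "c \<otimes> (s \<otimes> (s \<otimes> s)) = c \<otimes> (c \<otimes> (s \<otimes> (s \<otimes> s)))"
    using assms(4) assms(2) c unfolding t by (simp add: m_assoc sc)
  then have "c \<otimes> (s \<otimes> (s \<otimes> s)) = c \<otimes> c \<otimes> (s \<otimes> (s \<otimes> s))"
    using assms(2) c by (simp add: m_assoc)
  then have "c = \<one>" using assms(2) c by simp
  then show ?thesis using t assms by simp
qed

text \<open>In class two \<open>comm x\<close> is a homomorphism, so the elements it sends into
  \<open>M\<close> form a subgroup; it suffices to test generators.\<close>

lemma comm_generate_right:
  assumes "class2" and A: "A \<subseteq> carrier G" and M: "subgroup M G" and x: "x \<in> carrier G"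
    and *: "\<And>y. y \<in> A \<Longrightarrow> comm x y \<in> M" and y: "y \<in> generate G A"
  shows "comm x y \<in> M"
  using y
proof (induction rule: generate.induct)
  case one
  then show ?case using x subgroup.one_closed[OF M] by (simp add: comm_def)
next
  case (inv h)
  then have "h \<in> carrier G" "comm x h \<in> M" using A * by auto
  then show ?case using x by (simp add: comm_inv_right assms(1) subgroup.m_inv_closed[OF M])
next
  case (eng h1 h2)
  then have "h1 \<in> carrier G" "h2 \<in> carrier G" using generate_in_carrier[OF A] by auto
  then show ?case using eng.IH x by (simp add: comm_mult_right assms(1) subgroup.m_closed[OF M])
qed (rule *)

text \<open>Normality is tested with conjugation by the elements of \<open>B\<close> alone, not by
  their inverses; this suits the relations (c), which give \<open>t x t^-1\<close> but not
  \<open>t^-1 x t\<close>. The inverses come for free because \<open>[b^-1, a] = [b, a]^-1\<close>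
  in class two. \<open>comm_generate_right\<close> is used twice, once to pass from \<open>B\<close>
  to the whole group and once to pass from \<open>A\<close> to the subgroup it generates; inverting
  a commutator moves the varying entry to the right.\<close>

lemma class2_generate_normal:
  assumes c: "class2" and A: "A \<subseteq> carrier G" and B: "B \<subseteq> carrier G" "generate G B = carrier G"
    and *: "\<And>b a. b \<in> B \<Longrightarrow> a \<in> A \<Longrightarrow> b \<otimes> a \<otimes> inv b \<in> generate G A"
  shows "generate G A \<lhd> G"
proof -
  note M = generate_is_subgroup[OF A]
  have ba: "comm a b \<in> generate G A" if "b \<in> B" "a \<in> A" for a b
  proof -
    have "comm b a = b \<otimes> a \<otimes> inv b \<otimes> inv a" by (simp add: comm_def)
    then have "comm b a \<in> generate G A" using *[OF that] generate.inv[OF that(2), of G]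
      by (simp add: subgroup.m_closed[OF M])
    then have "inv (comm b a) \<in> generate G A" by (rule subgroup.m_inv_closed[OF M])
    then show ?thesis using that A B by (simp add: inv_comm_swap subset_iff)
  qed
  have xa: "comm x a \<in> generate G A" if "x \<in> carrier G" "a \<in> A" for a x
  proof -
    have "comm a x \<in> generate G A"
      using comm_generate_right[OF c B(1) M _ ba[OF _ that(2)]] that A B(2) by auto
    then have "inv (comm a x) \<in> generate G A" by (rule subgroup.m_inv_closed[OF M])
    then show ?thesis using that A by (simp add: inv_comm_swap subset_iff)
  qed
  show ?thesis unfolding normal_inv_iff
  proof (intro conjI M ballI)
    fix x h assume x: "x \<in> carrier G" and h: "h \<in> generate G A"
    have hc: "h \<in> carrier G" using generate_in_carrier[OF A h] .
    have "x \<otimes> h \<otimes> inv x = comm x h \<otimes> h"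
      using x hc by (simp add: comm_def m_assoc)
    then show "x \<otimes> h \<otimes> inv x \<in> generate G A"
      using comm_generate_right[OF c A M x xa[OF x] h] h by (simp add: subgroup.m_closed[OF M])
  qed
qed

text \<open>Conjugation by \<open>y\<close> is a homomorphism taking \<open>x\<close> to
  \<open>t x\<close>, hence \<open>x^n\<close> to \<open>(t x)^n = t^n x^n\<close>. Working with a
  homomorphism treats negative exponents along with positive ones.\<close>

lemma int_pow_swap:
  fixes n :: int
  assumes "x \<in> carrier G" "y \<in> carrier G" "t \<in> carrier G"
    and "x \<otimes> y = t \<otimes> (y \<otimes> x)" "t \<otimes> x = x \<otimes> t" "t \<otimes> y = y \<otimes> t"
  shows "x [^] n \<otimes> y = t [^] n \<otimes> (y \<otimes> x [^] n)"
proof -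
  let ?h = "\<lambda>w. inv y \<otimes> w \<otimes> y"
  have "?h \<in> hom G G"
  proof (rule homI)
    fix u w assume uw: "u \<in> carrier G" "w \<in> carrier G"
    have "y \<otimes> (inv y \<otimes> (w \<otimes> y)) = w \<otimes> y" using assms uw by (simp flip: m_assoc)
    then show "inv y \<otimes> (u \<otimes> w) \<otimes> y = inv y \<otimes> u \<otimes> y \<otimes> (inv y \<otimes> w \<otimes> y)"
      using assms uw by (simp add: m_assoc)
  qed (use assms in auto)
  then have "?h (x [^] n) = ?h x [^] n"
    using hom_int_pow[of ?h G G x n] assms is_group by simp
  also have "?h x = inv y \<otimes> (y \<otimes> (t \<otimes> x))"
    using assms by (simp add: m_assoc) (metis m_assoc)
  also have "\<dots> = t \<otimes> x" using assms by (simp flip: m_assoc)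
  also have "(t \<otimes> x) [^] n = t [^] n \<otimes> x [^] n" using assms by (intro int_pow_mult_distrib)
  finally have h: "inv y \<otimes> (x [^] n \<otimes> y) = t [^] n \<otimes> x [^] n" using assms by (simp add: m_assoc)
  have ty: "t [^] n \<otimes> y = y \<otimes> t [^] n"
  proof -
    have "(inv y \<otimes> t \<otimes> y) [^] n = inv y \<otimes> t [^] n \<otimes> y"
      using hom_int_pow[OF \<open>?h \<in> hom G G\<close> assms(3) is_group is_group, of n] by simp
    moreover have "inv y \<otimes> t \<otimes> y = t"
      using assms by (simp add: m_assoc inv_solve_left')
    ultimately show ?thesis using assms by (simp add: m_assoc inv_solve_left)
  qed
  have "x [^] n \<otimes> y = y \<otimes> (t [^] n \<otimes> x [^] n)"
    using h assms by (simp add: inv_solve_left')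
  also have "\<dots> = t [^] n \<otimes> (y \<otimes> x [^] n)" using ty assms by (simp flip: m_assoc)
  finally show ?thesis .
qed

lemma int_pow_commute:
  fixes n :: int
  assumes "x \<in> carrier G" "y \<in> carrier G" "x \<otimes> y = y \<otimes> x"
  shows "x [^] n \<otimes> y = y \<otimes> x [^] n"
  using int_pow_swap[of x y \<one> n] assms by simp

end

section \<open>A Heisenberg quotient of the mixed braid group\<close>

text \<open>The bilinear forms are chosen to give $[a_i, b_i] = \sigma^2$ and
  $[\tilde a_i, b_i] = [a_i, \tilde b_i] = \zeta$, with the \<open>Sig'\<close> trivial. In \<open>form_zeta\<close> the tilde
  coordinates enter only through the second argument, so that right multiplication by fibre generators
  does not change the \<open>\<zeta>\<close> coordinate through the form.\<close>

definition unit_vec :: "bgen \<Rightarrow> bgen \<Rightarrow> int" where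
  "unit_vec x = (\<lambda>y. if y = x then 1 else 0)"

definition form_sigma :: "nat \<Rightarrow> (bgen \<Rightarrow> int) \<Rightarrow> (bgen \<Rightarrow> int) \<Rightarrow> int" where
  "form_sigma g v w = (\<Sum>i=1..g. 2 * v (Al i) * w (Be i))"

definition form_zeta :: "nat \<Rightarrow> (bgen \<Rightarrow> int) \<Rightarrow> (bgen \<Rightarrow> int) \<Rightarrow> int" where
  "form_zeta g v w = (\<Sum>i=1..g. v (Al i) * w (Be' i) - v (Be i) * w (Al' i))"

definition heis :: "nat \<Rightarrow> (int \<times> int \<times> (bgen \<Rightarrow> int)) monoid" where
  "heis g = \<lparr>carrier = UNIV,
     monoid.mult = (\<lambda>(s, z, v) (s', z', v').
       (s + s' + form_sigma g v v', z + z' + form_zeta g v v', v + v')),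
     one = (0, 0, 0)\<rparr>"

fun heis_gen :: "bgen \<Rightarrow> int \<times> int \<times> (bgen \<Rightarrow> int)" where
  "heis_gen (Sig i) = (1, 0, 0)"
| "heis_gen (Zet i) = (0, 1, 0)"
| "heis_gen (Sig' i) = (0, 0, 0)"
| "heis_gen (Al i) = (0, 0, unit_vec (Al i))"
| "heis_gen (Be i) = (0, 0, unit_vec (Be i))"
| "heis_gen (Al' i) = (0, 0, unit_vec (Al' i))"
| "heis_gen (Be' i) = (0, 0, unit_vec (Be' i))"

lemma form_simps [simp]:
  "form_sigma g (u + v) w = form_sigma g u w + form_sigma g v w"
  "form_sigma g w (u + v) = form_sigma g w u + form_sigma g w v"
  "form_sigma g 0 w = 0" "form_sigma g w 0 = 0"
  "form_sigma g (u - v) w = form_sigma g u w - form_sigma g v w"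
  "form_sigma g w (u - v) = form_sigma g w u - form_sigma g w v"
  "form_zeta g (u - v) w = form_zeta g u w - form_zeta g v w"
  "form_zeta g w (u - v) = form_zeta g w u - form_zeta g w v"
  "form_sigma g (- v) w = - form_sigma g v w" "form_sigma g w (- v) = - form_sigma g w v"
  "form_zeta g (u + v) w = form_zeta g u w + form_zeta g v w"
  "form_zeta g w (u + v) = form_zeta g w u + form_zeta g w v"
  "form_zeta g 0 w = 0" "form_zeta g w 0 = 0"
  "form_zeta g (- v) w = - form_zeta g v w" "form_zeta g w (- v) = - form_zeta g w v"
  by (simp_all add: form_sigma_def form_zeta_def algebra_simps sum.distrib sum_subtractf
      flip: sum_negf)

lemma unit_vec_apply [simp]: "unit_vec x y = (if y = x then 1 else 0)"
  by (simp add: unit_vec_def)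

lemma form_unit_vec [simp]:
  "form_sigma g v (unit_vec x) = (case x of Be i \<Rightarrow> if i \<in> {1..g} then 2 * v (Al i) else 0 | _ \<Rightarrow> 0)"
  "form_zeta g v (unit_vec x) = (case x of Be' i \<Rightarrow> if i \<in> {1..g} then v (Al i) else 0
     | Al' i \<Rightarrow> if i \<in> {1..g} then - v (Be i) else 0 | _ \<Rightarrow> 0)"
proof -
  have *: "(\<Sum>i=1..g. if i = j then f i else 0) = (if j \<in> {1..g} then f j else 0)"
    for f :: "nat \<Rightarrow> int" and j
    by (rule sum.delta) simp
  show "form_sigma g v (unit_vec x) = (case x of Be i \<Rightarrow> if i \<in> {1..g} then 2 * v (Al i) else 0 | _ \<Rightarrow> 0)"
  proof (cases x)
    case (Be j)
    have "form_sigma g v (unit_vec x) = (\<Sum>i=1..g. if i = j then 2 * v (Al i) else 0)"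
      unfolding form_sigma_def Be by (rule sum.cong) auto
    then show ?thesis unfolding Be * by simp
  qed (simp_all add: form_sigma_def)
  show "form_zeta g v (unit_vec x) = (case x of Be' i \<Rightarrow> if i \<in> {1..g} then v (Al i) else 0
     | Al' i \<Rightarrow> if i \<in> {1..g} then - v (Be i) else 0 | _ \<Rightarrow> 0)"
  proof (cases x)
    case (Al' j)
    have "form_zeta g v (unit_vec x) = (\<Sum>i=1..g. if i = j then - v (Be i) else 0)"
      unfolding form_zeta_def Al' by (rule sum.cong) auto
    then show ?thesis unfolding Al' * by simp
  next
    case (Be' j)
    have "form_zeta g v (unit_vec x) = (\<Sum>i=1..g. if i = j then v (Al i) else 0)"
      unfolding form_zeta_def Be' by (rule sum.cong) auto
    then show ?thesis unfolding Be' * by simp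
  qed (simp_all add: form_zeta_def)
qed

lemma heis_simps [simp]:
  "(s, z, v) \<otimes>\<^bsub>heis g\<^esub> (s', z', v') = (s + s' + form_sigma g v v', z + z' + form_zeta g v v', v + v')"
  "\<one>\<^bsub>heis g\<^esub> = (0, 0, 0)" "p \<in> carrier (heis g)"
  by (simp_all add: heis_def)

lemma group_heis: "group (heis g)"
proof (rule groupI)
  fix p q r
  show "p \<otimes>\<^bsub>heis g\<^esub> q \<otimes>\<^bsub>heis g\<^esub> r = p \<otimes>\<^bsub>heis g\<^esub> (q \<otimes>\<^bsub>heis g\<^esub> r)"
    by (cases p; cases q; cases r) (simp add: add.assoc)
  show "\<exists>q\<in>carrier (heis g). q \<otimes>\<^bsub>heis g\<^esub> p = \<one>\<^bsub>heis g\<^esub>"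
    by (cases p) (rule bexI[of _ "(- fst p + form_sigma g (snd (snd p)) (snd (snd p)),
      - fst (snd p) + form_zeta g (snd (snd p)) (snd (snd p)), - snd (snd p))"]; simp)
qed auto

lemma inv_heis [simp]:
  "inv\<^bsub>heis g\<^esub> (s, z, v) = (- s + form_sigma g v v, - z + form_zeta g v v, - v)"
  by (rule group.inv_equality[OF group_heis]) simp_all

lemma class2_heis: "group.class2 (heis g)"
  unfolding group.class2_def[OF group_heis] group.comm_def[OF group_heis]
  by auto

text \<open>As \<open>\<sigma>\<close> and \<open>\<zeta>\<close> are central here, conjugation by
  them or by a commutator containing one disappears. What remains is
  \<open>[a_i, b_i] = \<sigma>^2\<close> from (a), \<open>[a'_i, b'_i] = 1\<close> from (b) since
  the \<open>Sig'\<close> are trivial, and from (c) the values \<open>\<zeta>\<close> for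
  \<open>[a'_i, b_i]\<close> and \<open>\<zeta>^-1\<close> for \<open>[b'_i, a_i]\<close>. All of
  this is visible on coordinates.\<close>

lemma heis_gen_rels_mixed:
  assumes "(u, v) \<in> rels_mixed k n g"
  shows "weval (heis g) heis_gen u = weval (heis g) heis_gen v"
  using assms unfolding rels_mixed_def rels_fibre_def rels_base_def
  by (auto elim!: surface_rels.cases zeta_rels.cases action_rels.cases
      simp: letter_def wconj_def wcomm_def doubleton_eq_iff)

text \<open>The index 1 picks representatives: in the quotient by \<open>\<Gamma>_3\<close> all
  \<open>Sig i\<close> have the same image, and so do all \<open>Zet i\<close>.\<close>

fun ak_bgen :: "akgen \<Rightarrow> bgen" where
  "ak_bgen AKsigma = Sig 1"
| "ak_bgen AKzeta = Zet 1"
| "ak_bgen (AKa i) = Al i"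
| "ak_bgen (AKb i) = Be i"

lemma heis_gen_ak_rels:
  assumes "(u, v) \<in> ak_rels g"
  shows "weval (heis g) (heis_gen \<circ> ak_bgen) u = weval (heis g) (heis_gen \<circ> ak_bgen) v"
  using assms unfolding ak_rels_def
  by (auto simp: ak_gens_def letter_def wcomm_def doubleton_eq_iff)

section \<open>Normal forms in the group of An and Ko\<close>

fun akgen_val :: "'b \<Rightarrow> 'b \<Rightarrow> (nat \<Rightarrow> 'b) \<Rightarrow> (nat \<Rightarrow> 'b) \<Rightarrow> akgen \<Rightarrow> 'b" where
  "akgen_val \<sigma> \<zeta> a b AKsigma = \<sigma>"
| "akgen_val \<sigma> \<zeta> a b AKzeta = \<zeta>"
| "akgen_val \<sigma> \<zeta> a b (AKa i) = a i"
| "akgen_val \<sigma> \<zeta> a b (AKb i) = b i"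

text \<open>Any group with chosen elements satisfying the relations of An and Ko. It is interpreted
  twice: in \<open>G_Sigma g\<close>, where it yields the normal form, and in the quotient of the
  braid group, where it yields the homomorphism from \<open>G_Sigma g\<close>.\<close>

locale ak_group = group +
  fixes g :: nat and \<sigma> \<zeta> :: 'a and a b :: "nat \<Rightarrow> 'a"
  assumes gens_closed: "\<sigma> \<in> carrier G" "\<zeta> \<in> carrier G"
      "\<And>i. i \<in> {1..g} \<Longrightarrow> a i \<in> carrier G" "\<And>i. i \<in> {1..g} \<Longrightarrow> b i \<in> carrier G"
    and sigma_commute: "\<sigma> \<otimes> \<zeta> = \<zeta> \<otimes> \<sigma>"
      "\<And>i. i \<in> {1..g} \<Longrightarrow> \<sigma> \<otimes> a i = a i \<otimes> \<sigma>" "\<And>i. i \<in> {1..g} \<Longrightarrow> \<sigma> \<otimes> b i = b i \<otimes> \<sigma>"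
    and zeta_commute: "\<And>i. i \<in> {1..g} \<Longrightarrow> \<zeta> \<otimes> a i = a i \<otimes> \<zeta>"
      "\<And>i. i \<in> {1..g} \<Longrightarrow> \<zeta> \<otimes> b i = b i \<otimes> \<zeta>"
    and ab_commute: "\<And>i j. i \<in> {1..g} \<Longrightarrow> j \<in> {1..g} \<Longrightarrow> i \<noteq> j \<Longrightarrow> a i \<otimes> a j = a j \<otimes> a i"
      "\<And>i j. i \<in> {1..g} \<Longrightarrow> j \<in> {1..g} \<Longrightarrow> i \<noteq> j \<Longrightarrow> a i \<otimes> b j = b j \<otimes> a i"
      "\<And>i j. i \<in> {1..g} \<Longrightarrow> j \<in> {1..g} \<Longrightarrow> i \<noteq> j \<Longrightarrow> b i \<otimes> b j = b j \<otimes> b i"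
    and ab_swap: "\<And>i. i \<in> {1..g} \<Longrightarrow> a i \<otimes> b i = \<sigma> \<otimes> \<sigma> \<otimes> (b i \<otimes> a i)"
begin

text \<open>One block \<open>b_i^p a_i^q\<close> for each handle. With \<open>b_i\<close> in front,
  a factor \<open>a_j\<close> arriving from the right only raises an exponent, whereas
  \<open>b_j\<close> must pass \<open>a_j^q\<close> and releases \<open>\<sigma>^(2 q)\<close>. The
  same asymmetry is built into \<open>form_sigma\<close>, which pairs \<open>Al\<close> of the left
  factor with \<open>Be\<close> of the right one.\<close>

primrec nf :: "(nat \<Rightarrow> int) \<Rightarrow> (nat \<Rightarrow> int) \<Rightarrow> nat \<Rightarrow> 'a" where
  "nf \<alpha> \<beta> 0 = \<one>"
| "nf \<alpha> \<beta> (Suc m) = nf \<alpha> \<beta> m \<otimes> (b (Suc m) [^] \<beta> (Suc m) \<otimes> a (Suc m) [^] \<alpha> (Suc m))"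

lemma nf_closed [simp]: "m \<le> g \<Longrightarrow> nf \<alpha> \<beta> m \<in> carrier G"
  by (induction m) (auto simp: gens_closed)

lemma nf_cong:
  assumes "\<And>i. 1 \<le> i \<Longrightarrow> i \<le> m \<Longrightarrow> \<alpha> i = \<alpha>' i" "\<And>i. 1 \<le> i \<Longrightarrow> i \<le> m \<Longrightarrow> \<beta> i = \<beta>' i"
  shows "nf \<alpha> \<beta> m = nf \<alpha>' \<beta>' m"
  using assms by (induction m) auto

lemma nf_zero [simp]: "nf (\<lambda>_. 0) (\<lambda>_. 0) m = \<one>"
  by (induction m) auto

lemma block_commute:
  fixes p q :: int
  assumes "i \<in> {1..g}" "x \<in> carrier G" "a i \<otimes> x = x \<otimes> a i" "b i \<otimes> x = x \<otimes> b i"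
  shows "b i [^] p \<otimes> a i [^] q \<otimes> x = x \<otimes> (b i [^] p \<otimes> a i [^] q)"
proof -
  have c: "a i [^] q \<in> carrier G" "b i [^] p \<in> carrier G" using assms gens_closed by auto
  have "a i [^] q \<otimes> x = x \<otimes> a i [^] q" "b i [^] p \<otimes> x = x \<otimes> b i [^] p"
    using assms gens_closed by (simp_all add: int_pow_commute)
  then show ?thesis using c assms(2) by (metis m_assoc)
qed

lemma nf_commute:
  assumes "m \<le> g" "x \<in> carrier G" "\<And>i. i \<in> {1..m} \<Longrightarrow> a i \<otimes> x = x \<otimes> a i"
    "\<And>i. i \<in> {1..m} \<Longrightarrow> b i \<otimes> x = x \<otimes> b i"
  shows "nf \<alpha> \<beta> m \<otimes> x = x \<otimes> nf \<alpha> \<beta> m"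
  using assms
proof (induction m)
  case (Suc m)
  let ?B = "b (Suc m) [^] \<beta> (Suc m) \<otimes> a (Suc m) [^] \<alpha> (Suc m)"
  have c: "?B \<in> carrier G" "nf \<alpha> \<beta> m \<in> carrier G" using Suc.prems gens_closed by auto
  have "nf \<alpha> \<beta> m \<otimes> x = x \<otimes> nf \<alpha> \<beta> m" using Suc by simp
  moreover have "?B \<otimes> x = x \<otimes> ?B" using Suc.prems by (intro block_commute) auto
  ultimately show ?case using c Suc.prems(2) unfolding nf.simps by (metis m_assoc)
qed auto

lemma nf_mult_a:
  assumes "m \<le> g" "j \<in> {1..m}"
  shows "nf \<alpha> \<beta> m \<otimes> a j = nf (\<alpha>(j := \<alpha> j + 1)) \<beta> m"
  using assms
proof (induction m)
  case (Suc m)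
  let ?B = "b (Suc m) [^] \<beta> (Suc m)" and ?A = "a (Suc m) [^] \<alpha> (Suc m)"
  have c: "?B \<in> carrier G" "?A \<in> carrier G" "nf \<alpha> \<beta> m \<in> carrier G" "a j \<in> carrier G"
    using Suc.prems gens_closed by auto
  show ?case
  proof (cases "j = Suc m")
    case True
    have nf: "nf (\<alpha>(j := \<alpha> j + 1)) \<beta> m = nf \<alpha> \<beta> m" by (rule nf_cong) (auto simp: True)
    show ?thesis using c unfolding nf.simps nf by (simp add: True m_assoc int_pow_mult)
  next
    case False
    then have "nf \<alpha> \<beta> m \<otimes> a j = nf (\<alpha>(j := \<alpha> j + 1)) \<beta> m"
      using Suc.prems by (intro Suc.IH) auto
    moreover have "?B \<otimes> ?A \<otimes> a j = a j \<otimes> (?B \<otimes> ?A)"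
      using Suc.prems False by (intro block_commute) (auto simp: gens_closed ab_commute)
    moreover have "nf \<alpha> \<beta> (Suc m) \<otimes> a j = nf \<alpha> \<beta> m \<otimes> (?B \<otimes> ?A \<otimes> a j)"
      using c by (simp add: m_assoc)
    moreover have "nf \<alpha> \<beta> m \<otimes> (a j \<otimes> (?B \<otimes> ?A)) = nf \<alpha> \<beta> m \<otimes> a j \<otimes> (?B \<otimes> ?A)"
      using c by (simp add: m_assoc)
    ultimately show ?thesis using False unfolding nf.simps by simp
  qed
qed auto

text \<open>Blocks of other handles commute with \<open>b j\<close>. In its own block
  \<open>b j\<close> passes the power of \<open>a j\<close>, and the resulting power of
  \<open>\<sigma> \<otimes> \<sigma>\<close> is moved to the front because it commutes with
  everything to its left.\<close>

lemma nf_mult_b: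
  assumes "m \<le> g" "j \<in> {1..m}"
  shows "nf \<alpha> \<beta> m \<otimes> b j = (\<sigma> \<otimes> \<sigma>) [^] \<alpha> j \<otimes> nf \<alpha> (\<beta>(j := \<beta> j + 1)) m"
  using assms
proof (induction m)
  case (Suc m)
  let ?B = "b (Suc m) [^] \<beta> (Suc m)" and ?A = "a (Suc m) [^] \<alpha> (Suc m)"
  let ?t = "(\<sigma> \<otimes> \<sigma>) [^] \<alpha> j"
  have j: "j \<in> {1..g}" using Suc.prems by auto
  have c: "?B \<in> carrier G" "?A \<in> carrier G" "nf \<alpha> \<beta> m \<in> carrier G" "b j \<in> carrier G"
    "?t \<in> carrier G" "b (Suc m) \<in> carrier G" "a (Suc m) \<in> carrier G"
    using Suc.prems gens_closed by auto
  have ss: "\<sigma> \<otimes> \<sigma> \<otimes> x = x \<otimes> (\<sigma> \<otimes> \<sigma>)" if "x \<in> carrier G" "\<sigma> \<otimes> x = x \<otimes> \<sigma>" for x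
    using that gens_closed(1) by (metis m_assoc)
  show ?case
  proof (cases "j = Suc m")
    case True
    have nf: "nf \<alpha> (\<beta>(j := \<beta> j + 1)) m = nf \<alpha> \<beta> m" by (rule nf_cong) (auto simp: True)
    have "?A \<otimes> b j = ?t \<otimes> (b j \<otimes> ?A)" unfolding True
      using Suc.prems gens_closed ab_swap ss sigma_commute by (intro int_pow_swap) auto
    then have "nf \<alpha> \<beta> (Suc m) \<otimes> b j = nf \<alpha> \<beta> m \<otimes> (?B \<otimes> (?t \<otimes> (b j \<otimes> ?A)))"
      using c by (simp add: m_assoc)
    also have "\<dots> = nf \<alpha> \<beta> m \<otimes> ?B \<otimes> ?t \<otimes> (b j \<otimes> ?A)" using c by (simp add: m_assoc)
    also have "nf \<alpha> \<beta> m \<otimes> ?B \<otimes> ?t = ?t \<otimes> (nf \<alpha> \<beta> m \<otimes> ?B)"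
    proof -
      have "nf \<alpha> \<beta> m \<otimes> ?B \<otimes> (\<sigma> \<otimes> \<sigma>) = \<sigma> \<otimes> \<sigma> \<otimes> (nf \<alpha> \<beta> m \<otimes> ?B)"
      proof -
        have "nf \<alpha> \<beta> m \<otimes> (\<sigma> \<otimes> \<sigma>) = \<sigma> \<otimes> \<sigma> \<otimes> nf \<alpha> \<beta> m"
          using Suc.prems gens_closed ss sigma_commute by (intro nf_commute) auto
        moreover have "?B \<otimes> (\<sigma> \<otimes> \<sigma>) = \<sigma> \<otimes> \<sigma> \<otimes> ?B"
          using Suc.prems gens_closed ss sigma_commute by (intro int_pow_commute) auto
        ultimately show ?thesis using c gens_closed(1) by (metis m_assoc m_closed)
      qed
      then show ?thesis using int_pow_commute[of "\<sigma> \<otimes> \<sigma>" "nf \<alpha> \<beta> m \<otimes> ?B"] c gens_closed(1) by simp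
    qed
    finally show ?thesis using c unfolding nf.simps nf by (simp add: True m_assoc int_pow_mult)
  next
    case False
    then have "nf \<alpha> \<beta> m \<otimes> b j = ?t \<otimes> nf \<alpha> (\<beta>(j := \<beta> j + 1)) m"
      using Suc.prems by (intro Suc.IH) auto
    moreover have "?B \<otimes> ?A \<otimes> b j = b j \<otimes> (?B \<otimes> ?A)"
      using Suc.prems False by (intro block_commute) (auto simp: gens_closed ab_commute)
    moreover have "nf \<alpha> \<beta> (Suc m) \<otimes> b j = nf \<alpha> \<beta> m \<otimes> (?B \<otimes> ?A \<otimes> b j)"
      using c by (simp add: m_assoc)
    moreover have "nf \<alpha> \<beta> m \<otimes> (b j \<otimes> (?B \<otimes> ?A)) = nf \<alpha> \<beta> m \<otimes> b j \<otimes> (?B \<otimes> ?A)"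
      using c by (simp add: m_assoc)
    moreover have "nf \<alpha> (\<beta>(j := \<beta> j + 1)) m \<in> carrier G" using Suc.prems by simp
    ultimately show ?thesis using False c unfolding nf.simps by (simp add: m_assoc)
  qed
qed auto

text \<open>Reads an element of \<open>heis g\<close> as a normal form, discarding the coordinates
  with a tilde. It is not claimed to be a homomorphism; what matters is how it behaves under right
  multiplication by fibre generators.\<close>

definition of_heis :: "int \<times> int \<times> (bgen \<Rightarrow> int) \<Rightarrow> 'a" where
  "of_heis = (\<lambda>(s, z, v). \<sigma> [^] s \<otimes> (\<zeta> [^] z \<otimes> nf (\<lambda>i. v (Al i)) (\<lambda>i. v (Be i)) g))"

lemma of_heis_closed [simp]: "of_heis p \<in> carrier G"
  by (cases p) (simp add: of_heis_def gens_closed)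

abbreviation gen :: "akgen \<Rightarrow> 'a" where
  "gen \<equiv> akgen_val \<sigma> \<zeta> a b"

lemma gen_closed: "gen \<in> ak_gens g \<rightarrow> carrier G"
  by (auto simp: ak_gens_def gens_closed)

text \<open>Right multiplication by a generator changes normal forms in the group exactly as it
  changes coordinates in \<open>heis g\<close>. The first coordinate is affected by the form only
  for \<open>AKb j\<close>, and the second never is.\<close>

lemma of_heis_mult_gen:
  assumes "x \<in> ak_gens g"
  shows "of_heis (p \<otimes>\<^bsub>heis g\<^esub> heis_gen (ak_bgen x)) = of_heis p \<otimes> gen x"
proof -
  obtain s z v where p: "p = (s, z, v)" by (cases p)
  define \<alpha> \<beta> where "\<alpha> = (\<lambda>i. v (Al i))" and "\<beta> = (\<lambda>i. v (Be i))"
  let ?N = "nf \<alpha> \<beta> g"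
  have N: "?N \<in> carrier G" "\<sigma> [^] s \<in> carrier G" "\<zeta> [^] z \<in> carrier G" by (simp_all add: gens_closed)
  have op: "of_heis p = \<sigma> [^] s \<otimes> (\<zeta> [^] z \<otimes> ?N)" by (simp add: p of_heis_def \<alpha>_def \<beta>_def)
  have N\<sigma>: "?N \<otimes> \<sigma> = \<sigma> \<otimes> ?N" and N\<zeta>: "?N \<otimes> \<zeta> = \<zeta> \<otimes> ?N"
    by (intro nf_commute; simp add: gens_closed sigma_commute zeta_commute)+
  consider "x = AKsigma" | "x = AKzeta" | j where "x = AKa j" "j \<in> {1..g}"
    | j where "x = AKb j" "j \<in> {1..g}" using assms by (auto simp: ak_gens_def)
  then show ?thesis
  proof cases
    case 1
    have "\<zeta> [^] z \<otimes> \<sigma> = \<sigma> \<otimes> \<zeta> [^] z"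
      by (rule int_pow_commute) (simp_all add: gens_closed sigma_commute)
    then have "\<zeta> [^] z \<otimes> (\<sigma> \<otimes> ?N) = \<sigma> \<otimes> (\<zeta> [^] z \<otimes> ?N)"
      using N gens_closed by (simp flip: m_assoc)
    then show ?thesis using 1 N gens_closed N\<sigma>
      by (simp add: op m_assoc) (simp add: p of_heis_def m_assoc int_pow_mult \<alpha>_def \<beta>_def)
  next
    case 2
    then show ?thesis using N gens_closed N\<zeta>
      by (simp add: op m_assoc) (simp add: p of_heis_def m_assoc int_pow_mult \<alpha>_def \<beta>_def)
  next
    case (3 j)
    have "(\<lambda>i. (v + unit_vec (Al j)) (Al i)) = \<alpha>(j := \<alpha> j + 1)"
      "(\<lambda>i. (v + unit_vec (Al j)) (Be i)) = \<beta>" by (auto simp: \<alpha>_def \<beta>_def)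
    then have "of_heis (p \<otimes>\<^bsub>heis g\<^esub> heis_gen (ak_bgen x)) = \<sigma> [^] s \<otimes> (\<zeta> [^] z \<otimes> nf (\<alpha>(j := \<alpha> j + 1)) \<beta> g)"
      using 3 by (simp add: p of_heis_def del: plus_fun_apply unit_vec_apply)
    then show ?thesis using nf_mult_a[of g j \<alpha> \<beta>] 3 N gens_closed by (simp add: op m_assoc)
  next
    case (4 j)
    let ?N' = "nf \<alpha> (\<beta>(j := \<beta> j + 1)) g"
    have c: "?N' \<in> carrier G" "b j \<in> carrier G" using 4 gens_closed by auto
    have "(\<lambda>i. (v + unit_vec (Be j)) (Al i)) = \<alpha>"
      "(\<lambda>i. (v + unit_vec (Be j)) (Be i)) = \<beta>(j := \<beta> j + 1)" by (auto simp: \<alpha>_def \<beta>_def)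
    \<comment> \<open>The shift \<open>2 * \<alpha> j\<close> is the value of
      \<open>form_sigma\<close> on \<open>v\<close> and the unit vector of \<open>Be j\<close>;
      \<open>nf_mult_b\<close> produces the same power of \<open>\<sigma>\<close>.\<close>
    then have 1: "of_heis (p \<otimes>\<^bsub>heis g\<^esub> heis_gen (ak_bgen x)) = \<sigma> [^] (s + 2 * \<alpha> j) \<otimes> (\<zeta> [^] z \<otimes> ?N')"
      using 4 by (simp add: p of_heis_def \<alpha>_def del: plus_fun_apply unit_vec_apply)
    have two: "(\<sigma> \<otimes> \<sigma>) [^] \<alpha> j = \<sigma> [^] (2 * \<alpha> j)"
    proof -
      have "\<sigma> \<otimes> \<sigma> = \<sigma> [^] (2 :: int)" using gens_closed(1) int_pow_mult[of \<sigma> 1 1] by simp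
      then show ?thesis using gens_closed(1) by (simp only: int_pow_pow)
    qed
    have "\<zeta> [^] z \<otimes> (\<sigma> \<otimes> \<sigma>) [^] \<alpha> j = (\<sigma> \<otimes> \<sigma>) [^] \<alpha> j \<otimes> \<zeta> [^] z"
    proof -
      have "\<zeta> [^] z \<otimes> \<sigma> = \<sigma> \<otimes> \<zeta> [^] z"
        by (rule int_pow_commute) (simp_all add: gens_closed sigma_commute)
      from int_pow_commute[OF _ _ this[symmetric]] show ?thesis
        unfolding two using gens_closed by simp
    qed
    then have "\<zeta> [^] z \<otimes> ((\<sigma> \<otimes> \<sigma>) [^] \<alpha> j \<otimes> ?N') = \<sigma> [^] (2 * \<alpha> j) \<otimes> (\<zeta> [^] z \<otimes> ?N')"
      using N c gens_closed(1) unfolding two by (simp flip: m_assoc)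
    then show ?thesis using nf_mult_b[of g j \<alpha> \<beta>] 4 N c gens_closed unfolding 1
      by (simp add: op m_assoc int_pow_mult)
  qed
qed

lemma of_heis_mult_weval:
  assumes "w \<in> words (ak_gens g)"
  shows "of_heis (p \<otimes>\<^bsub>heis g\<^esub> weval (heis g) (heis_gen \<circ> ak_bgen) w) = of_heis p \<otimes> weval G gen w"
  using assms
proof (induction w arbitrary: p)
  case Nil
  then show ?case by (cases p) simp
next
  case (Cons x w)
  interpret H: group "heis g" by (rule group_heis)
  obtain y e where x: "x = (y, e)" by (cases x)
  have y: "y \<in> ak_gens g" and w: "w \<in> words (ak_gens g)" using Cons.prems x by auto
  have c: "gen y \<in> carrier G" "weval G gen w \<in> carrier G" using y w gen_closed by auto
  let ?x = "if e then heis_gen (ak_bgen y) else inv\<^bsub>heis g\<^esub> heis_gen (ak_bgen y)"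
  have H: "q \<in> carrier (heis g)" for q by (simp add: heis_def)
  have "of_heis (p \<otimes>\<^bsub>heis g\<^esub> ?x) = of_heis p \<otimes> (if e then gen y else inv gen y)"
  proof (cases e)
    case False
    \<comment> \<open>For an inverse letter, the statement about generators is applied at
      \<open>p\<close> times that inverse, and \<open>gen y\<close> is then cancelled on the
      right.\<close>
    have "of_heis (p \<otimes>\<^bsub>heis g\<^esub> ?x) \<otimes> gen y
        = of_heis (p \<otimes>\<^bsub>heis g\<^esub> ?x \<otimes>\<^bsub>heis g\<^esub> heis_gen (ak_bgen y))"
      using of_heis_mult_gen[OF y] by simp
    also have "p \<otimes>\<^bsub>heis g\<^esub> ?x \<otimes>\<^bsub>heis g\<^esub> heis_gen (ak_bgen y) = p"
      using False H.m_assoc[OF H H H] H.l_inv[OF H] H.r_one[OF H] by simp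
    finally show ?thesis using False c by (simp add: inv_solve_right)
  qed (simp add: of_heis_mult_gen[OF y])
  moreover have "(if e then gen y else inv gen y) \<in> carrier G" using c by simp
  ultimately show ?case
    using Cons.IH[OF w, of "p \<otimes>\<^bsub>heis g\<^esub> ?x"] c H.m_assoc[OF H H H]
    by (simp add: x m_assoc del: heis_simps(1) split del: if_split)
qed

text \<open>Uniqueness of coordinates: starting at the neutral element, a word acts on normal forms
  only through its value in \<open>heis g\<close>. This is the faithfulness statement behind both
  injectivity results.\<close>

lemma weval_gen_eq_one:
  assumes "w \<in> words (ak_gens g)" "weval (heis g) (heis_gen \<circ> ak_bgen) w = \<one>\<^bsub>heis g\<^esub>"
  shows "weval G gen w = \<one>"
proof -
  have "of_heis (0, 0, 0) = \<one>" by (simp add: of_heis_def zero_fun_def)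
  then show ?thesis
    using of_heis_mult_weval[OF assms(1), of "(0, 0, 0)"] assms gen_closed by simp
qed

end

lemma (in ak_group) ak_rels_gen:
  assumes "(u, v) \<in> ak_rels g"
  shows "weval G gen u = weval G gen v"
proof -
  from assms consider
    x y where "u = letter x @ letter y" "v = letter y @ letter x" "x \<in> ak_gens g" "y \<in> ak_gens g"
      "x \<noteq> y" "\<forall>i. {x, y} \<noteq> {AKa i, AKb i}"
  | i where "u = wcomm (letter (AKa i)) (letter (AKb i))" "v = letter AKsigma @ letter AKsigma" "i \<in> {1..g}"
    unfolding ak_rels_def by blast
  then show ?thesis
  proof cases
    case (1 x y)
    have "gen x \<otimes> gen y = gen y \<otimes> gen x"
    proof (cases x; cases y)
      fix i j assume "x = AKa i" "y = AKa j"
      then show ?thesis using 1(3-5) ab_commute(1)[of i j] by (auto simp: ak_gens_def)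
    next
      fix i j assume "x = AKb i" "y = AKb j"
      then show ?thesis using 1(3-5) ab_commute(3)[of i j] by (auto simp: ak_gens_def)
    next
      fix i j assume "x = AKa i" "y = AKb j"
      then show ?thesis using 1(3-6) ab_commute(2)[of i j] by (auto simp: ak_gens_def doubleton_eq_iff)
    next
      fix i j assume "x = AKb i" "y = AKa j"
      then show ?thesis using 1(3-6) ab_commute(2)[of j i] by (auto simp: ak_gens_def doubleton_eq_iff)
    qed (use 1(3-6) sigma_commute zeta_commute in \<open>auto simp: ak_gens_def\<close>)
    then show ?thesis using 1 gen_closed by (auto simp: letter_def Pi_def)
  next
    case (2 i)
    have c: "a i \<in> carrier G" "b i \<in> carrier G" "\<sigma> \<in> carrier G" using 2 gens_closed by auto
    have "comm (a i) (b i) = \<sigma> \<otimes> \<sigma>" using c ab_swap[OF 2(3)] by (intro comm_unique) auto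
    then show ?thesis using c by (simp add: 2 wcomm_def letter_def comm_def m_assoc)
  qed
qed

section \<open>Induced maps on fundamental groups\<close>

lemma loop_homotopic_refl:
  assumes "p \<in> loops Y y"
  shows "loop_homotopic Y y p p"
  using assms by (auto simp: loop_homotopic_def loops_def pathin_def)

lemma loop_homotopic_compose:
  assumes "loop_homotopic X x p q" "continuous_map X Y f"
  shows "loop_homotopic Y (f x) (f \<circ> p) (f \<circ> q)"
  using assms unfolding loop_homotopic_def
  by (rule homotopic_with_compose_continuous_map_left) auto

lemma loop_class_eq:
  assumes "loop_homotopic Y y p q"
  shows "loop_class Y y p = loop_class Y y q"
  using assms unfolding loop_class_def loop_homotopic_def
  by (auto intro: homotopic_with_trans homotopic_with_symD)

lemma loops_compose:
  assumes "p \<in> loops X x" "continuous_map X Y f"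
  shows "f \<circ> p \<in> loops Y (f x)"
  using assms by (auto simp: loops_def pathin_def intro: continuous_map_compose)

text \<open>The union defining \<open>pi1_map\<close> runs over homotopic loops, whose images are
  homotopic, so all its members are the same class.\<close>

lemma pi1_map_loop_class:
  assumes "continuous_map X Y f" "p \<in> loops X x"
  shows "pi1_map Y (f x) f (loop_class X x p) = loop_class Y (f x) (f \<circ> p)"
proof -
  have "loop_class Y (f x) (f \<circ> q) = loop_class Y (f x) (f \<circ> p)" if "q \<in> loop_class X x p" for q
  proof -
    have "loop_homotopic X x p q" using that by (simp add: loop_class_def)
    from loop_class_eq[OF loop_homotopic_compose[OF this assms(1)]] show ?thesis by (rule HOL.sym)
  qed
  moreover have "p \<in> loop_class X x p"
    using assms(2) by (simp add: loop_class_def loop_homotopic_refl)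
  ultimately show ?thesis unfolding pi1_map_def by blast
qed

lemma loop_join_loops:
  assumes "p \<in> loops Y y" "q \<in> loops Y y"
  shows "loop_join p q \<in> loops Y y"
proof -
  have p: "continuous_map (top_of_set {0..1}) Y p" "p 0 = y" "p 1 = y"
    and q: "continuous_map (top_of_set {0..1}) Y q" "q 0 = y" "q 1 = y"
    using assms by (auto simp: loops_def pathin_def)
  have "continuous_map (top_of_set {0..1::real}) Y (\<lambda>t. if t \<le> 1/2 then p (2 * t) else q (2 * t - 1))"
  proof (rule continuous_map_cases_le)
    show "continuous_map (subtopology (top_of_set {0..1}) {t \<in> topspace (top_of_set {0..1::real}). t \<le> 1/2})
        Y (\<lambda>t. p (2 * t))"
      by (rule continuous_map_compose[OF _ p(1), unfolded o_def])
         (auto simp: subtopology_subtopology continuous_map_in_subtopology intro!: continuous_intros)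
    show "continuous_map (subtopology (top_of_set {0..1}) {t \<in> topspace (top_of_set {0..1::real}). 1/2 \<le> t})
        Y (\<lambda>t. q (2 * t - 1))"
      by (rule continuous_map_compose[OF _ q(1), unfolded o_def])
         (auto simp: subtopology_subtopology continuous_map_in_subtopology intro!: continuous_intros)
    show "p (2 * t) = q (2 * t - 1)" if "t = 1/2" for t
      unfolding that using p q by simp
  qed auto
  then show ?thesis using p q by (simp add: loops_def pathin_def loop_join_def)
qed

lemma loop_homotopic_join:
  assumes "loop_homotopic Y y p p'" "loop_homotopic Y y q q'"
  shows "loop_homotopic Y y (loop_join p q) (loop_join p' q')"
proof -
  let ?I = "top_of_set {0..1::real}"
  from assms(1) obtain h where h: "continuous_map (prod_topology ?I ?I) Y h"
    "\<And>x. h (0, x) = p x" "\<And>x. h (1, x) = p' x"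
    "\<And>t. t \<in> {0..1} \<Longrightarrow> h (t, 0) = y \<and> h (t, 1) = y"
    unfolding loop_homotopic_def homotopic_with_def by blast
  from assms(2) obtain j where j: "continuous_map (prod_topology ?I ?I) Y j"
    "\<And>x. j (0, x) = q x" "\<And>x. j (1, x) = q' x"
    "\<And>t. t \<in> {0..1} \<Longrightarrow> j (t, 0) = y \<and> j (t, 1) = y"
    unfolding loop_homotopic_def homotopic_with_def by blast
  let ?H = "\<lambda>z. if snd z \<le> 1/2 then h (fst z, 2 * snd z) else j (fst z, 2 * snd z - 1)"
  have "continuous_map (prod_topology ?I ?I) Y ?H"
  proof (rule continuous_map_cases_le)
    show "continuous_map (subtopology (prod_topology ?I ?I) {z \<in> topspace (prod_topology ?I ?I). snd z \<le> 1/2})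
        Y (\<lambda>z. h (fst z, 2 * snd z))"
      by (rule continuous_map_compose[OF _ h(1), unfolded o_def])
         (auto simp: subtopology_subtopology continuous_map_in_subtopology prod_topology_subtopology
           simp flip: euclidean_product_topology intro!: continuous_intros)
    show "continuous_map (subtopology (prod_topology ?I ?I) {z \<in> topspace (prod_topology ?I ?I). 1/2 \<le> snd z})
        Y (\<lambda>z. j (fst z, 2 * snd z - 1))"
      by (rule continuous_map_compose[OF _ j(1), unfolded o_def])
         (auto simp: subtopology_subtopology continuous_map_in_subtopology prod_topology_subtopology
           simp flip: euclidean_product_topology intro!: continuous_intros)
    \<comment> \<open>The first coordinate is the time of the homotopy, the second the parameter of
      the loop. The two halves fit at 1/2 because both homotopies keep the end points at
      \<open>y\<close>.\<close>
    show "h (fst z, 2 * snd z) = j (fst z, 2 * snd z - 1)"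
      if "z \<in> topspace (prod_topology ?I ?I)" "snd z = 1/2" for z
      unfolding that(2) using that(1) h(4)[of "fst z"] j(4)[of "fst z"] by (auto simp: mem_Times_iff)
  qed (auto simp: continuous_map_of_snd intro!: continuous_intros)
  then show ?thesis unfolding loop_homotopic_def homotopic_with_def
    by (intro exI[of _ ?H]) (use h j in \<open>auto simp: loop_join_def\<close>)
qed

lemma mult_pi1:
  assumes "p \<in> loops Y y" "q \<in> loops Y y"
  shows "loop_class Y y p \<otimes>\<^bsub>pi1 Y y\<^esub> loop_class Y y q = loop_class Y y (loop_join p q)"
proof -
  have "loop_class Y y (loop_join p' q') = loop_class Y y (loop_join p q)"
    if "p' \<in> loop_class Y y p" "q' \<in> loop_class Y y q" for p' q'
  proof -
    have "loop_homotopic Y y p p'" "loop_homotopic Y y q q'" using that by (simp_all add: loop_class_def)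
    from loop_class_eq[OF loop_homotopic_join[OF this]] show ?thesis by (rule HOL.sym)
  qed
  moreover have "p \<in> loop_class Y y p" "q \<in> loop_class Y y q"
    using assms by (simp_all add: loop_class_def loop_homotopic_refl)
  ultimately have "(\<Union>p'\<in>loop_class Y y p. \<Union>q'\<in>loop_class Y y q. loop_class Y y (loop_join p' q'))
      = loop_class Y y (loop_join p q)" by blast
  then show ?thesis by (simp add: pi1_def)
qed

text \<open>Composition with \<open>f\<close> commutes with \<open>loop_join\<close> on the nose,
  without a homotopy. Multiplicativity is all that is required here, as the group laws for the braid
  groups are part of \<open>presents\<close>.\<close>

lemma pi1_map_hom:
  assumes f: "continuous_map X Y f"
  shows "pi1_map Y (f x) f \<in> hom (pi1 X x) (pi1 Y (f x))"
proof (rule homI)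
  fix C assume "C \<in> carrier (pi1 X x)"
  then obtain p where p: "p \<in> loops X x" "C = loop_class X x p" by (auto simp: pi1_def)
  show "pi1_map Y (f x) f C \<in> carrier (pi1 Y (f x))"
    using loops_compose[OF p(1) f] by (simp add: p pi1_map_loop_class f pi1_def)
  fix D assume "D \<in> carrier (pi1 X x)"
  then obtain q where q: "q \<in> loops X x" "D = loop_class X x q" by (auto simp: pi1_def)
  have "f \<circ> loop_join p q = loop_join (f \<circ> p) (f \<circ> q)" by (auto simp: loop_join_def)
  then show "pi1_map Y (f x) f (C \<otimes>\<^bsub>pi1 X x\<^esub> D) =
      pi1_map Y (f x) f C \<otimes>\<^bsub>pi1 Y (f x)\<^esub> pi1_map Y (f x) f D"
    using loops_compose[OF p(1) f] loops_compose[OF q(1) f] p q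
    by (simp add: mult_pi1 pi1_map_loop_class f loop_join_loops)
qed

section \<open>Maps between configuration spaces\<close>

lemma topspace_quotient_topology [simp]: "topspace (quotient_topology Y f) = f ` topspace Y"
proof -
  have "openin (quotient_topology Y f) (f ` topspace Y)"
  proof -
    have "{y \<in> topspace Y. f y \<in> f ` topspace Y} = topspace Y" by auto
    then show ?thesis by (simp add: openin_quotient_topology)
  qed
  then have "f ` topspace Y \<subseteq> topspace (quotient_topology Y f)" by (rule openin_subset)
  moreover have "topspace (quotient_topology Y f) \<subseteq> f ` topspace Y"
    using openin_topspace[of "quotient_topology Y f"] unfolding openin_quotient_topology by blast
  ultimately show ?thesis by blast
qed

text \<open>The universal property of the quotient, with \<open>h\<close> standing for the composite
  \<open>j \<circ> f\<close>: continuity between orbit spaces is checked on configurations.\<close>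

lemma continuous_map_quotient:
  assumes "continuous_map Y Z h" "\<And>y. y \<in> topspace Y \<Longrightarrow> j (f y) = h y"
  shows "continuous_map (quotient_topology Y f) Z j"
  unfolding continuous_map_def
proof (intro conjI allI impI)
  show "j \<in> topspace (quotient_topology Y f) \<rightarrow> topspace Z"
    using assms continuous_map_image_subset_topspace by (fastforce simp: continuous_map_def)
  fix U assume "openin Z U"
  then have "openin Y {y \<in> topspace Y. h y \<in> U}" using assms(1) by (simp add: continuous_map_def)
  moreover have "{y \<in> topspace Y. f y \<in> {x \<in> f ` topspace Y. j x \<in> U}} = {y \<in> topspace Y. h y \<in> U}"
    using assms(2) by (intro Collect_cong) (simp add: imageI cong: conj_cong)
  ultimately show "openin (quotient_topology Y f) {x \<in> topspace (quotient_topology Y f). j x \<in> U}"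
    unfolding openin_quotient_topology topspace_quotient_topology by simp
qed

lemma continuous_map_into_quotient: "continuous_map Y (quotient_topology Y f) f"
  unfolding continuous_map_def by (auto simp: openin_quotient_topology)

lemma sym_perms_restrict:
  assumes "p \<in> mixed_perms k n"
  obtains q where "q \<in> sym_perms n" "\<And>i. i < n \<Longrightarrow> p (k + i) = k + q i"
proof -
  have p: "p permutes {..<k + n}" "p ` {..<k} = {..<k}" using assms by (auto simp: mixed_perms_def)
  have inj: "inj p" using p(1) permutes_inj by blast
  have pk: "k \<le> p (k + i) \<and> p (k + i) < k + n" if "i < n" for i
  proof -
    have "p (k + i) < k + n" using p(1) that permutes_in_image[of p "{..<k + n}" "k + i"] by auto
    moreover have "\<not> p (k + i) < k"
    proof
      assume "p (k + i) < k"
      then have "p (k + i) \<in> p ` {..<k}" using p(2) by auto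
      then show False using inj by (auto dest: injD)
    qed
    ultimately show ?thesis by simp
  qed
  \<comment> \<open>Subtraction is harmless since \<open>p\<close> maps the last \<open>n\<close>
    indices above \<open>k\<close>; the value \<open>i\<close> outside the range is what
    \<open>permutes\<close> demands.\<close>
  define q where "q i = (if i < n then p (k + i) - k else i)" for i
  have "q permutes {..<n}"
  proof (rule bij_imp_permutes)
    have "inj_on q {..<n}"
    proof (rule inj_onI)
      fix i j assume ij: "i \<in> {..<n}" "j \<in> {..<n}" "q i = q j"
      then have "p (k + i) = p (k + j)" using pk[of i] pk[of j] by (auto simp: q_def eq_diff_iff)
      then show "i = j" using injD[OF inj, of "k + i" "k + j"] by simp
    qed
    moreover have "q ` {..<n} \<subseteq> {..<n}" using pk by (force simp: q_def)
    ultimately show "bij_betw q {..<n} {..<n}"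
      by (simp add: bij_betw_def endo_inj_surj)
  qed (simp add: q_def)
  moreover have "p (k + i) = k + q i" if "i < n" for i using pk[OF that] that by (simp add: q_def)
  ultimately show ?thesis using that by (auto simp: sym_perms_def)
qed

lemma mixed_perms_join:
  assumes "p \<in> sym_perms k" "q \<in> sym_perms n"
  obtains r where "r \<in> mixed_perms k n" "\<And>i. i < k \<Longrightarrow> r i = p i" "\<And>i. i < n \<Longrightarrow> r (k + i) = k + q i"
proof -
  have p: "p permutes {..<k}" and q: "q permutes {..<n}" using assms by (auto simp: sym_perms_def)
  have pk: "p i < k \<longleftrightarrow> i < k" for i using permutes_in_image[OF p, of i] by simp
  have qn: "q i < n \<longleftrightarrow> i < n" for i using permutes_in_image[OF q, of i] by simp
  define r where "r i = (if i < k then p i else if i < k + n then k + q (i - k) else i)" for i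
  have "r permutes {..<k + n}"
  proof (rule bij_imp_permutes)
    have "inj_on r {..<k + n}"
    proof (rule inj_onI)
      fix i j assume ij: "i \<in> {..<k + n}" "j \<in> {..<k + n}" "r i = r j"
      show "i = j"
      proof (cases "i < k"; cases "j < k")
        assume "i < k" "j < k"
        then show ?thesis using ij permutes_inj[OF p] by (auto simp: r_def dest: injD)
      next
        assume *: "\<not> i < k" "\<not> j < k"
        then have "q (i - k) = q (j - k)" using ij by (auto simp: r_def)
        then have "i - k = j - k" using permutes_inj[OF q] by (auto dest: injD)
        then show ?thesis using * by simp
      next
        assume "i < k" "\<not> j < k"
        then show ?thesis using ij pk[of i] by (auto simp: r_def)
      next
        assume "\<not> i < k" "j < k"
        then show ?thesis using ij pk[of j] by (auto simp: r_def)
      qed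
    qed
    moreover have "r i < k + n" if "i < k + n" for i
      using that pk[of i] qn[of "i - k"] by (auto simp: r_def)
    then have "r ` {..<k + n} \<subseteq> {..<k + n}" by auto
    ultimately show "bij_betw r {..<k + n} {..<k + n}" by (simp add: bij_betw_def endo_inj_surj)
  qed (simp add: r_def)
  moreover have "r ` {..<k} = {..<k}"
  proof -
    have "r ` {..<k} = p ` {..<k}" by (rule image_cong) (auto simp: r_def)
    then show ?thesis using permutes_image[OF p] by simp
  qed
  ultimately show ?thesis using that by (auto simp: mixed_perms_def r_def)
qed

lemma id_in_perms: "id \<in> sym_perms n" "id \<in> mixed_perms k n"
  by (auto simp: sym_perms_def mixed_perms_def permutes_id)

text \<open>A mixed permutation restricts to the last \<open>n\<close> indices, and conversely each
  permutation of these extends by the identity on the first \<open>k\<close>. The equality of whole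
  orbits serves both the continuity of the map on quotients and the identification of base
  points.\<close>

lemma last_points_orbit:
  "last_points k n ` orbit_of (mixed_perms k n) x = orbit_of (sym_perms n) (last_points k n x)"
proof
  show "last_points k n ` orbit_of (mixed_perms k n) x \<subseteq> orbit_of (sym_perms n) (last_points k n x)"
  proof
    fix y assume "y \<in> last_points k n ` orbit_of (mixed_perms k n) x"
    then obtain p where p: "p \<in> mixed_perms k n" "y = last_points k n (x \<circ> p)" by (auto simp: orbit_of_def)
    obtain q where q: "q \<in> sym_perms n" "\<And>i. i < n \<Longrightarrow> p (k + i) = k + q i"
      using sym_perms_restrict[OF p(1)] by blast
    have "q i < n \<longleftrightarrow> i < n" for i using q(1) permutes_in_image[of q "{..<n}" i] by (simp add: sym_perms_def)
    then have "last_points k n (x \<circ> p) i = (last_points k n x \<circ> q) i" for i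
      by (cases "i < n") (simp_all add: last_points_def q(2))
    then have "y = last_points k n x \<circ> q" unfolding p(2) by blast
    then show "y \<in> orbit_of (sym_perms n) (last_points k n x)" using q(1) by (auto simp: orbit_of_def)
  qed
  show "orbit_of (sym_perms n) (last_points k n x) \<subseteq> last_points k n ` orbit_of (mixed_perms k n) x"
  proof
    fix y assume "y \<in> orbit_of (sym_perms n) (last_points k n x)"
    then obtain q where q: "q \<in> sym_perms n" "y = last_points k n x \<circ> q" by (auto simp: orbit_of_def)
    obtain r where r: "r \<in> mixed_perms k n" "\<And>i. i < n \<Longrightarrow> r (k + i) = k + q i"
      using mixed_perms_join[OF id_in_perms(1) q(1)] by blast
    have "q i < n \<longleftrightarrow> i < n" for i using q(1) permutes_in_image[of q "{..<n}" i] by (simp add: sym_perms_def)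
    then have "(last_points k n x \<circ> q) i = last_points k n (x \<circ> r) i" for i
      by (cases "i < n") (simp_all add: last_points_def r(2))
    then have "y = last_points k n (x \<circ> r)" unfolding q(2) by blast
    then show "y \<in> last_points k n ` orbit_of (mixed_perms k n) x" using r(1) by (auto simp: orbit_of_def)
  qed
qed

text \<open>The mixed permutations are closed under composition and inverses, so replacing
  \<open>x\<close> by \<open>x \<circ> r\<close> only relabels the orbit.\<close>

lemma orbit_of_mixed_perms_comp:
  assumes "r \<in> mixed_perms k n"
  shows "orbit_of (mixed_perms k n) (x \<circ> r) = orbit_of (mixed_perms k n) x"
proof -
  have r: "r permutes {..<k + n}" "r ` {..<k} = {..<k}" using assms by (auto simp: mixed_perms_def)
  have mult: "p \<circ> q \<in> mixed_perms k n" if "p \<in> mixed_perms k n" "q \<in> mixed_perms k n" for p q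
  proof -
    have "(p \<circ> q) ` {..<k} = p ` q ` {..<k}" by (rule image_comp[symmetric])
    then show ?thesis using that by (simp add: mixed_perms_def permutes_compose)
  qed
  have inv: "inv_into UNIV r \<in> mixed_perms k n"
  proof -
    have "inv_into UNIV r ` r ` {..<k} = {..<k}" using permutes_inverses(2)[OF r(1)] by (simp add: image_comp)
    then show ?thesis using r permutes_inv by (auto simp: mixed_perms_def)
  qed
  show ?thesis
  proof
    show "orbit_of (mixed_perms k n) (x \<circ> r) \<subseteq> orbit_of (mixed_perms k n) x"
      using mult[OF assms] by (auto simp: orbit_of_def comp_assoc)
    have "x \<circ> p = (x \<circ> r) \<circ> (inv_into UNIV r \<circ> p)" for p
      using permutes_inverses(1)[OF r(1)] by (auto simp: fun_eq_iff)
    then show "orbit_of (mixed_perms k n) x \<subseteq> orbit_of (mixed_perms k n) (x \<circ> r)"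
      using mult[OF inv] unfolding orbit_of_def by blast
  qed
qed

text \<open>Permuting the \<open>k\<close> moving points extends by the identity on the punctures to
  a mixed permutation. Hence all members of the union coincide, and the map used in
  \<open>fibre_incl\<close> is well defined on orbits.\<close>

lemma add_points_orbit:
  "(\<Union>x'\<in>orbit_of (sym_perms k) x. orbit_of (mixed_perms k n) (add_points k n c x'))
     = orbit_of (mixed_perms k n) (add_points k n c x)"
proof -
  have "orbit_of (mixed_perms k n) (add_points k n c (x \<circ> p)) = orbit_of (mixed_perms k n) (add_points k n c x)"
    if p: "p \<in> sym_perms k" for p
  proof -
    obtain r where r: "r \<in> mixed_perms k n" "\<And>i. i < k \<Longrightarrow> r i = p i" "\<And>i. i < n \<Longrightarrow> r (k + i) = k + i"
      using mixed_perms_join[OF p id_in_perms(1), of n] by auto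
    have "p i < k \<longleftrightarrow> i < k" for i using p permutes_in_image[of p "{..<k}" i] by (simp add: sym_perms_def)
    moreover have "r i < k + n \<longleftrightarrow> i < k + n" for i
      using r(1) permutes_in_image[of r "{..<k + n}" i] by (simp add: mixed_perms_def)
    moreover have "r i = i" if "k \<le> i" "i < k + n" for i using r(3)[of "i - k"] that by auto
    ultimately have "add_points k n c (x \<circ> p) = add_points k n c x \<circ> r"
      by (auto simp: add_points_def fun_eq_iff r(2))
    then show ?thesis using orbit_of_mixed_perms_comp[OF r(1)] by metis
  qed
  moreover have "x \<in> orbit_of (sym_perms k) x"
  proof -
    have "x \<circ> id \<in> orbit_of (sym_perms k) x" unfolding orbit_of_def using id_in_perms(1)[of k] by blast
    then show ?thesis by simp
  qed
  ultimately show ?thesis unfolding orbit_of_def[of "sym_perms k"] by blast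
qed

lemma continuous_map_last_points:
  "continuous_map (config_space (k + n) X) (config_space n X) (last_points k n)"
proof -
  have "continuous_map (config_space (k + n) X) X (\<lambda>x. x (k + i))" if "i < n" for i
    unfolding config_space_def
    by (intro continuous_map_from_subtopology continuous_map_product_projection) (use that in auto)
  moreover have "inj_on (last_points k n x) {..<n}" if "inj_on x {..<k + n}" for x :: "nat \<Rightarrow> 'a"
  proof (rule inj_onI)
    fix i j assume "i \<in> {..<n}" "j \<in> {..<n}" "last_points k n x i = last_points k n x j"
    then show "i = j" using inj_onD[OF that, of "k + i" "k + j"] by (simp add: last_points_def)
  qed
  ultimately show ?thesis
    unfolding config_space_def[of n X] continuous_map_in_subtopology continuous_map_componentwise
    by (auto simp: last_points_def config_space_def)
qed

lemma psi_hom: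
  "psi k n X c \<in> hom (mixed_braid_group k n X c) (braid_group n X (last_points k n c))"
proof -
  have "continuous_map (mixed_braid_space k n X) (braid_space n X) ((`) (last_points k n))"
    unfolding mixed_braid_space_def
  proof (rule continuous_map_quotient)
    show "continuous_map (config_space (k + n) X) (braid_space n X) (orbit_of (sym_perms n) \<circ> last_points k n)"
      unfolding braid_space_def
      by (rule continuous_map_compose[OF continuous_map_last_points continuous_map_into_quotient])
  qed (simp add: last_points_orbit)
  from pi1_map_hom[OF this, of "orbit_of (mixed_perms k n) c"] show ?thesis
    by (simp add: psi_def mixed_braid_group_def braid_group_def last_points_orbit)
qed

lemma continuous_map_add_points:
  assumes "c \<in> {..<k + n} \<rightarrow> topspace X" "inj_on c {..<k + n}"
  shows "continuous_map (config_space k (punctured k n X c)) (config_space (k + n) X) (add_points k n c)"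
proof -
  let ?Y = "config_space k (punctured k n X c)"
  have "continuous_map ?Y X (\<lambda>x. if i < k then x i else c i)" if "i < k + n" for i
  proof (cases "i < k")
    case True
    have "continuous_map ?Y (punctured k n X c) (\<lambda>x. x i)"
      unfolding config_space_def
      by (intro continuous_map_from_subtopology continuous_map_product_projection) (use True in auto)
    then show ?thesis using True by (simp add: punctured_def continuous_map_in_subtopology)
  next
    case False
    then show ?thesis using assms(1) that by (auto simp: Pi_def)
  qed
  moreover have "inj_on (add_points k n c x) {..<k + n}" if "x \<in> topspace ?Y" for x
  proof (rule inj_onI)
    fix i j assume ij: "i \<in> {..<k + n}" "j \<in> {..<k + n}" "add_points k n c x i = add_points k n c x j"
    \<comment> \<open>The moving points avoid the punctures because the configuration lies in the
      punctured surface; this excludes the mixed cases below.\<close>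
    have x: "inj_on x {..<k}" "\<And>l. l < k \<Longrightarrow> x l \<notin> c ` {k..<k + n}"
      using that by (auto simp: config_space_def punctured_def)
    have c: "c l \<in> c ` {k..<k + n}" if "\<not> l < k" "l < k + n" for l using that by auto
    show "i = j"
      using c[of i] c[of j] ij x(1) x(2)[of i] x(2)[of j] assms(2)
      by (cases "i < k"; cases "j < k") (auto simp: add_points_def inj_on_def)
  qed
  ultimately show ?thesis
    unfolding config_space_def[of "k + n" X] continuous_map_in_subtopology continuous_map_componentwise
    by (auto simp: add_points_def)
qed

lemma fibre_incl_hom:
  assumes "c \<in> {..<k + n} \<rightarrow>\<^sub>E topspace X" "inj_on c {..<k + n}"
  shows "fibre_incl k n X c \<in> hom (fibre_braid_group k n X c) (mixed_braid_group k n X c)"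
proof -
  let ?f = "\<lambda>A. \<Union>x\<in>A. orbit_of (mixed_perms k n) (add_points k n c x)"
  have "continuous_map (braid_space k (punctured k n X c)) (mixed_braid_space k n X) ?f"
    unfolding braid_space_def
  proof (rule continuous_map_quotient)
    show "continuous_map (config_space k (punctured k n X c)) (mixed_braid_space k n X)
        (orbit_of (mixed_perms k n) \<circ> add_points k n c)"
      unfolding mixed_braid_space_def using assms
      by (intro continuous_map_compose[OF continuous_map_add_points continuous_map_into_quotient]) auto
  qed (simp add: add_points_orbit)
  \<comment> \<open>Equality as functions, not just on the indices used, relies on \<open>c\<close>
    being extensional. It makes the base points of the two fundamental groups correspond.\<close>
  moreover have "add_points k n c (first_points k c) = c"
    using assms(1) by (auto simp: add_points_def first_points_def fun_eq_iff PiE_def extensional_def)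
  ultimately show ?thesis
    using pi1_map_hom[of "braid_space k (punctured k n X c)" _ ?f "orbit_of (sym_perms k) (first_points k c)"]
    by (simp add: fibre_incl_def mixed_braid_group_def fibre_braid_group_def braid_group_def add_points_orbit)
qed

section \<open>The relations modulo the third term of the lower central series\<close>

lemma gens_fibre_simps [simp]:
  "Sig i \<in> gens_fibre k n g \<longleftrightarrow> 1 \<le> i \<and> i < k" "Al i \<in> gens_fibre k n g \<longleftrightarrow> 1 \<le> i \<and> i \<le> g"
  "Be i \<in> gens_fibre k n g \<longleftrightarrow> 1 \<le> i \<and> i \<le> g" "Zet i \<in> gens_fibre k n g \<longleftrightarrow> 1 \<le> i \<and> i \<le> n"
  by (auto simp: gens_fibre_def)

lemma gens_base_simps [simp]:
  "Sig' i \<in> gens_base n g \<longleftrightarrow> 1 \<le> i \<and> i < n" "Al' i \<in> gens_base n g \<longleftrightarrow> 1 \<le> i \<and> i \<le> g"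
  "Be' i \<in> gens_base n g \<longleftrightarrow> 1 \<le> i \<and> i \<le> g"
  by (auto simp: gens_base_def)

text \<open>The introduction rules with compositions such as \<open>letter \<circ> Sig\<close>
  written out as abstractions, so that instances reduce to concrete words.\<close>

lemmas fibre_rels = surface_rels.intros[where m = m and g = g and s = "\<lambda>i. letter (Sig i)"
    and a = "\<lambda>i. letter (Al i)" and b = "\<lambda>i. letter (Be i)" for m g]

lemmas fibre_zeta_rels = zeta_rels.intros[where k = k and n = n and g = g and s = "\<lambda>i. letter (Sig i)"
    and a = "\<lambda>i. letter (Al i)" and b = "\<lambda>i. letter (Be i)" and z = "\<lambda>i. letter (Zet i)" for k n g]

lemmas mixed_action_rels = action_rels.intros[where k = k and n = n and g = g and s = "\<lambda>i. letter (Sig i)"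
    and a = "\<lambda>i. letter (Al i)" and b = "\<lambda>i. letter (Be i)" and z = "\<lambda>i. letter (Zet i)" and s' = "\<lambda>i. letter (Sig' i)"
    and a' = "\<lambda>i. letter (Al' i)" and b' = "\<lambda>i. letter (Be' i)" for k n g]

text \<open>Collects the consequences of the mixed relations in an arbitrary group of class two. The
  intended instance is the quotient of the braid group by \<open>\<Gamma>_3\<close>, with
  \<open>f\<close> giving the images of the standard generators.\<close>

locale mixed_class2 = group +
  fixes k n g :: nat and f :: "bgen \<Rightarrow> 'a"
  assumes kn: "1 \<le> g" "3 \<le> k" "3 \<le> n" and class2: "class2"
    and f_closed: "f \<in> gens_fibre k n g \<union> gens_base n g \<rightarrow> carrier G"
    and rel: "\<And>u v. (u, v) \<in> rels_mixed k n g \<Longrightarrow> u \<in> words (gens_fibre k n g \<union> gens_base n g) \<Longrightarrow>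
      v \<in> words (gens_fibre k n g \<union> gens_base n g) \<Longrightarrow> weval G f u = weval G f v"
begin

lemma surface_rel:
  assumes "(u, v) \<in> surface_rels k g (\<lambda>i. letter (Sig i)) (\<lambda>i. letter (Al i)) (\<lambda>i. letter (Be i))"
    "u \<in> words (gens_fibre k n g)" "v \<in> words (gens_fibre k n g)"
  shows "weval G f u = weval G f v"
  using assms by (intro rel) (auto simp: rels_mixed_def rels_fibre_def comp_def intro: words_mono[rotated])

lemma zeta_rel:
  assumes "(u, v) \<in> zeta_rels k n g (\<lambda>i. letter (Sig i)) (\<lambda>i. letter (Al i)) (\<lambda>i. letter (Be i)) (\<lambda>i. letter (Zet i))"
    "u \<in> words (gens_fibre k n g)" "v \<in> words (gens_fibre k n g)"
  shows "weval G f u = weval G f v"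
  using assms by (intro rel) (auto simp: rels_mixed_def rels_fibre_def comp_def intro: words_mono[rotated])

lemma action_rel:
  assumes "(u, v) \<in> action_rels k n g (\<lambda>i. letter (Sig i)) (\<lambda>i. letter (Al i)) (\<lambda>i. letter (Be i)) (\<lambda>i. letter (Zet i))
      (\<lambda>i. letter (Sig' i)) (\<lambda>i. letter (Al' i)) (\<lambda>i. letter (Be' i))"
    "u \<in> words (gens_fibre k n g \<union> gens_base n g)" "v \<in> words (gens_fibre k n g \<union> gens_base n g)"
  shows "weval G f u = weval G f v"
  using assms by (intro rel) (auto simp: rels_mixed_def comp_def)

lemma closed [simp]:
  "1 \<le> i \<Longrightarrow> i < k \<Longrightarrow> f (Sig i) \<in> carrier G" "1 \<le> i \<Longrightarrow> i \<le> n \<Longrightarrow> f (Zet i) \<in> carrier G"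
  "1 \<le> i \<Longrightarrow> i \<le> g \<Longrightarrow> f (Al i) \<in> carrier G" "1 \<le> i \<Longrightarrow> i \<le> g \<Longrightarrow> f (Be i) \<in> carrier G"
  "1 \<le> i \<Longrightarrow> i < n \<Longrightarrow> f (Sig' i) \<in> carrier G"
  "1 \<le> i \<Longrightarrow> i \<le> g \<Longrightarrow> f (Al' i) \<in> carrier G" "1 \<le> i \<Longrightarrow> i \<le> g \<Longrightarrow> f (Be' i) \<in> carrier G"
  using f_closed by (auto simp: Pi_def)

lemma sig_eq: "1 \<le> i \<Longrightarrow> i < k \<Longrightarrow> f (Sig i) = f (Sig 1)"
proof (induction i rule: dec_induct)
  case (step i)
  have "weval G f (letter (Sig i) @ letter (Sig (i + 1)) @ letter (Sig i))
      = weval G f (letter (Sig (i + 1)) @ letter (Sig i) @ letter (Sig (i + 1)))"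
    by (rule surface_rel[OF fibre_rels(2)]) (use step in auto)
  then have "f (Sig i) \<otimes> (f (Sig (Suc i)) \<otimes> f (Sig i)) = f (Sig (Suc i)) \<otimes> (f (Sig i) \<otimes> f (Sig (Suc i)))"
    using step(1,4) by (simp add: letter_def)
  then have "f (Sig i) = f (Sig (Suc i))"
    by (rule class2_braid_rel[OF class2, rotated 2]) (use step(1,4) in simp_all)
  then show ?case using step by simp
qed simp

text \<open>The relations make \<open>a_j\<close>, \<open>b_j\<close> and \<open>\<zeta>_i\<close>
  commute with \<open>\<sigma>_2\<close>, which exists because \<open>3 \<le> k\<close>, and
  \<open>\<sigma>_2\<close> now equals \<open>\<sigma>_1\<close>.\<close>

lemma sig_commute:
  "1 \<le> j \<Longrightarrow> j \<le> g \<Longrightarrow> f (Sig 1) \<otimes> f (Al j) = f (Al j) \<otimes> f (Sig 1)"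
  "1 \<le> j \<Longrightarrow> j \<le> g \<Longrightarrow> f (Sig 1) \<otimes> f (Be j) = f (Be j) \<otimes> f (Sig 1)"
  "1 \<le> i \<Longrightarrow> i \<le> n \<Longrightarrow> f (Sig 1) \<otimes> f (Zet i) = f (Zet i) \<otimes> f (Sig 1)"
proof -
  have s2: "f (Sig 2) = f (Sig 1)" using sig_eq[of 2] kn by simp
  have s: "f (Sig 1) \<in> carrier G" using kn by simp
  have "weval G f (c @ letter (Sig 2)) = weval G f (letter (Sig 2) @ c)"
    if "1 \<le> j" "j \<le> g" "c \<in> {letter (Al j), letter (Be j)}" for c j
    by (rule surface_rel[OF fibre_rels(3)[where j = j]]) (use that kn in auto)
  from this[of j "letter (Al j)"] this[of j "letter (Be j)"]
  show "f (Sig 1) \<otimes> f (Al j) = f (Al j) \<otimes> f (Sig 1)" "f (Sig 1) \<otimes> f (Be j) = f (Be j) \<otimes> f (Sig 1)"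
    if "1 \<le> j" "j \<le> g" using that s by (simp_all add: letter_def s2)
  have "weval G f (letter (Zet i) @ letter (Sig 2)) = weval G f (letter (Sig 2) @ letter (Zet i))"
    if "1 \<le> i" "i \<le> n"
    by (rule zeta_rel[OF fibre_zeta_rels(1)]) (use that kn in auto)
  then show "f (Sig 1) \<otimes> f (Zet i) = f (Zet i) \<otimes> f (Sig 1)" if "1 \<le> i" "i \<le> n"
    using that s by (simp add: letter_def s2)
qed

text \<open>Removes the conjugation by \<open>\<sigma>_1\<close> from the commutation relations
  between different handles. The trailing factor \<open>c\<close> adapts the rule to products
  bracketed to the right.\<close>

lemma conj_sig:
  assumes "x \<in> carrier G" "c \<in> carrier G" "f (Sig 1) \<otimes> x = x \<otimes> f (Sig 1)"
  shows "inv (f (Sig 1)) \<otimes> (x \<otimes> (f (Sig 1) \<otimes> c)) = x \<otimes> c"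
proof -
  have s: "f (Sig 1) \<in> carrier G" using kn by simp
  have "x \<otimes> (f (Sig 1) \<otimes> c) = f (Sig 1) \<otimes> (x \<otimes> c)"
    using assms s by (simp flip: m_assoc)
  then show ?thesis using assms s by (simp add: inv_solve_left')
qed

lemma zet_central:
  assumes "x \<in> carrier G"
  shows "f (Zet 1) \<otimes> x = x \<otimes> f (Zet 1)"
proof -
  have c: "f (Zet 1) \<in> carrier G" "f (Al' 1) \<in> carrier G" "f (Be 1) \<in> carrier G"
    using kn by simp_all
  \<comment> \<open>The first handle is available because \<open>1 \<le> g\<close>; its relation
    \<open>a'_1 b_1 a'_1^-1 = b_1 \<zeta>_1\<close> is solved for \<open>\<zeta>_1\<close>.\<close>
  have "weval G f (letter (Al' 1) @ letter (Be 1) @ winv (letter (Al' 1))) = weval G f (letter (Be 1) @ letter (Zet 1))"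
    by (rule action_rel[OF mixed_action_rels(12)]) (use kn in auto)
  then have "f (Al' 1) \<otimes> (f (Be 1) \<otimes> inv f (Al' 1)) = f (Be 1) \<otimes> f (Zet 1)"
    using c by (simp add: letter_def)
  then have "f (Zet 1) = comm (inv (f (Be 1))) (f (Al' 1))"
    using c by (simp add: comm_def m_assoc inv_solve_left)
  then show ?thesis using class2D[OF class2 _ _ assms] c by simp
qed

text \<open>Conjugation by \<open>\<sigma>'_i\<close> sends \<open>\<zeta>_{i+1}\<close> to
  \<open>\<zeta>_i\<close>, which by induction is the central element \<open>\<zeta>_1\<close>; so
  the conjugation is trivial.\<close>

lemma zet_eq: "1 \<le> i \<Longrightarrow> i \<le> n \<Longrightarrow> f (Zet i) = f (Zet 1)"
proof (induction i rule: dec_induct)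
  case (step i)
  have c: "f (Sig' i) \<in> carrier G" "f (Zet (Suc i)) \<in> carrier G" "f (Zet 1) \<in> carrier G"
    using step kn by auto
  have "weval G f (letter (Sig' i) @ letter (Zet (i + 1)) @ winv (letter (Sig' i))) = weval G f (letter (Zet i))"
    by (rule action_rel[OF mixed_action_rels(4)]) (use step in auto)
  then have "f (Sig' i) \<otimes> (f (Zet (Suc i)) \<otimes> inv f (Sig' i)) = f (Zet 1)"
    using step c by (simp add: letter_def)
  then have "f (Sig' i) \<otimes> f (Zet (Suc i)) = f (Zet 1) \<otimes> f (Sig' i)"
    using c by (metis inv_closed inv_solve_right' m_assoc m_closed)
  then show ?case using c zet_central[OF c(1)] by simp
qed simp

text \<open>Once \<open>\<sigma>_1\<close> commutes with \<open>a_i\<close> and \<open>b_i\<close>,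
  the relation \<open>a_i \<sigma>_1 b_i = \<sigma>_1 b_i \<sigma>_1 a_i \<sigma>_1\<close> has one
  \<open>\<sigma>_1\<close> on the left and three on the right.\<close>

lemma ab_swap:
  assumes "1 \<le> i" "i \<le> g"
  shows "f (Al i) \<otimes> f (Be i) = f (Sig 1) \<otimes> f (Sig 1) \<otimes> (f (Be i) \<otimes> f (Al i))"
proof -
  have s: "f (Sig 1) \<in> carrier G" "f (Al i) \<in> carrier G" "f (Be i) \<in> carrier G" using kn assms by simp_all
  have "weval G f (letter (Al i) @ letter (Sig 1) @ letter (Be i))
      = weval G f (letter (Sig 1) @ letter (Be i) @ letter (Sig 1) @ letter (Al i) @ letter (Sig 1))"
    by (rule surface_rel[OF fibre_rels(5)]) (use assms kn in auto)
  then have "f (Al i) \<otimes> (f (Sig 1) \<otimes> f (Be i))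
      = f (Sig 1) \<otimes> (f (Be i) \<otimes> (f (Sig 1) \<otimes> (f (Al i) \<otimes> f (Sig 1))))"
    using s by (simp add: letter_def)
  moreover have "f (Al i) \<otimes> (f (Sig 1) \<otimes> f (Be i)) = f (Sig 1) \<otimes> (f (Al i) \<otimes> f (Be i))"
    using s sig_commute(1)[OF assms] by (simp flip: m_assoc)
  moreover have "f (Be i) \<otimes> (f (Sig 1) \<otimes> (f (Al i) \<otimes> f (Sig 1)))
      = f (Sig 1) \<otimes> f (Sig 1) \<otimes> (f (Be i) \<otimes> f (Al i))"
  proof -
    have "f (Al i) \<otimes> f (Sig 1) = f (Sig 1) \<otimes> f (Al i)" "f (Be i) \<otimes> f (Sig 1) = f (Sig 1) \<otimes> f (Be i)"
      using sig_commute(1,2)[OF assms] by simp_all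
    moreover have "f (Be i) \<otimes> (f (Sig 1) \<otimes> x) = f (Sig 1) \<otimes> (f (Be i) \<otimes> x)" if "x \<in> carrier G" for x
      using s that sig_commute(2)[OF assms] by (simp flip: m_assoc)
    ultimately show ?thesis using s by (simp add: m_assoc)
  qed
  ultimately show ?thesis using s by simp
qed

lemma ab_commute:
  assumes "1 \<le> i" "i < j" "j \<le> g" "x \<in> {Al i, Be i}" "y \<in> {Al j, Be j}"
  shows "f x \<otimes> f y = f y \<otimes> f x"
proof -
  have s: "f (Sig 1) \<in> carrier G" "f x \<in> carrier G" "f y \<in> carrier G" using kn assms by auto
  have sx: "f (Sig 1) \<otimes> f x = f x \<otimes> f (Sig 1)" using sig_commute[of i] assms by auto
  have "weval G f ((winv (letter (Sig 1)) @ letter x @ letter (Sig 1)) @ letter y)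
      = weval G f (letter y @ winv (letter (Sig 1)) @ letter x @ letter (Sig 1))"
    by (rule surface_rel[OF fibre_rels(6)[where i = i and j = j and c = "letter x" and d = "letter y"]])
       (use assms kn in auto)
  then show ?thesis using s conj_sig[OF s(2,3) sx] conj_sig[OF s(2) one_closed sx]
    by (simp add: letter_def)
qed

lemma ak_group: "ak_group G g (f (Sig 1)) (f (Zet 1)) (\<lambda>i. f (Al i)) (\<lambda>i. f (Be i))"
proof unfold_locales
  fix i j assume ij: "i \<in> {1..g}" "j \<in> {1..g}" "i \<noteq> j"
  have *: "f x \<otimes> f y = f y \<otimes> f x" if "x \<in> {Al i, Be i}" "y \<in> {Al j, Be j}" for x y
  proof (cases "i < j")
    case True
    then show ?thesis using ij that by (intro ab_commute[of i j]) auto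
  next
    case False
    then show ?thesis using ij that by (intro ab_commute[of j i, symmetric]) auto
  qed
  show "f (Al i) \<otimes> f (Al j) = f (Al j) \<otimes> f (Al i)" "f (Al i) \<otimes> f (Be j) = f (Be j) \<otimes> f (Al i)"
    "f (Be i) \<otimes> f (Be j) = f (Be j) \<otimes> f (Be i)" by (rule *; simp)+
next
  fix i assume i: "i \<in> {1..g}"
  show "f (Al i) \<in> carrier G" "f (Be i) \<in> carrier G" using i by auto
  then show "f (Zet 1) \<otimes> f (Al i) = f (Al i) \<otimes> f (Zet 1)" "f (Zet 1) \<otimes> f (Be i) = f (Be i) \<otimes> f (Zet 1)"
    by (simp_all only: zet_central)
  show "f (Sig 1) \<otimes> f (Al i) = f (Al i) \<otimes> f (Sig 1)" "f (Sig 1) \<otimes> f (Be i) = f (Be i) \<otimes> f (Sig 1)"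
    "f (Al i) \<otimes> f (Be i) = f (Sig 1) \<otimes> f (Sig 1) \<otimes> (f (Be i) \<otimes> f (Al i))"
    using i by (simp_all only: sig_commute ab_swap atLeastAtMost_iff)
next
  show "f (Sig 1) \<otimes> f (Zet 1) = f (Zet 1) \<otimes> f (Sig 1)" using kn by (intro sig_commute) auto
qed (use kn in auto)

lemma action_word:
  assumes "t \<in> gens_base n g" "x \<in> gens_fibre k n g"
  shows "\<exists>w\<in>words (gens_fibre k n g). f t \<otimes> f x \<otimes> inv (f t) = weval G f w"
proof -
  let ?R = "action_rels k n g (\<lambda>i. letter (Sig i)) (\<lambda>i. letter (Al i)) (\<lambda>i. letter (Be i)) (\<lambda>i. letter (Zet i))
      (\<lambda>i. letter (Sig' i)) (\<lambda>i. letter (Al' i)) (\<lambda>i. letter (Be' i))"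
  let ?W = "words (gens_fibre k n g)"
  have c: "f t \<in> carrier G" "f x \<in> carrier G" using assms f_closed by auto
  have tw: "letter t @ letter x \<in> words (gens_fibre k n g \<union> gens_base n g)"
    "letter x @ letter t \<in> words (gens_fibre k n g \<union> gens_base n g)"
    "letter t @ letter x @ winv (letter t) \<in> words (gens_fibre k n g \<union> gens_base n g)"
    using assms by auto
  have sub: "w \<in> words (gens_fibre k n g \<union> gens_base n g)" if "w \<in> ?W" for w
    using that by (rule words_mono[rotated]) simp
  \<comment> \<open>The relations (c) come in two shapes: plain commutation, or an explicit
    conjugate that is already a word in fibre generators.\<close>
  have "(letter t @ letter x, letter x @ letter t) \<in> ?R \<or>
      (\<exists>w\<in>?W. (letter t @ letter x @ winv (letter t), w) \<in> ?R)"
  proof -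
    have n1: "1 \<le> n" "1 < k" using kn by auto
    consider i where "t = Sig' i" "1 \<le> i" "i < n"
      | i y where "(t, y) \<in> {(Al' i, Al i), (Be' i, Be i)}" "1 \<le> i" "i \<le> g"
      using assms(1) by (auto simp: gens_base_def)
    then show ?thesis
    proof cases
      case (1 i)
      consider j where "x = Sig j" "1 \<le> j" "j < k" | j where "x \<in> {Al j, Be j}" "1 \<le> j" "j \<le> g"
        | "x = Zet (i + 1)" | "x = Zet i" | j where "x = Zet j" "1 \<le> j" "j \<le> n" "j \<noteq> i" "j \<noteq> i + 1"
        using assms(2) by (auto simp: gens_fibre_def) metis
      then show ?thesis
      proof cases
        case (1 j) then show ?thesis using mixed_action_rels(1)[of i n j k g] \<open>t = Sig' i\<close> \<open>1 \<le> i\<close> \<open>i < n\<close> by auto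
      next
        case (2 j) then show ?thesis
          using mixed_action_rels(3)[of i n j g "letter x" k] \<open>t = Sig' i\<close> \<open>1 \<le> i\<close> \<open>i < n\<close> by auto
      next
        case 3 then show ?thesis
          using mixed_action_rels(4)[of i n k g] \<open>t = Sig' i\<close> \<open>1 \<le> i\<close> \<open>i < n\<close>
          by (intro disjI2 bexI[of _ "letter (Zet i)"]) auto
      next
        case 4 then show ?thesis
          using mixed_action_rels(5)[of i n k g] \<open>t = Sig' i\<close> \<open>1 \<le> i\<close> \<open>i < n\<close>
          by (intro disjI2 bexI[of _ "winv (letter (Zet i)) @ letter (Zet (i + 1)) @ letter (Zet i)"]) auto
      next
        case (5 j) then show ?thesis
          using mixed_action_rels(6)[of i n j k g] \<open>t = Sig' i\<close> \<open>1 \<le> i\<close> \<open>i < n\<close>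
          by (intro disjI2 bexI[of _ "letter (Zet j)"]) auto
      qed
    next
      case (2 i y)
      have ty: "(letter t, letter y) \<in> {(letter (Al' i), letter (Al i)), (letter (Be' i), letter (Be i))}"
        "y \<in> gens_fibre k n g" using 2 by auto
      \<comment> \<open>For \<open>t\<close> on handle \<open>i\<close>, a letter of an earlier or a
        later handle has its own relation. On handle \<open>i\<close> itself the partner
        \<open>y\<close> of \<open>t\<close> is separated from the other letter, for which
        \<open>Al'\<close> and \<open>Be'\<close> behave differently.\<close>
      consider j where "x = Sig j" "1 \<le> j" "j < k" | j where "x \<in> {Al j, Be j}" "1 \<le> j" "j < i"
        | j where "x \<in> {Al j, Be j}" "i < j" "j \<le> g" | "x = y" | "t = Al' i" "x = Be i" | "t = Be' i" "x = Al i"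
        | "x = Zet 1" | j where "x = Zet j" "1 \<le> j" "j \<le> n" "j \<noteq> 1"
        using assms(2) 2 unfolding gens_fibre_def by auto (metis nat_neq_iff)+
      then show ?thesis
      proof cases
        case (1 j) then show ?thesis using mixed_action_rels(2)[of i g "letter t" j k n] 2 by auto
      next
        case (2 j) then show ?thesis
          using mixed_action_rels(10)[of n i g "letter t" "letter y" j "letter x" k] ty n1 \<open>i \<le> g\<close>
          by (intro disjI2 bexI[of _ "wconj (letter x) (wcomm (winv (letter y)) (winv (letter (Zet 1))))"]) auto
      next
        case (3 j) then show ?thesis
          using mixed_action_rels(11)[of i g "letter t" "letter y" j "letter x" k n] ty n1 \<open>1 \<le> i\<close>
          by (intro disjI2 bexI[of _ "letter x"]) auto
      next
        case 4 then show ?thesis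
          using mixed_action_rels(9)[of n i g "letter t" "letter y" k] ty n1 \<open>1 \<le> i\<close> \<open>i \<le> g\<close>
          by (intro disjI2 bexI[of _ "winv (letter (Zet 1)) @ letter x @ letter (Zet 1)"]) auto
      next
        case 5 then show ?thesis
          using mixed_action_rels(12)[of n i g k] n1 \<open>1 \<le> i\<close> \<open>i \<le> g\<close>
          by (intro disjI2 bexI[of _ "letter (Be i) @ letter (Zet 1)"]) auto
      next
        case 6 then show ?thesis
          using mixed_action_rels(13)[of n i g k] n1 \<open>1 \<le> i\<close> \<open>i \<le> g\<close>
          by (intro disjI2 bexI[of _ "winv (letter (Zet 1)) @ letter (Al i) @
            wcomm (winv (letter (Be i))) (winv (letter (Zet 1)))"]) auto
      next
        case 7 then show ?thesis
          using mixed_action_rels(7)[of n i g "letter t" "letter y" k] ty n1 \<open>1 \<le> i\<close> \<open>i \<le> g\<close>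
          by (intro disjI2 bexI[of _ "wconj (letter (Zet 1)) (letter y @ letter (Zet 1))"]) auto
      next
        case (8 j) then show ?thesis
          using mixed_action_rels(8)[of i g "letter t" "letter y" j n k] ty n1 \<open>1 \<le> i\<close> \<open>i \<le> g\<close>
          by (intro disjI2 bexI[of _ "wconj (letter (Zet j)) (wcomm (winv (letter y)) (winv (letter (Zet 1))))"]) auto
      qed
    qed
  qed
  then show ?thesis
  proof
    assume "(letter t @ letter x, letter x @ letter t) \<in> ?R"
    from action_rel[OF this tw(1,2)] have "f t \<otimes> f x \<otimes> inv (f t) = f x"
      using c by (simp add: letter_def inv_solve_right')
    then show ?thesis using assms(2) c by (intro bexI[of _ "letter x"]) (auto simp: letter_def)
  next
    assume "\<exists>w\<in>?W. (letter t @ letter x @ winv (letter t), w) \<in> ?R"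
    then obtain w where w: "w \<in> ?W" "(letter t @ letter x @ winv (letter t), w) \<in> ?R" by blast
    from action_rel[OF w(2) tw(3) sub[OF w(1)]] show ?thesis
      using c w(1) by (auto simp: letter_def m_assoc)
  qed
qed

text \<open>Conjugates by base generators are fibre words by \<open>action_word\<close>; conjugates
  by fibre generators stay inside the subgroup anyway.\<close>

lemma fibre_normal:
  assumes "generate G (f ` (gens_fibre k n g \<union> gens_base n g)) = carrier G"
  shows "generate G (f ` gens_fibre k n g) \<lhd> G"
proof (rule class2_generate_normal[OF class2 _ _ assms])
  show A: "f ` gens_fibre k n g \<subseteq> carrier G" and "f ` (gens_fibre k n g \<union> gens_base n g) \<subseteq> carrier G"
    using f_closed by auto
  note M = generate_is_subgroup[OF A]
  fix b a assume b: "b \<in> f ` (gens_fibre k n g \<union> gens_base n g)" and a: "a \<in> f ` gens_fibre k n g"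
  then obtain t x where t: "b = f t" "t \<in> gens_fibre k n g \<union> gens_base n g" and x: "a = f x" "x \<in> gens_fibre k n g"
    by auto
  show "b \<otimes> a \<otimes> inv b \<in> generate G (f ` gens_fibre k n g)"
  proof (cases "t \<in> gens_base n g")
    case True
    from action_word[OF this x(2)] show ?thesis
      unfolding t x using weval_in_subgroup[OF M] generate.incl by (metis subsetI)
  next
    case False
    then have "b \<in> generate G (f ` gens_fibre k n g)" "a \<in> generate G (f ` gens_fibre k n g)"
      using t x by (auto intro: generate.incl)
    then show ?thesis by (intro subgroup.m_closed[OF M] subgroup.m_inv_closed[OF M])
  qed
qed

end

section \<open>The isomorphism\<close>

lemma weval_ak:
  assumes "w \<in> words (ak_gens g)"
  shows "weval (G_Sigma g) (ak g) w = word_class (ak_gens g) (ak_rels g) w"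
proof -
  have "ak g = (\<lambda>x. word_class (ak_gens g) (ak_rels g) (letter x))" by (rule ext) (simp add: ak_def)
  then show ?thesis using word_class_eq_weval[OF assms, of "ak_rels g"] by (simp add: G_Sigma_def)
qed

lemma ak_group_G_Sigma:
  "ak_group (G_Sigma g) g (ak g AKsigma) (ak g AKzeta) (\<lambda>i. ak g (AKa i)) (\<lambda>i. ak g (AKb i))"
proof -
  interpret group "G_Sigma g" unfolding G_Sigma_def by (rule group_presented_group)
  have c: "ak g x \<in> carrier (G_Sigma g)" if "x \<in> ak_gens g" for x
    using that by (simp add: ak_def G_Sigma_def carrier_presented_group)
  have rel: "weval (G_Sigma g) (ak g) u = weval (G_Sigma g) (ak g) v"
    if "(u, v) \<in> ak_rels g" "u \<in> words (ak_gens g)" "v \<in> words (ak_gens g)" for u v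
    using word_class_eq_iff[OF that(2), of "ak_rels g" v] word_eq.rel[OF that] that
    by (simp add: weval_ak)
  have comm: "ak g x \<otimes>\<^bsub>G_Sigma g\<^esub> ak g y = ak g y \<otimes>\<^bsub>G_Sigma g\<^esub> ak g x"
    if "x \<in> ak_gens g" "y \<in> ak_gens g" "x \<noteq> y" "\<forall>i. {x, y} \<noteq> {AKa i, AKb i}" for x y
    using rel[of "letter x @ letter y" "letter y @ letter x"] that c
    by (auto simp: ak_rels_def letter_def)
  show ?thesis
  proof unfold_locales
    fix i assume i: "i \<in> {1..g}"
    then have c': "ak g (AKa i) \<in> carrier (G_Sigma g)" "ak g (AKb i) \<in> carrier (G_Sigma g)"
      "ak g AKsigma \<in> carrier (G_Sigma g)" by (auto intro!: c simp: ak_gens_def)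
    have "weval (G_Sigma g) (ak g) (wcomm (letter (AKa i)) (letter (AKb i)))
        = weval (G_Sigma g) (ak g) (letter AKsigma @ letter AKsigma)"
      using i by (intro rel) (auto simp: ak_rels_def ak_gens_def)
    then have "comm (ak g (AKa i)) (ak g (AKb i)) = ak g AKsigma \<otimes>\<^bsub>G_Sigma g\<^esub> ak g AKsigma"
      using c' by (simp add: wcomm_def letter_def comm_def m_assoc)
    then show "ak g (AKa i) \<otimes>\<^bsub>G_Sigma g\<^esub> ak g (AKb i) = ak g AKsigma \<otimes>\<^bsub>G_Sigma g\<^esub> ak g AKsigma
        \<otimes>\<^bsub>G_Sigma g\<^esub> (ak g (AKb i) \<otimes>\<^bsub>G_Sigma g\<^esub> ak g (AKa i))"
      using comm_swap[OF c'(1,2)] by simp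
  qed (rule c comm; force simp: ak_gens_def doubleton_eq_iff)+
qed

lemma word_class_eq_one:
  assumes "w \<in> words (ak_gens g)" "weval (heis g) (heis_gen \<circ> ak_bgen) w = \<one>\<^bsub>heis g\<^esub>"
  shows "word_class (ak_gens g) (ak_rels g) w = \<one>\<^bsub>G_Sigma g\<^esub>"
proof -
  interpret ak_group "G_Sigma g" g "ak g AKsigma" "ak g AKzeta" "\<lambda>i. ak g (AKa i)" "\<lambda>i. ak g (AKb i)"
    by (rule ak_group_G_Sigma)
  have "gen = ak g"
  proof
    show "gen x = ak g x" for x by (cases x) auto
  qed
  then show ?thesis
    using weval_gen_eq_one[OF assms] assms(1) by (simp add: weval_ak)
qed

text \<open>This embedding turns identities in \<open>G_Sigma g\<close> into computations with
  coordinates.\<close>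

lemma G_Sigma_heis:
  obtains J where "J \<in> hom (G_Sigma g) (heis g)" "inj_on J (carrier (G_Sigma g))"
    "\<And>x. x \<in> ak_gens g \<Longrightarrow> J (ak g x) = heis_gen (ak_bgen x)"
proof -
  obtain J where J: "J \<in> hom (G_Sigma g) (heis g)"
    and Jw: "\<And>w. w \<in> words (ak_gens g) \<Longrightarrow>
      J (word_class (ak_gens g) (ak_rels g) w) = weval (heis g) (heis_gen \<circ> ak_bgen) w"
    using presented_group_hom[OF group_heis _ heis_gen_ak_rels, of "ak_gens g" g]
    unfolding G_Sigma_def by (metis Pi_I heis_simps(3))
  interpret group_hom "G_Sigma g" "heis g" J
    using J group_heis group_presented_group by (simp add: group_hom_def group_hom_axioms_def G_Sigma_def)
  have "inj_on J (carrier (G_Sigma g))"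
    unfolding inj_on_one_iff using word_class_eq_one Jw
    by (auto simp: G_Sigma_def carrier_presented_group)
  moreover have "J (ak g x) = heis_gen (ak_bgen x)" if "x \<in> ak_gens g" for x
    using that Jw[of "letter x"] H.weval_letter[of "heis_gen \<circ> ak_bgen" "ak_gens g" x]
    by (simp add: ak_def)
  ultimately show ?thesis using J that by blast
qed

theorem theorem1p1:
  fixes X :: "'a topology" and c :: "nat \<Rightarrow> 'a" and k n g :: nat
    and \<gamma> \<delta> \<beta> :: "bgen \<Rightarrow> 'a braid"
  assumes "1 \<le> g" and "3 \<le> k" and "3 \<le> n"
    and "compact_orientable_surface_1 g X"
    and "c \<in> {..<k + n} \<rightarrow>\<^sub>E surface_interior X" and "inj_on c {..<k + n}"
    and "standard_generators k n g X c \<gamma> \<delta> \<beta>"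
  shows "\<exists>\<iota> \<in> iso (G_Sigma g) (G_ker k n X c).
      (\<forall>i\<in>{1..<k}. \<iota> (ak g AKsigma) = Phi k n X c (\<beta> (Sig i))) \<and>
      (\<forall>i\<in>{1..n}. \<iota> (ak g AKzeta) = Phi k n X c (\<beta> (Zet i))) \<and>
      (\<forall>i\<in>{1..g}. \<iota> (ak g (AKa i)) = Phi k n X c (\<beta> (Al i)) \<and>
                   \<iota> (ak g (AKb i)) = Phi k n X c (\<beta> (Be i))) \<and>
      (\<exists>f. is_Phi_Sigma k n g X c \<beta> f) \<and>
      (\<forall>f. is_Phi_Sigma k n g X c \<beta> f \<longrightarrow>
         (\<forall>x\<in>carrier (fibre_braid_group k n X c). \<iota> (f x) = Phi k n X c x))"
proof -
  let ?S = "gens_fibre k n g \<union> gens_base n g"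
  define B where "B = mixed_braid_group k n X c"
  define H where "H = braid_group n X (last_points k n c)"
  define F where "F = fibre_braid_group k n X c"
  define Q where "Q = B Mod lower_central B 3"
  have pB: "presents ?S (rels_mixed k n g) \<gamma> B" and pH: "presents (gens_base n g) (rels_base n g) \<delta> H"
    and pF: "presents (gens_fibre k n g) (rels_fibre k n g) \<beta> F"
    and psi1: "\<And>s. s \<in> gens_fibre k n g \<Longrightarrow> psi k n X c (\<gamma> s) = \<one>\<^bsub>H\<^esub>"
    and psi2: "\<And>s. s \<in> gens_base n g \<Longrightarrow> psi k n X c (\<gamma> s) = \<delta> s"
    and incl: "\<And>s. s \<in> gens_fibre k n g \<Longrightarrow> fibre_incl k n X c (\<beta> s) = \<gamma> s"
    using assms(7) by (auto simp: standard_generators_def B_def H_def F_def)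
  interpret B: group B using pB by (simp add: presents_def)
  interpret H: group H using pH by (simp add: presents_def)
  interpret F: group F using pF by (simp add: presents_def)
  interpret heis: group "heis g" by (rule group_heis)
  interpret \<rho>: group_hom B Q "rho B" unfolding Q_def by (rule B.rho_group_hom)
  note \<gamma> = presents_closed[OF pB]
  have c: "c \<in> {..<k + n} \<rightarrow>\<^sub>E topspace X" using assms(5) by (auto simp: surface_interior_def PiE_def Pi_def)
  interpret \<psi>: group_hom B H "psi k n X c"
    using psi_hom[of k n X c] by unfold_locales (simp add: B_def H_def)
  interpret i: group_hom F B "fibre_incl k n X c"
    using fibre_incl_hom[OF c assms(6)] by unfold_locales (simp add: B_def F_def)

  interpret Q: mixed_class2 Q k n g "rho B \<circ> \<gamma>"
  proof unfold_locales
    show "\<rho>.H.class2" unfolding Q_def by (rule B.class2_Mod)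
    show "rho B \<circ> \<gamma> \<in> ?S \<rightarrow> carrier Q" using \<gamma> by (auto simp: Pi_def)
    fix u v assume "(u, v) \<in> rels_mixed k n g" and w: "u \<in> words ?S" "v \<in> words ?S"
    then have "weval B \<gamma> u = weval B \<gamma> v" by (rule presents_rel[OF pB])
    then show "weval Q (rho B \<circ> \<gamma>) u = weval Q (rho B \<circ> \<gamma>) v"
      using hom_weval[OF B.is_group \<rho>.H.is_group \<rho>.homh \<gamma>] w by metis
  qed (use assms in auto)
  interpret QA: ak_group Q g "(rho B \<circ> \<gamma>) (Sig 1)" "(rho B \<circ> \<gamma>) (Zet 1)"
    "\<lambda>i. (rho B \<circ> \<gamma>) (Al i)" "\<lambda>i. (rho B \<circ> \<gamma>) (Be i)"
    by (rule Q.ak_group)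
  have QA_gen: "QA.gen = rho B \<circ> \<gamma> \<circ> ak_bgen"
  proof
    show "QA.gen x = (rho B \<circ> \<gamma> \<circ> ak_bgen) x" for x
      by (cases x) simp_all
  qed

  \<comment> \<open>The kernel of the induced map on quotients\<close>
  interpret rH: group_hom H "H Mod lower_central H 3" "rho H" by (rule H.rho_group_hom)
  \<comment> \<open>Two representatives of a coset differ by an element of
    \<open>\<Gamma>_3(B)\<close>, which \<open>psi\<close> sends into \<open>\<Gamma>_3(H)\<close>;
    so the union in \<open>induced_quot\<close> is a single coset.\<close>
  have iq: "induced_quot H (psi k n X c) (rho B x) = rho H (psi k n X c x)" if x: "x \<in> carrier B" for x
  proof -
    have "rho H (psi k n X c y) = rho H (psi k n X c x)" if y: "y \<in> rho B x" for y
    proof -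
      obtain h where h: "h \<in> lower_central B 3" "y = h \<otimes>\<^bsub>B\<^esub> x" using y by (auto simp: rho_def r_coset_def)
      have hc: "h \<in> carrier B" using h(1) B.lower_central_subgroup subgroup.mem_carrier by metis
      have "psi k n X c h \<in> lower_central H 3" using hom_lower_central[OF \<psi>.group_hom_axioms] h(1) by blast
      then have "rho H (psi k n X c h) = \<one>\<^bsub>H Mod lower_central H 3\<^esub>"
        using H.rho_eq_one_iff hc \<psi>.hom_closed by blast
      then show ?thesis using h(2) hc x \<psi>.hom_mult rH.hom_mult \<psi>.hom_closed rH.H.l_one rH.hom_closed by metis
    qed
    moreover have "x \<in> rho B x"
      unfolding rho_def using x B.rcos_self B.lower_central_subgroup by blast
    ultimately show ?thesis unfolding induced_quot_def by blast
  qed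
  define K where "K = {x \<in> carrier Q. induced_quot H (psi k n X c) x = \<one>\<^bsub>H Mod lower_central H 3\<^esub>}"
  have G_ker: "G_ker k n X c = Q\<lparr>carrier := K\<rparr>"
    by (simp add: G_ker_def Let_def Q_def B_def H_def K_def kernel_def)

  obtain \<iota> where \<iota>: "\<iota> \<in> hom (G_Sigma g) Q"
    and \<iota>w: "\<And>w. w \<in> words (ak_gens g) \<Longrightarrow> \<iota> (word_class (ak_gens g) (ak_rels g) w) = weval Q QA.gen w"
    using presented_group_hom[OF \<rho>.H.is_group QA.gen_closed QA.ak_rels_gen] unfolding G_Sigma_def by blast
  interpret \<iota>: group_hom "G_Sigma g" Q \<iota>
    using \<iota> \<rho>.H.is_group group_presented_group by (simp add: group_hom_def group_hom_axioms_def G_Sigma_def)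
  have cS: "carrier (G_Sigma g) = word_class (ak_gens g) (ak_rels g) ` words (ak_gens g)"
    by (simp add: G_Sigma_def carrier_presented_group)
  have \<iota>_ak: "\<iota> (ak g x) = rho B (\<gamma> (ak_bgen x))" if "x \<in> ak_gens g" for x
    using that \<iota>w[of "letter x"] \<rho>.H.weval_letter[OF QA.gen_closed] fun_cong[OF QA_gen, of x]
    by (simp add: ak_def)
  have ak_fibre: "ak_bgen x \<in> gens_fibre k n g" if "x \<in> ak_gens g" for x
    using that assms(1-3) by (auto simp: ak_gens_def)
  have \<gamma>ak: "\<gamma> \<circ> ak_bgen \<in> ak_gens g \<rightarrow> carrier B" using ak_fibre \<gamma> by (auto simp: Pi_def)
  have wQ: "weval Q QA.gen w = rho B (weval B (\<gamma> \<circ> ak_bgen) w)" if "w \<in> words (ak_gens g)" for w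
    unfolding QA_gen comp_assoc using hom_weval[OF B.is_group \<rho>.H.is_group \<rho>.homh \<gamma>ak that] by simp

  \<comment> \<open>Injectivity\<close>
  have inj: "inj_on \<iota> (carrier (G_Sigma g))"
    unfolding \<iota>.inj_on_one_iff
  proof (intro allI impI)
    fix x assume "x \<in> carrier (G_Sigma g)" and x1: "\<iota> x = \<one>\<^bsub>Q\<^esub>"
    then obtain w where w: "w \<in> words (ak_gens g)" "x = word_class (ak_gens g) (ak_rels g) w"
      unfolding cS by blast
    let ?y = "weval B (\<gamma> \<circ> ak_bgen) w"
    have y: "?y \<in> carrier B" using B.weval_closed[OF \<gamma>ak w(1)] .
    have "rho B ?y = \<one>\<^bsub>Q\<^esub>" using x1 \<iota>w wQ w by metis
    then have y3: "?y \<in> lower_central B 3" using B.rho_eq_one_iff[OF y] by (simp add: Q_def)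
    \<comment> \<open>As the target has class two, \<open>h\<close> sends
      \<open>\<Gamma>_3(B)\<close> to the trivial group. The value of \<open>w\<close> in
      \<open>heis g\<close> is therefore trivial, and so is its class in
      \<open>G_Sigma g\<close>.\<close>
    obtain h where h: "h \<in> hom B (heis g)" "\<And>s. s \<in> ?S \<Longrightarrow> h (\<gamma> s) = heis_gen s"
      using presents_hom[OF pB group_heis, of heis_gen] heis_gen_rels_mixed by (metis Pi_I heis_simps(3))
    then have "group_hom B (heis g) h" by unfold_locales
    from hom_lower_central[OF this, of 3] y3 have "h ?y = \<one>\<^bsub>heis g\<^esub>"
      using heis.lower_central_class2[OF class2_heis] by blast
    moreover have "h ?y = weval (heis g) (h \<circ> (\<gamma> \<circ> ak_bgen)) w"
      by (rule hom_weval[OF B.is_group group_heis h(1) \<gamma>ak w(1)])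
    moreover have "\<dots> = weval (heis g) (heis_gen \<circ> ak_bgen) w"
      using w(1) by (rule weval_cong) (simp add: h(2) ak_fibre)
    ultimately show "x = \<one>\<^bsub>G_Sigma g\<^esub>" using word_class_eq_one w by metis
  qed

  \<comment> \<open>The image is the kernel\<close>
  let ?M = "generate Q ((rho B \<circ> \<gamma>) ` gens_fibre k n g)"
  have MQ: "(rho B \<circ> \<gamma>) ` gens_fibre k n g \<subseteq> carrier Q" using \<gamma> by (auto simp: Pi_def)
  have subM: "subgroup ?M Q" by (rule \<rho>.H.generate_is_subgroup[OF MQ])
  have SQ: "(rho B \<circ> \<gamma>) ` ?S \<subseteq> carrier Q" using \<gamma> by (auto simp: Pi_def)
  have genQ: "generate Q ((rho B \<circ> \<gamma>) ` ?S) = carrier Q"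
  proof
    show "generate Q ((rho B \<circ> \<gamma>) ` ?S) \<subseteq> carrier Q"
      by (rule \<rho>.H.generate_incl[OF SQ])
    have sub: "subgroup (generate Q ((rho B \<circ> \<gamma>) ` ?S)) Q"
      by (rule \<rho>.H.generate_is_subgroup[OF SQ])
    show "carrier Q \<subseteq> generate Q ((rho B \<circ> \<gamma>) ` ?S)"
    proof
      fix q assume "q \<in> carrier Q"
      then obtain x where x: "x \<in> carrier B" "q = rho B x" unfolding Q_def B.rho_surj[symmetric] by blast
      obtain w where w: "w \<in> words ?S" "x = weval B \<gamma> w" using presents_word[OF pB x(1)] by blast
      have "q = weval Q (rho B \<circ> \<gamma>) w"
        using hom_weval[OF B.is_group \<rho>.H.is_group \<rho>.homh \<gamma> w(1)] x w by simp
      then show "q \<in> generate Q ((rho B \<circ> \<gamma>) ` ?S)"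
        using \<rho>.H.weval_in_subgroup[OF sub w(1)] generate.incl by (metis subsetI)
    qed
  qed
  interpret M: normal ?M Q by (rule Q.fibre_normal[OF genQ])

  have MK: "?M = K"
  proof
    have "?M \<subseteq> rho B ` kernel B H (psi k n X c)"
    proof (rule \<rho>.H.generate_subgroup_incl)
      show "subgroup (rho B ` kernel B H (psi k n X c)) Q"
        by (rule \<rho>.subgroup_img_is_subgroup[OF \<psi>.subgroup_kernel])
      show "(rho B \<circ> \<gamma>) ` gens_fibre k n g \<subseteq> rho B ` kernel B H (psi k n X c)"
        using psi1 \<gamma> by (auto simp: kernel_def Pi_def)
    qed
    also have "\<dots> \<subseteq> K" by (auto simp: K_def kernel_def iq rH.hom_one)
    finally show "?M \<subseteq> K" .
  next
    show "K \<subseteq> ?M"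
    proof
      fix q assume q: "q \<in> K"
      then obtain x where x: "x \<in> carrier B" "q = rho B x" unfolding K_def Q_def B.rho_surj[symmetric] by blast
      have "psi k n X c x \<in> lower_central H 3"
        using q x H.rho_eq_one_iff[of "psi k n X c x"] by (simp add: K_def iq)
      \<comment> \<open>Since the relations (b) hold in the mixed braid group, \<open>\<psi>\<close> has a section.\<close>
      obtain s where s: "s \<in> hom H B" "\<And>t. t \<in> gens_base n g \<Longrightarrow> s (\<delta> t) = \<gamma> t"
      proof (rule presents_hom[OF pH B.is_group, of \<gamma>])
        show "\<gamma> \<in> gens_base n g \<rightarrow> carrier B" using \<gamma> by auto
        fix u v assume "(u, v) \<in> rels_base n g" "u \<in> words (gens_base n g)" "v \<in> words (gens_base n g)"
        then show "weval B \<gamma> u = weval B \<gamma> v"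
          by (intro presents_rel[OF pB]) (auto simp: rels_mixed_def intro: words_mono[rotated])
      qed blast
      interpret s: group_hom H B s using s(1) by unfold_locales
      have "s (psi k n X c x) \<in> lower_central B 3"
        using hom_lower_central[OF s.group_hom_axioms] \<open>psi k n X c x \<in> lower_central H 3\<close> by blast
      then have one: "rho B (s (psi k n X c x)) = \<one>\<^bsub>Q\<^esub>"
        using B.rho_eq_one_iff[of "s (psi k n X c x)"] x by (simp add: Q_def)
      let ?p = "\<lambda>y. ?M #>\<^bsub>Q\<^esub> y"
      have p: "?p \<in> hom Q (Q Mod ?M)" by (rule M.r_coset_hom_Mod)
      \<comment> \<open>Modulo \<open>?M\<close> an element equals its image under the section after
        \<open>psi\<close>: on fibre generators both sides are trivial, on base generators the
        section restores \<open>\<gamma> t\<close>. For \<open>x\<close> the right side vanishes,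
        since the section maps \<open>\<Gamma>_3(H)\<close> into
        \<open>\<Gamma>_3(B)\<close>.\<close>
      have "(?p \<circ> rho B) x = (?p \<circ> (rho B \<circ> (s \<circ> psi k n X c))) x"
      proof (rule presents_hom_eq[OF pB M.factorgroup_is_group _ _ _ x(1)])
        show "?p \<circ> rho B \<in> hom B (Q Mod ?M)" by (rule hom_compose[OF \<rho>.homh p])
        show "?p \<circ> (rho B \<circ> (s \<circ> psi k n X c)) \<in> hom B (Q Mod ?M)"
          by (intro hom_compose[OF _ p] hom_compose[OF _ \<rho>.homh] hom_compose[OF \<psi>.homh s(1)])
        fix t assume t: "t \<in> ?S"
        show "(?p \<circ> rho B) (\<gamma> t) = (?p \<circ> (rho B \<circ> (s \<circ> psi k n X c))) (\<gamma> t)"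
        proof (cases "t \<in> gens_fibre k n g")
          case True
          then have m: "rho B (\<gamma> t) \<in> ?M" by (auto intro: generate.incl)
          then have "?p (rho B (\<gamma> t)) = ?M"
            using \<rho>.H.coset_join2[OF _ subM m] subgroup.mem_carrier[OF subM m] by blast
          moreover have "?p \<one>\<^bsub>Q\<^esub> = ?M"
            using \<rho>.H.coset_join2[OF _ subM] subgroup.one_closed[OF subM] by blast
          ultimately show ?thesis using psi1[OF True] s.hom_one \<rho>.hom_one by simp
        next
          case False
          then show ?thesis using t psi2 s(2) by auto
        qed
      qed
      then have "?p q = ?p \<one>\<^bsub>Q\<^esub>" using one x by simp
      also have "\<dots> = ?M" using \<rho>.H.coset_join2[OF _ subM] subgroup.one_closed[OF subM] by blast
      finally have "?p q = ?M" .
      then show "q \<in> ?M" using \<rho>.H.coset_join1[OF _ _ subM] x subgroup.subset[OF subM] by auto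
    qed
  qed
  have img: "\<iota> ` carrier (G_Sigma g) = K"
  proof
    show "\<iota> ` carrier (G_Sigma g) \<subseteq> K"
    proof
      fix q assume "q \<in> \<iota> ` carrier (G_Sigma g)"
      then obtain w where w: "w \<in> words (ak_gens g)" "q = weval Q QA.gen w" unfolding cS using \<iota>w by auto
      have "QA.gen ` ak_gens g \<subseteq> ?M" unfolding QA_gen using ak_fibre by (auto intro: generate.incl)
      then show "q \<in> K" unfolding MK[symmetric] w(2) by (rule \<rho>.H.weval_in_subgroup[OF subM w(1)])
    qed
    show "K \<subseteq> \<iota> ` carrier (G_Sigma g)" unfolding MK[symmetric]
    proof (rule \<rho>.H.generate_subgroup_incl[OF _ \<iota>.img_is_subgroup])
      show "(rho B \<circ> \<gamma>) ` gens_fibre k n g \<subseteq> \<iota> ` carrier (G_Sigma g)"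
      proof
        fix y assume "y \<in> (rho B \<circ> \<gamma>) ` gens_fibre k n g"
        then obtain t where t: "t \<in> gens_fibre k n g" "y = rho B (\<gamma> t)" by auto
        \<comment> \<open>Surjectivity rests on the collapse of indices: every \<open>Sig i\<close>
          and every \<open>Zet i\<close> has the same image as the representative with index
          1.\<close>
        have "\<exists>x\<in>ak_gens g. rho B (\<gamma> t) = rho B (\<gamma> (ak_bgen x))"
        proof (cases t)
          case (Sig i)
          then show ?thesis using t Q.sig_eq[of i] by (intro bexI[of _ AKsigma]) (auto simp: ak_gens_def)
        next
          case (Zet i)
          then show ?thesis using t Q.zet_eq[of i] by (intro bexI[of _ AKzeta]) (auto simp: ak_gens_def)
        next
          case (Al i)
          then show ?thesis using t by (intro bexI[of _ "AKa i"]) (auto simp: ak_gens_def)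
        next
          case (Be i)
          then show ?thesis using t by (intro bexI[of _ "AKb i"]) (auto simp: ak_gens_def)
        qed (use t in \<open>auto simp: gens_fibre_def\<close>)
        then obtain x where x: "x \<in> ak_gens g" "rho B (\<gamma> t) = \<iota> (ak g x)" using \<iota>_ak by auto
        then show "y \<in> \<iota> ` carrier (G_Sigma g)" using t by (auto simp: cS ak_def)
      qed
    qed
  qed
  have iso: "\<iota> \<in> iso (G_Sigma g) (G_ker k n X c)"
    using inj img \<iota>.hom_mult unfolding G_ker by (auto simp: iso_def hom_def bij_betw_def)

  \<comment> \<open>Existence of \<open>\<Phi>_\<Sigma>\<close> and compatibility with
    \<open>\<Phi>_k\<close>\<close>
  have Phi: "Phi k n X c x = (rho B \<circ> fibre_incl k n X c) x" for x by (simp add: Phi_def B_def)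
  have Phi_gen: "Phi k n X c (\<beta> s) = rho B (\<gamma> s)" if "s \<in> gens_fibre k n g" for s
    using incl[OF that] by (simp add: Phi)
  have Phi_ak: "\<iota> (ak g AKsigma) = Phi k n X c (\<beta> (Sig i))" if "i \<in> {1..<k}" for i
    using that \<iota>_ak[of AKsigma] Q.sig_eq[of i] by (simp add: Phi_gen ak_gens_def)
  have Phi_zet: "\<iota> (ak g AKzeta) = Phi k n X c (\<beta> (Zet i))" if "i \<in> {1..n}" for i
    using that \<iota>_ak[of AKzeta] Q.zet_eq[of i] by (simp add: Phi_gen ak_gens_def)
  have Phi_ab: "\<iota> (ak g (AKa i)) = Phi k n X c (\<beta> (Al i)) \<and> \<iota> (ak g (AKb i)) = Phi k n X c (\<beta> (Be i))"
    if "i \<in> {1..g}" for i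
    using that \<iota>_ak[of "AKa i"] \<iota>_ak[of "AKb i"] by (simp add: Phi_gen ak_gens_def)
  have ex: "\<exists>f. is_Phi_Sigma k n g X c \<beta> f"
  proof -
    define \<phi> where "\<phi> s = (case s of Sig i \<Rightarrow> ak g AKsigma | Zet i \<Rightarrow> ak g AKzeta
      | Al i \<Rightarrow> ak g (AKa i) | Be i \<Rightarrow> ak g (AKb i) | _ \<Rightarrow> \<one>\<^bsub>G_Sigma g\<^esub>)" for s
    obtain J where J: "J \<in> hom (G_Sigma g) (heis g)" "inj_on J (carrier (G_Sigma g))"
      "\<And>x. x \<in> ak_gens g \<Longrightarrow> J (ak g x) = heis_gen (ak_bgen x)" using G_Sigma_heis[of g] by blast
    have \<phi>: "\<phi> \<in> gens_fibre k n g \<rightarrow> carrier (G_Sigma g)"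
      by (auto simp: \<phi>_def gens_fibre_def ak_def cS ak_gens_def)
    \<comment> \<open>The relations of the fibre group need not be derived from those of An and Ko:
      after the injective \<open>J\<close> they are relations among the \<open>heis_gen\<close>,
      which have already been verified.\<close>
    have J\<phi>: "J (weval (G_Sigma g) \<phi> u) = weval (heis g) heis_gen u" if "u \<in> words (gens_fibre k n g)" for u
    proof -
      have "J (weval (G_Sigma g) \<phi> u) = weval (heis g) (J \<circ> \<phi>) u"
        by (rule hom_weval[OF \<iota>.G.is_group group_heis J(1) \<phi> that])
      also have "\<dots> = weval (heis g) heis_gen u"
        using that by (rule weval_cong) (auto simp: gens_fibre_def \<phi>_def J(3) ak_gens_def)
      finally show ?thesis .
    qed
    obtain f where f: "f \<in> hom F (G_Sigma g)" "\<And>s. s \<in> gens_fibre k n g \<Longrightarrow> f (\<beta> s) = \<phi> s"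
    proof (rule presents_hom[OF pF \<iota>.G.is_group \<phi>])
      fix u v assume uv: "(u, v) \<in> rels_fibre k n g" "u \<in> words (gens_fibre k n g)" "v \<in> words (gens_fibre k n g)"
      then have "J (weval (G_Sigma g) \<phi> u) = J (weval (G_Sigma g) \<phi> v)"
        using heis_gen_rels_mixed[of u v k n g] by (simp add: J\<phi> rels_mixed_def)
      then show "weval (G_Sigma g) \<phi> u = weval (G_Sigma g) \<phi> v"
        using J(2) \<iota>.G.weval_closed[OF \<phi>] uv by (simp add: inj_on_eq_iff)
    qed blast
    then have "is_Phi_Sigma k n g X c \<beta> f" by (simp add: is_Phi_Sigma_def F_def \<phi>_def)
    then show ?thesis by blast
  qed
  have comp: "\<iota> (f x) = Phi k n X c x"
    if f: "is_Phi_Sigma k n g X c \<beta> f" and x: "x \<in> carrier (fibre_braid_group k n X c)" for f x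
  proof -
    \<comment> \<open>Both sides are homomorphisms on the fibre group and agree on its generators,
      which also makes the identity valid for every admissible \<open>f\<close>.\<close>
    have "(\<iota> \<circ> f) x = (rho B \<circ> fibre_incl k n X c) x"
    proof (rule presents_hom_eq[OF pF \<rho>.H.is_group])
      show "\<iota> \<circ> f \<in> hom F Q" using f \<iota> by (auto simp: is_Phi_Sigma_def F_def intro: hom_compose)
      show "rho B \<circ> fibre_incl k n X c \<in> hom F Q" by (rule hom_compose[OF i.homh \<rho>.homh])
      show "(\<iota> \<circ> f) (\<beta> s) = (rho B \<circ> fibre_incl k n X c) (\<beta> s)" if "s \<in> gens_fibre k n g" for s
      proof -
        have "\<iota> (f (\<beta> s)) = Phi k n X c (\<beta> s)"
          using that f Phi_ak Phi_zet Phi_ab by (auto simp: gens_fibre_def is_Phi_Sigma_def)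
        then show ?thesis by (simp add: Phi)
      qed
    qed (use x in \<open>simp add: F_def\<close>)
    then show ?thesis by (simp add: Phi)
  qed
  show ?thesis
    by (intro bexI[OF _ iso] conjI ballI allI impI Phi_ak Phi_zet Phi_ab[THEN conjunct1]
        Phi_ab[THEN conjunct2] ex comp)
qed

end
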